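(* Let $1<p<\infty$, $T>0$, and let $\Theta\subset\mathbb{R}^l$ be a nonempty compact set. Let $F_0,F_1,\dots,F_k:\mathbb{R}^d\times\Theta\to\mathbb{R}^d$ be such that, for some $L>0$, $$\sup_{i=0,\dots,k}|F_i(x_1,\theta_1)-F_i(x_2,\theta_2)|_2\le L\big(|x_1-x_2|_2+|x_1+x_2|_2\,|\theta_1-\theta_2|_2\big)$$ for all $(x_1,\theta_1),(x_2,\theta_2)\in\mathbb{R}^d\times\Theta$; let $x_0:\Theta\to\mathbb{R}^d$ be continuous; let $a:\mathbb{R}^d\times\Theta\to[0,+\infty)$ be continuous; and let $f:[0,T]\times\mathbb{R}^k\to\mathbb{R}$ satisfy: (i) $f(\cdot,u)$ is measurable for every $u\in\mathbb{R}^k$; (ii) $f(t,\cdot)$ is continuous and convex for a.e. $t\in[0,T]$; (iii) there exist $c\in L^1([0,T],[0,+\infty))$ and $C>0$ such that $f(t,u)\ge C|u|_2^p-c(t)$ for a.e. $t\in[0,T]$ and every $u\in\mathbb{R}^k$; (iv) there exist $u'\in\mathbb{R}^k$ and $c'\in L^1([0,T],[0,+\infty))$ such that $|f(t,u')|\le c'(t)$ for a.e. $t\in[0,T]$. Assume moreover that the derivatives $(x,\theta)\mapsto\frac{\partial}{\partial x}F_i(x,\theta)$, $i=0,\dots,k$, and the gradient $(x,\theta)\mapsto\nabla_xa(x,\theta)$ exist and are continuous on $\mathbb{R}^d\times\Theta$. Let $\mathcal{U}:=L^p([0,T],\mathbb{R}^k)$ and let $u^*\in\mathcal{U}$ be a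 local minimizer (with respect to the $L^p$-norm) of the functional $\mathcal{J}:\mathcal{U}\to\mathbb{R}\cup\{+\infty\}$, $$\mathcal{J}(u):=\max_{\theta\in\Theta}a(X_u(T,\theta),\theta)+\int_0^Tf(t,u(t))\,dt,$$ and let $X:=X_{u^*}:[0,T]\times\Theta\to\mathbb{R}^d$ and $\Lambda:=\Lambda_{u^*}:[0,T]\times\Theta\to(\mathbb{R}^d)^*$ be the state and adjoint maps corresponding to $u^*$ (defined in the context). Then there exists a Borel probability measure $\mu\in\mathcal{P}(\Theta)$ such that, for a.e. $t\in[0,T]$, $$u^*(t)\in\arg\max_{v\in\mathbb{R}^k}\left\{\int_\Theta\Lambda(t,\theta)\cdot F(X(t,\theta),\theta)\cdot v\,d\mu(\theta)-f(t,v)\right\},$$ and $$\theta\in\mathrm{supp}(\mu)\implies a(X(T,\theta),\theta)=\max_{\vartheta\in\Theta}a(X(T,\vartheta),\vartheta).$$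
   Context: Write $F=(F_1,\dots,F_k):\mathbb{R}^d\times\Theta\to\mathbb{R}^{d\times k}$. For $u\in\mathcal{U}$ and $\theta\in\Theta$, $x_u^\theta:[0,T]\to\mathbb{R}^d$ denotes the (Carathéodory, absolutely continuous) solution of $\dot x(t)=F_0(x(t),\theta)+F(x(t),\theta)u(t)$ for a.e. $t\in[0,T]$, $x(0)=x_0(\theta)$, and $X_u(t,\theta):=x_u^\theta(t)$. For $u=(u_1,\dots,u_k)\in\mathcal{U}$ and $\theta\in\Theta$, $\lambda_u^\theta:[0,T]\to(\mathbb{R}^d)^*$ (a row vector) is the unique Carathéodory solution of $$\dot\lambda_u^\theta(t)=-\lambda_u^\theta(t)\left(\frac{\partial F_0(x_u^\theta(t),\theta)}{\partial x}+\sum_{i=1}^ku_i(t)\frac{\partial F_i(x_u^\theta(t),\theta)}{\partial x}\right),\qquad\lambda_u^\theta(T)=-\nabla_xa(x_u^\theta(T),\theta),$$ and $\Lambda_u(t,\theta):=\lambda_u^\theta(t)$. $\mathcal{P}(\Theta)$ is the set of Borel probability measures on $\Theta$. *)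

theory Defs
  imports "HOL-Analysis.Analysis"
begin

text \<open>
  The family \<open>K \<in> D\<close> of a division ranges over finitely many non-overlapping compact
  subintervals \<open>K = {Inf K..Sup K}\<close>, so this is the usual epsilon-delta definition.
\<close>
definition absolutely_cont_on :: "real \<Rightarrow> real \<Rightarrow> (real \<Rightarrow> 'a::real_normed_vector) \<Rightarrow> bool" where
  "absolutely_cont_on a b x \<longleftrightarrow>
     (\<forall>e>0. \<exists>\<delta>>0. \<forall>D S. D division_of S \<and> S \<subseteq> {a..b} \<and> (\<Sum>K\<in>D. Sup K - Inf K) < \<delta>
        \<longrightarrow> (\<Sum>K\<in>D. norm (x (Sup K) - x (Inf K))) < e)"

definition caratheodory_solution ::
    "real \<Rightarrow> (real \<Rightarrow> 'a::real_normed_vector \<Rightarrow> 'a) \<Rightarrow> (real \<Rightarrow> 'a) \<Rightarrow> bool" where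
  "caratheodory_solution T g x \<longleftrightarrow> absolutely_cont_on 0 T x \<and>
     (AE t in lebesgue_on {0..T}. (x has_vector_derivative g t (x t)) (at t within {0..T}))"

text \<open>Elements of \<open>L\<^sup>p([0,T])\<close> are represented by measurable functions; nothing below
  depends on the representative or on the values outside \<open>[0,T]\<close>.\<close>
definition Lp_space :: "real \<Rightarrow> real \<Rightarrow> (real \<Rightarrow> 'a::euclidean_space) set" where
  "Lp_space p T = {u. u \<in> borel_measurable (lebesgue_on {0..T}) \<and>
                      integrable (lebesgue_on {0..T}) (\<lambda>t. norm (u t) powr p)}"

definition Lp_norm :: "real \<Rightarrow> real \<Rightarrow> (real \<Rightarrow> 'a::euclidean_space) \<Rightarrow> real" where
  "Lp_norm p T u = (LINT t|lebesgue_on {0..T}. norm (u t) powr p) powr (1 / p)"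

definition gradient :: "('a::real_inner \<Rightarrow> real) \<Rightarrow> 'a \<Rightarrow> 'a" where
  "gradient g x = (THE D. GDERIV g x :> D)"

text \<open>The matrix whose columns are the controlled fields \<open>F\<^sub>1, \<dots>, F\<^sub>k\<close>.\<close>
definition field_matrix :: "('k::finite \<Rightarrow> real^'d \<Rightarrow> 'p \<Rightarrow> real^'d) \<Rightarrow> real^'d \<Rightarrow> 'p \<Rightarrow> real^'k^'d" where
  "field_matrix F x \<theta> = (\<chi> r i. F i x \<theta> $ r)"

text \<open>
  \<open>state_map F0 F x0 T u t \<theta>\<close> is the value at time \<open>t\<close> of the trajectory for control \<open>u\<close>
  and parameter \<open>\<theta>\<close>, and \<open>adjoint_map\<close> the corresponding adjoint (a row vector).
  For vector fields that are globally Lipschitz in the state, and controls in \<open>L\<^sup>p\<close>, solutions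
  exist and are unique on \<open>[0,T]\<close>, so the choice is immaterial there; values outside
  \<open>[0,T]\<close> are irrelevant.
\<close>
definition state_map ::
    "(real^'d \<Rightarrow> 'p \<Rightarrow> real^'d) \<Rightarrow> ('k::finite \<Rightarrow> real^'d \<Rightarrow> 'p \<Rightarrow> real^'d) \<Rightarrow> ('p \<Rightarrow> real^'d) \<Rightarrow>
     real \<Rightarrow> (real \<Rightarrow> real^'k) \<Rightarrow> real \<Rightarrow> 'p \<Rightarrow> real^'d" where
  "state_map F0 F x0 T u t \<theta> =
     (SOME x. caratheodory_solution T (\<lambda>s y. F0 y \<theta> + field_matrix F y \<theta> *v u s) x \<and>
              x 0 = x0 \<theta>) t"

definition adjoint_map ::
    "(real^'d \<Rightarrow> 'p \<Rightarrow> real^'d) \<Rightarrow> ('k::finite \<Rightarrow> real^'d \<Rightarrow> 'p \<Rightarrow> real^'d) \<Rightarrow> ('p \<Rightarrow> real^'d) \<Rightarrow>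
     (real^'d \<Rightarrow> 'p \<Rightarrow> real) \<Rightarrow> real \<Rightarrow> (real \<Rightarrow> real^'k) \<Rightarrow> real \<Rightarrow> 'p \<Rightarrow> real^'d" where
  "adjoint_map F0 F x0 a T u t \<theta> =
     (SOME l. caratheodory_solution T
                (\<lambda>s y. - (y v* (jacobian (\<lambda>z. F0 z \<theta>) (at (state_map F0 F x0 T u s \<theta>)) +
                       (\<Sum>i\<in>UNIV. u s $ i *\<^sub>R
                          jacobian (\<lambda>z. F i z \<theta>) (at (state_map F0 F x0 T u s \<theta>)))))) l \<and>
              l T = - gradient (\<lambda>z. a z \<theta>) (state_map F0 F x0 T u T \<theta>)) t"

text \<open>
  The Lebesgue integral with values in \<open>[-\<infinity>,\<infinity>]\<close>: integral of the positive part minus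
  integral of the negative part. (\<open>ennreal\<close> maps negative reals to 0.) The cost below has an
  integrable negative part, so the value \<open>\<infinity> - \<infinity>\<close> does not arise.
\<close>
definition extended_integral :: "'b measure \<Rightarrow> ('b \<Rightarrow> real) \<Rightarrow> ereal" where
  "extended_integral M g =
     enn2ereal (\<integral>\<^sup>+ t. ennreal (g t) \<partial>M) - enn2ereal (\<integral>\<^sup>+ t. ennreal (- g t) \<partial>M)"

text \<open>The maximum over the compact set \<open>\<Theta>\<close> is written as a supremum, which is attained
  because the end-point cost is continuous in \<open>\<theta>\<close>.\<close>
definition cost_functional ::
    "(real^'d \<Rightarrow> 'p \<Rightarrow> real^'d) \<Rightarrow> ('k::finite \<Rightarrow> real^'d \<Rightarrow> 'p \<Rightarrow> real^'d) \<Rightarrow> ('p \<Rightarrow> real^'d) \<Rightarrow>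
     (real^'d \<Rightarrow> 'p \<Rightarrow> real) \<Rightarrow> (real \<Rightarrow> real^'k \<Rightarrow> real) \<Rightarrow> real \<Rightarrow> 'p set \<Rightarrow>
     (real \<Rightarrow> real^'k) \<Rightarrow> ereal" where
  "cost_functional F0 F x0 a f T \<Theta> u =
     ereal (SUP \<theta>\<in>\<Theta>. a (state_map F0 F x0 T u T \<theta>) \<theta>) +
     extended_integral (lebesgue_on {0..T}) (\<lambda>t. f t (u t))"

definition Lp_local_minimizer ::
    "real \<Rightarrow> real \<Rightarrow> ((real \<Rightarrow> 'a::euclidean_space) \<Rightarrow> ereal) \<Rightarrow> (real \<Rightarrow> 'a) \<Rightarrow> bool" where
  "Lp_local_minimizer p T J u \<longleftrightarrow> u \<in> Lp_space p T \<and>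
     (\<exists>e>0. \<forall>v\<in>Lp_space p T. Lp_norm p T (\<lambda>t. v t - u t) < e \<longrightarrow> J u \<le> J v)"

text \<open>Borel probability measures on the subspace \<open>\<Theta>\<close>; the underlying space is \<open>\<Theta>\<close> itself.\<close>
definition borel_prob_measures :: "'p::topological_space set \<Rightarrow> 'p measure set" where
  "borel_prob_measures \<Theta> = {\<mu>. sets \<mu> = sets (restrict_space borel \<Theta>) \<and> emeasure \<mu> (space \<mu>) = 1}"

definition measure_support :: "'p::topological_space measure \<Rightarrow> 'p set" where
  "measure_support \<mu> = {\<theta> \<in> space \<mu>. \<forall>U. open U \<and> \<theta> \<in> U \<longrightarrow> emeasure \<mu> (U \<inter> space \<mu>) > 0}"

end

theory Submission
  imports Defs "HOL-Probability.Probability"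
begin

text \<open>
  Perturb \<open>ustar\<close> to \<open>ustar + \<epsilon> w\<close> along directions \<open>w\<close> of finite running cost. Pairing the state variation with
  the adjoint shows that the end-point cost of the parameter \<open>\<theta>\<close> changes by
  \<open>- \<epsilon> \<integral> \<Lambda> F w dt + o(\<epsilon>)\<close>, uniformly in \<open>\<theta>\<close>. Convexity of \<open>f\<close> bounds the change of the running cost by \<open>\<epsilon>\<close>
  times the full increment, so local minimality yields, for every direction, a parameter maximizing the end-point
  cost for which increment minus \<open>\<integral> \<Lambda> F w dt\<close> is nonnegative. The increment is convex in \<open>w\<close>, so a minimax argument
  replaces these parameters by one probability measure on the maximizers that works for countably many
  directions at once. Taking \<open>w\<close> to be \<open>v - ustar\<close> on rational time intervals, with \<open>v\<close> in a countable dense set,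
  localizes the integral inequality to almost every time.
\<close>

section \<open>Absolute continuity and the fundamental theorem of calculus\<close>

text \<open>The obstacle is the maximum over \<open>\<Theta>\<close> in the cost: the parameter that
  witnesses minimality depends on the direction, and no single one need serve all of them. A mixture
  does. Mixtures are found as weak limits of empirical measures; a continuous curve through the
  whole parameter set pulls these back to the line, where Helly's theorem gives the compactness. The
  dynamics is affine and the running cost convex in the control, so a direction need not be small or
  live on a short interval: every direction of finite cost may be scaled by
  \<open>\<epsilon>\<close>. This lets the minimax step form convex combinations of directions.
  Since \<open>f t v\<close> is merely measurable in \<open>t\<close>, moving to a constant
  \<open>v\<close> can cost infinitely much. Times with \<open>\<bar>f t v\<bar> > n\<close> are
  therefore left unchanged, and \<open>n\<close> is chosen at each time separately at the end. The
  expansion must be uniform in \<open>\<theta>\<close>, because the parameter that is worst for the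
  perturbed control moves with \<open>\<epsilon>\<close>. Every constant therefore comes from
  Gronwall's inequality along a compact set of trajectories.\<close>

lemma division_interval_real:
  fixes K :: "real set"
  assumes "D division_of S" "K \<in> D"
  obtains u v where "u \<le> v" "K = {u..v}" "Inf K = u" "Sup K = v"
proof -
  obtain u v where uv: "K = cbox u v" "K \<noteq> {}"
    using division_ofD(3,4)[OF assms] by metis
  then have "u \<le> v" by auto
  with uv that show ?thesis by (metis box_real(2) cInf_atLeastAtMost cSup_atLeastAtMost)
qed

lemma absolutely_cont_on_subset:
  assumes "absolutely_cont_on a b x" "{c..d} \<subseteq> {a..b}"
  shows "absolutely_cont_on c d x"
  using assms unfolding absolutely_cont_on_def by (meson order_trans)

lemma absolutely_cont_on_imp_continuous_on:
  fixes x :: "real \<Rightarrow> 'a::real_normed_vector"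
  assumes "absolutely_cont_on a b x"
  shows "continuous_on {a..b} x"
  unfolding continuous_on_iff
proof (intro ballI allI impI)
  fix s e :: real assume s: "s \<in> {a..b}" and "e > 0"
  then obtain d where d: "d > 0" "\<And>D S. \<lbrakk>D division_of S; S \<subseteq> {a..b}; (\<Sum>K\<in>D. Sup K - Inf K) < d\<rbrakk>
      \<Longrightarrow> (\<Sum>K\<in>D. norm (x (Sup K) - x (Inf K))) < e"
    using assms unfolding absolutely_cont_on_def by metis
  have key: "norm (x v - x u) < e" if "u \<in> {a..b}" "v \<in> {a..b}" "u \<le> v" "v - u < d" for u v
  proof -
    have "{{u..v}} division_of {u..v}"
      using that division_of_self[of u v] by auto
    from d(2)[OF this] that show ?thesis by auto
  qed
  show "\<exists>d>0. \<forall>t\<in>{a..b}. dist t s < d \<longrightarrow> dist (x t) (x s) < e"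
  proof (intro exI[of _ d] conjI ballI impI d)
    fix t assume t: "t \<in> {a..b}" "dist t s < d"
    show "dist (x t) (x s) < e"
      using key[of s t] key[of t s] s t
      by (cases "s \<le> t") (auto simp: dist_norm norm_minus_commute)
  qed
qed

text \<open>Reduces all closure properties to one estimate of increments: the sums over a division
  inherit it term by term. Unary operations use it with \<open>x = y\<close>.\<close>

lemma absolutely_cont_on_bound:
  assumes x: "absolutely_cont_on a b x" and y: "absolutely_cont_on a b y"
    and bd: "\<And>s t. s \<in> {a..b} \<Longrightarrow> t \<in> {a..b} \<Longrightarrow>
               norm (z t - z s) \<le> M * (norm (x t - x s) + norm (y t - y s))"
  shows "absolutely_cont_on a b z"
  unfolding absolutely_cont_on_def
proof (intro allI impI)
  fix e :: real assume "e > 0"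
  \<comment> \<open>\<open>M\<close> may be zero or negative, so the factor used is
    \<open>\<bar>M\<bar> + 1\<close>, which is positive; 2 counts the two functions.\<close>
  define e' where "e' = e / (2 * (\<bar>M\<bar> + 1))"
  have e': "e' > 0" using \<open>e > 0\<close> by (auto simp: e'_def)
  obtain d1 where d1: "d1 > 0" "\<And>D S. \<lbrakk>D division_of S; S \<subseteq> {a..b}; (\<Sum>K\<in>D. Sup K - Inf K) < d1\<rbrakk>
      \<Longrightarrow> (\<Sum>K\<in>D. norm (x (Sup K) - x (Inf K))) < e'"
    using x e' unfolding absolutely_cont_on_def by metis
  obtain d2 where d2: "d2 > 0" "\<And>D S. \<lbrakk>D division_of S; S \<subseteq> {a..b}; (\<Sum>K\<in>D. Sup K - Inf K) < d2\<rbrakk>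
      \<Longrightarrow> (\<Sum>K\<in>D. norm (y (Sup K) - y (Inf K))) < e'"
    using y e' unfolding absolutely_cont_on_def by metis
  show "\<exists>\<delta>>0. \<forall>D S. D division_of S \<and> S \<subseteq> {a..b} \<and> (\<Sum>K\<in>D. Sup K - Inf K) < \<delta>
        \<longrightarrow> (\<Sum>K\<in>D. norm (z (Sup K) - z (Inf K))) < e"
  proof (intro exI[of _ "min d1 d2"] conjI allI impI)
    show "0 < min d1 d2" using d1(1) d2(1) by simp
    fix D S assume D: "D division_of S \<and> S \<subseteq> {a..b} \<and> (\<Sum>K\<in>D. Sup K - Inf K) < min d1 d2"
    have "norm (z (Sup K) - z (Inf K))
        \<le> (\<bar>M\<bar> + 1) * (norm (x (Sup K) - x (Inf K)) + norm (y (Sup K) - y (Inf K)))" if K: "K \<in> D" for K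
    proof -
      obtain u v where uv: "u \<le> v" "K = {u..v}" "Inf K = u" "Sup K = v"
        using division_interval_real D K by metis
      have "K \<subseteq> {a..b}" using D K by (meson division_ofD(2) order_trans)
      then have "u \<in> {a..b}" "v \<in> {a..b}" using uv by auto
      then have "norm (z v - z u) \<le> M * (norm (x v - x u) + norm (y v - y u))" by (intro bd)
      also have "\<dots> \<le> (\<bar>M\<bar> + 1) * (norm (x v - x u) + norm (y v - y u))"
        by (intro mult_right_mono) auto
      finally show ?thesis using uv by simp
    qed
    then have "(\<Sum>K\<in>D. norm (z (Sup K) - z (Inf K)))
        \<le> (\<Sum>K\<in>D. (\<bar>M\<bar> + 1) * (norm (x (Sup K) - x (Inf K)) + norm (y (Sup K) - y (Inf K))))"
      by (rule sum_mono)
    also have "\<dots> = (\<bar>M\<bar> + 1) * ((\<Sum>K\<in>D. norm (x (Sup K) - x (Inf K))) + (\<Sum>K\<in>D. norm (y (Sup K) - y (Inf K))))"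
      by (simp add: sum_distrib_left sum.distrib distrib_left)
    also have "\<dots> < (\<bar>M\<bar> + 1) * (e' + e')"
      using d1(2)[of D S] d2(2)[of D S] D by (intro mult_strict_left_mono add_strict_mono) auto
    also have "\<dots> = e"
      using abs_ge_zero[of M] by (simp add: e'_def nonzero_divide_eq_eq add_nonneg_eq_0_iff)
    finally show "(\<Sum>K\<in>D. norm (z (Sup K) - z (Inf K))) < e" .
  qed
qed

lemma absolutely_cont_on_bounded:
  assumes "absolutely_cont_on a b x"
  obtains M where "M \<ge> 0" "\<And>t. t \<in> {a..b} \<Longrightarrow> norm (x t) \<le> M"
proof -
  have "bounded (x ` {a..b})"
    using absolutely_cont_on_imp_continuous_on[OF assms]
    by (intro compact_imp_bounded compact_continuous_image) auto
  then show ?thesis using that by (metis bounded_pos image_eqI less_imp_le)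
qed

lemma absolutely_cont_on_inner:
  fixes x y :: "real \<Rightarrow> 'a::real_inner"
  assumes x: "absolutely_cont_on a b x" and y: "absolutely_cont_on a b y"
  shows "absolutely_cont_on a b (\<lambda>t. x t \<bullet> y t)"
proof -
  obtain M where M: "M \<ge> 0" "\<And>t. t \<in> {a..b} \<Longrightarrow> norm (x t) \<le> M"
    using absolutely_cont_on_bounded[OF x] by blast
  obtain N where N: "N \<ge> 0" "\<And>t. t \<in> {a..b} \<Longrightarrow> norm (y t) \<le> N"
    using absolutely_cont_on_bounded[OF y] by blast
  show ?thesis
  proof (rule absolutely_cont_on_bound[OF x y, where M = "M + N"])
    fix s t assume st: "s \<in> {a..b}" "t \<in> {a..b}"
    have "x t \<bullet> y t - x s \<bullet> y s = (x t - x s) \<bullet> y t + x s \<bullet> (y t - y s)"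
      by (simp add: inner_diff_left inner_diff_right)
    also have "norm \<dots> \<le> norm (x t - x s) * norm (y t) + norm (x s) * norm (y t - y s)"
      by (intro norm_triangle_le add_mono) (simp_all add: Cauchy_Schwarz_ineq2)
    also have "\<dots> \<le> norm (x t - x s) * N + M * norm (y t - y s)"
      using st M N by (intro add_mono mult_mono) auto
    also have "\<dots> \<le> (M + N) * (norm (x t - x s) + norm (y t - y s))"
      using M N by (simp add: algebra_simps)
    finally show "norm (x t \<bullet> y t - x s \<bullet> y s) \<le> (M + N) * (norm (x t - x s) + norm (y t - y s))" .
  qed
qed

lemma absolutely_cont_on_diff:
  assumes x: "absolutely_cont_on a b x" and y: "absolutely_cont_on a b y"
  shows "absolutely_cont_on a b (\<lambda>t. x t - y t)"
proof (rule absolutely_cont_on_bound[OF x y, where M = 1])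
  fix s t
  have "(x t - y t) - (x s - y s) = (x t - x s) - (y t - y s)" by simp
  then show "norm ((x t - y t) - (x s - y s)) \<le> 1 * (norm (x t - x s) + norm (y t - y s))"
    by (metis mult_1 norm_triangle_ineq4)
qed

lemma absolutely_cont_on_exp:
  fixes x :: "real \<Rightarrow> real"
  assumes x: "absolutely_cont_on a b x"
  shows "absolutely_cont_on a b (\<lambda>t. exp (x t))"
proof -
  obtain M where M: "M \<ge> 0" "\<And>t. t \<in> {a..b} \<Longrightarrow> norm (x t) \<le> M"
    using absolutely_cont_on_bounded[OF x] by blast
  show ?thesis
  proof (rule absolutely_cont_on_bound[OF x x, where M = "exp M"])
    fix s t assume st: "s \<in> {a..b}" "t \<in> {a..b}"
    have "norm (exp (x t) - exp (x s)) \<le> exp M * norm (x t - x s)"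
    proof (rule differentiable_bound[of "{-M..M}" exp "\<lambda>x h. exp x * h"])
      show "onorm ((*) (exp u)) \<le> exp M" if "u \<in> {-M..M}" for u
        using that by (intro onorm_le) (auto simp: abs_mult intro!: mult_right_mono)
      show "(exp has_derivative (*) (exp u)) (at u within {- M..M})" for u
        using DERIV_exp[of u] by (auto simp: has_field_derivative_def intro: has_derivative_at_withinI)
      show "x t \<in> {-M..M}" "x s \<in> {-M..M}" using M(2)[of t] M(2)[of s] st by auto
    qed auto
    also have "\<dots> \<le> exp M * (norm (x t - x s) + norm (x t - x s))"
      by (intro mult_left_mono) auto
    finally show "norm (exp (x t) - exp (x s)) \<le> exp M * (norm (x t - x s) + norm (x t - x s))" .
  qed
qed

section \<open>The fundamental theorem of calculus in both directions\<close>

lemma measure_division: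
  fixes S :: "'a::euclidean_space set"
  assumes D: "D division_of S"
  shows "S \<in> lmeasurable" "measure lebesgue S = (\<Sum>K\<in>D. measure lborel K)"
proof -
  have "((\<lambda>_. 1::real) has_integral measure lborel K) K" if "K \<in> D" for K
    using division_ofD(4)[OF D that] has_integral_const[of "1::real"] by fastforce
  then have *: "((\<lambda>_. 1::real) has_integral (\<Sum>K\<in>D. measure lborel K)) S"
    by (intro has_integral_combine_division[OF D])
  then show S: "S \<in> lmeasurable"
    by (simp add: has_integral_integrable lmeasurable_iff_integrable_on)
  show "measure lebesgue S = (\<Sum>K\<in>D. measure lborel K)"
    using * S by (simp add: lmeasure_integral integral_unique)
qed

text \<open>Straddle gauges handle the points of differentiability; the exceptional tags lie in an open set
  of small measure, where absolute continuity controls the increments of \<open>x\<close>.\<close>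
theorem absolutely_cont_on_has_integral:
  fixes x :: "real \<Rightarrow> 'a::euclidean_space"
  assumes "a \<le> b" and x: "absolutely_cont_on a b x" and N: "negligible N"
    and deriv: "\<And>t. t \<in> {a..b} - N \<Longrightarrow> (x has_vector_derivative g t) (at t within {a..b})"
  shows "(g has_integral x b - x a) {a..b}"
proof -
  \<comment> \<open>With value 0 on \<open>N\<close> the Riemann terms at exceptional tags vanish,
    and only the increments of \<open>x\<close> remain there.\<close>
  define g' where "g' t = (if t \<in> N then 0 else g t)" for t
  have "(g' has_integral x b - x a) (cbox a b)"
    unfolding has_integral
  proof (intro allI impI)
    fix e :: real assume "e > 0"
    define e' where "e' = e / (2 * (b - a + 1))"
    have e': "e' > 0" using \<open>e > 0\<close> \<open>a \<le> b\<close> by (auto simp: e'_def)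
    have "\<exists>d>0. \<forall>y\<in>{a..b}. norm (y - t) < d \<longrightarrow>
        norm (x y - x t - (y - t) *\<^sub>R g t) \<le> e' * norm (y - t)" if "t \<in> {a..b} - N" for t
      using deriv[OF that] e'
      unfolding has_vector_derivative_def has_derivative_within_alt by auto
    then obtain d where d: "\<And>t. t \<in> {a..b} - N \<Longrightarrow> d t > 0"
      "\<And>t y. \<lbrakk>t \<in> {a..b} - N; y \<in> {a..b}; norm (y - t) < d t\<rbrakk> \<Longrightarrow>
        norm (x y - x t - (y - t) *\<^sub>R g t) \<le> e' * norm (y - t)" by metis
    obtain \<delta> where \<delta>: "\<delta> > 0" "\<And>D S. \<lbrakk>D division_of S; S \<subseteq> {a..b}; (\<Sum>K\<in>D. Sup K - Inf K) < \<delta>\<rbrakk>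
      \<Longrightarrow> (\<Sum>K\<in>D. norm (x (Sup K) - x (Inf K))) < e/2"
      using x \<open>e > 0\<close> unfolding absolutely_cont_on_def by (metis half_gt_zero)
    obtain V where V: "open V" "N \<subseteq> V" "V - N \<in> lmeasurable" "emeasure lebesgue (V - N) < ennreal \<delta>"
      using sets_lebesgue_outer_open[OF negligible_imp_sets[OF N] \<delta>(1)] by metis
    have Vm: "V \<in> lmeasurable"
      using V N by (metis Diff_partition fmeasurable.Un negligible_imp_measurable)
    have "measure lebesgue (V - N) < \<delta>"
      using V(3,4) \<delta>(1) by (simp add: emeasure_eq_measure2 ennreal_less_iff)
    moreover have "measure lebesgue V = measure lebesgue (V - N)"
      using N by (metis measure_Diff_null_set negligible_iff_null_sets fmeasurableD Vm)
    ultimately have Vd: "measure lebesgue V < \<delta>" by simp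
    define \<gamma> where "\<gamma> t = (if t \<in> N then V else if t \<in> {a..b} then ball t (d t) else UNIV)" for t
    have "gauge \<gamma>"
      using V d unfolding gauge_def \<gamma>_def by auto
    show "\<exists>\<gamma>. gauge \<gamma> \<and> (\<forall>\<D>. \<D> tagged_division_of cbox a b \<and> \<gamma> fine \<D> \<longrightarrow>
              norm ((\<Sum>(t, K)\<in>\<D>. measure lborel K *\<^sub>R g' t) - (x b - x a)) < e)"
    proof (intro exI[of _ \<gamma>] conjI allI impI \<open>gauge \<gamma>\<close>)
      fix \<D> assume "\<D> tagged_division_of cbox a b \<and> \<gamma> fine \<D>"
      then have \<D>: "\<D> tagged_division_of cbox a b" and fine: "\<gamma> fine \<D>" by auto
      have fin: "finite \<D>" using \<D> by auto
      have K: "\<exists>u v. u \<le> t \<and> t \<le> v \<and> a \<le> u \<and> v \<le> b \<and> K = {u..v} \<and> Inf K = u \<and> Sup K = v \<and> measure lborel K = v - u"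
        if tK: "(t, K) \<in> \<D>" for t K
      proof -
        obtain u v where "K = cbox u v" using tagged_division_ofD(4)[OF \<D> tK] by auto
        moreover have "t \<in> K" "K \<subseteq> cbox a b" using tagged_division_ofD(2,3)[OF \<D> tK] by auto
        ultimately show ?thesis by (intro exI[of _ u] exI[of _ v]) auto
      qed
      have tele: "(\<Sum>(t, K)\<in>\<D>. x (Sup K) - x (Inf K)) = x b - x a"
        using additive_tagged_division_1[OF \<open>a \<le> b\<close>, of \<D> x] \<D> by simp
      define \<D>1 where "\<D>1 = {(t, K) \<in> \<D>. t \<in> N}"
      define \<D>2 where "\<D>2 = {(t, K) \<in> \<D>. t \<notin> N}"
      have fins: "finite \<D>1" "finite \<D>2"
        using fin by (auto simp: \<D>1_def \<D>2_def intro: rev_finite_subset)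
      have split: "sum h \<D> = sum h \<D>1 + sum h \<D>2" for h :: "real \<times> real set \<Rightarrow> real"
        unfolding \<D>1_def \<D>2_def
        by (subst sum.union_disjoint[symmetric]) (use fin in \<open>auto intro!: sum.cong intro: rev_finite_subset\<close>)
      let ?h = "\<lambda>(t, K). norm (measure lborel K *\<^sub>R g' t - (x (Sup K) - x (Inf K)))"
      have "norm ((\<Sum>(t, K)\<in>\<D>. measure lborel K *\<^sub>R g' t) - (x b - x a))
          = norm (\<Sum>(t, K)\<in>\<D>. measure lborel K *\<^sub>R g' t - (x (Sup K) - x (Inf K)))"
        by (simp add: tele[symmetric] sum_subtractf split_def)
      also have "\<dots> \<le> sum ?h \<D>"
        by (rule order_trans[OF norm_sum]) (simp add: split_def)
      also have "\<dots> = sum ?h \<D>1 + sum ?h \<D>2" by (rule split)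
      also have "sum ?h \<D>2 \<le> (\<Sum>(t, K)\<in>\<D>2. e' * measure lborel K)"
      proof (rule sum_mono, clarify)
        fix t K assume tK: "(t, K) \<in> \<D>2"
        then have tKD: "(t, K) \<in> \<D>" "t \<notin> N" by (auto simp: \<D>2_def)
        obtain u v where uv: "u \<le> t" "t \<le> v" "a \<le> u" "v \<le> b" "K = {u..v}" "Inf K = u" "Sup K = v" "measure lborel K = v - u"
          using K[OF tKD(1)] by auto
        have t: "t \<in> {a..b} - N" using uv tKD by auto
        have "K \<subseteq> ball t (d t)"
          using fine tKD t unfolding fine_def \<gamma>_def by fastforce
        moreover have "u \<in> K" "v \<in> K" using uv by auto
        ultimately have "u \<in> ball t (d t)" "v \<in> ball t (d t)" by blast+
        then have 12: "norm (x u - x t - (u - t) *\<^sub>R g t) \<le> e' * norm (u - t)"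
          "norm (x v - x t - (v - t) *\<^sub>R g t) \<le> e' * norm (v - t)"
          using d(2)[OF t, of u] d(2)[OF t, of v] uv by (auto simp: dist_norm norm_minus_commute)
        \<comment> \<open>Splitting the interval at its tag turns the error into two difference
          quotients based at \<open>t\<close>, each covered by the derivative.\<close>
        have 3: "measure lborel K *\<^sub>R g' t - (x (Sup K) - x (Inf K)) =
            (x u - x t - (u - t) *\<^sub>R g t) - (x v - x t - (v - t) *\<^sub>R g t)"
          using uv tKD by (simp add: g'_def algebra_simps)
        have "norm (measure lborel K *\<^sub>R g' t - (x (Sup K) - x (Inf K))) \<le> e' * norm (u - t) + e' * norm (v - t)"
          unfolding 3 by (rule order_trans[OF norm_triangle_ineq4 add_mono[OF 12]])
        also have "\<dots> = e' * measure lborel K" using uv by (simp add: algebra_simps)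
        finally show "norm (measure lborel K *\<^sub>R g' t - (x (Sup K) - x (Inf K))) \<le> e' * measure lborel K" .
      qed
      also have "(\<Sum>(t, K)\<in>\<D>2. e' * measure lborel K) \<le> (\<Sum>(t, K)\<in>\<D>. e' * measure lborel K)"
        using fin e' by (intro sum_mono2) (auto simp: \<D>2_def)
      also have "\<dots> = e' * (b - a)"
        using additive_content_tagged_division[OF \<D>] \<open>a \<le> b\<close>
        by (simp add: sum_distrib_left[symmetric] split_def)
      also have "\<dots> < e/2"
        using \<open>e > 0\<close> \<open>a \<le> b\<close> by (simp add: e'_def field_simps)
      also have "sum ?h \<D>1 < e/2"
      proof -
        have part: "\<D>1 tagged_partial_division_of cbox a b"
          using \<D> by (auto simp: \<D>1_def tagged_division_of_def intro: tagged_partial_division_subset)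
        define S where "S = \<Union>(snd ` \<D>1)"
        have "\<D>1 tagged_division_of S"
          using tagged_partial_division_of_Union_self[OF part] by (simp add: S_def)
        then have div: "snd ` \<D>1 division_of S" using division_of_tagged_division by blast
        have "K \<subseteq> V" if "K \<in> snd ` \<D>1" for K
          using that fine unfolding fine_def \<D>1_def \<gamma>_def by fastforce
        then have SV: "S \<subseteq> V" by (auto simp: S_def)
        have Sab: "S \<subseteq> {a..b}"
          using part unfolding S_def tagged_partial_division_of_def by fastforce
        \<comment> \<open>\<open>sum.over_tagged_division_lemma\<close> asks for the value 0 on
          degenerate boxes, including the empty one, whose \<open>Sup\<close> and \<open>Inf\<close>
          carry no information.\<close>
        define \<phi> where "\<phi> K = (if K = {} then 0 else norm (x (Sup K) - x (Inf K)))" for K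
        have len: "Sup K - Inf K = measure lborel K" if "K \<in> snd ` \<D>1" for K
          using that K by (fastforce simp: \<D>1_def)
        have "(\<Sum>K\<in>snd ` \<D>1. Sup K - Inf K) = (\<Sum>K\<in>snd ` \<D>1. measure lborel K)"
          using len by (rule sum.cong[OF refl])
        also have "\<dots> = measure lebesgue S"
          using measure_division[OF div] by simp
        also have "\<dots> \<le> measure lebesgue V"
          using SV Vm div by (intro measure_mono_fmeasurable) (auto intro: fmeasurableD measure_division)
        finally have "(\<Sum>K\<in>snd ` \<D>1. Sup K - Inf K) < \<delta>" using Vd by simp
        from \<delta>(2)[OF div Sab this] have *: "(\<Sum>K\<in>snd ` \<D>1. norm (x (Sup K) - x (Inf K))) < e/2" .
        have "sum ?h \<D>1 = (\<Sum>(t, K)\<in>\<D>1. norm (x (Sup K) - x (Inf K)))"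
          by (rule sum.cong) (auto simp: \<D>1_def g'_def norm_minus_commute)
        also have "\<dots> = (\<Sum>(t, K)\<in>\<D>1. \<phi> K)"
          using K by (intro sum.cong) (fastforce simp: \<D>1_def \<phi>_def)+
        also have "\<dots> = (\<Sum>K\<in>snd ` \<D>1. \<phi> K)"
        proof (rule sum.over_tagged_division_lemma[OF \<open>\<D>1 tagged_division_of S\<close>])
          fix u v :: real assume "box u v = {}"
          then show "\<phi> (cbox u v) = 0"
            by (cases "u = v") (auto simp: \<phi>_def)
        qed
        also have "\<dots> = (\<Sum>K\<in>snd ` \<D>1. norm (x (Sup K) - x (Inf K)))"
          using K by (intro sum.cong) (fastforce simp: \<D>1_def \<phi>_def)+
        finally show ?thesis using * by simp
      qed
      finally show "norm ((\<Sum>(t, K)\<in>\<D>. measure lborel K *\<^sub>R g' t) - (x b - x a)) < e" by simp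
    qed
  qed
  then show ?thesis
    unfolding box_real
    by (rule has_integral_spike[OF N, rotated]) (auto simp: g'_def)
qed

text \<open>At a bad point there are arbitrarily short intervals on which the Riemann term misses the integral by
  more than \<open>\<eta>\<close> times the length. Disjoint ones have small total length by Henstock's lemma, and they
  cover the bad points by Vitali.\<close>
theorem has_vector_derivative_indefinite_integral_AE:
  fixes f :: "real \<Rightarrow> 'n::euclidean_space"
  assumes f: "f integrable_on {a..b}"
  obtains N where "negligible N"
    "\<And>t. t \<in> {a..b} - N \<Longrightarrow> ((\<lambda>t. integral {a..t} f) has_vector_derivative f t) (at t within {a..b})"
proof -
  define F where "F t = integral {a..t} f" for t
  have FD: "F v - F u = integral {u..v} f" if "a \<le> u" "u \<le> v" "v \<le> b" for u v
    using Henstock_Kurzweil_Integration.integral_combine[of a u v f] that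
      integrable_on_subinterval[OF f, of a v]
    by (auto simp: F_def algebra_simps)
  define bad where "bad \<eta> = {t \<in> {a..b}. \<forall>d>0. \<exists>y\<in>{a..b}. y \<noteq> t \<and> \<bar>y - t\<bar> < d \<and>
      \<eta> * \<bar>y - t\<bar> < norm (F y - F t - (y - t) *\<^sub>R f t)}" for \<eta>
  have neg: "negligible (bad \<eta>)" if "\<eta> > 0" for \<eta>
    unfolding negligible_outer_le
  proof (intro allI impI)
    fix e :: real assume "e > 0"
    \<comment> \<open>Every selected interval misses by more than \<open>\<eta>\<close> times its
      length, so the precision \<open>e * \<eta>\<close> leaves a total length below
      \<open>e\<close>.\<close>
    obtain \<gamma> where \<gamma>: "gauge \<gamma>" "\<And>p. \<lbrakk>p tagged_partial_division_of cbox a b; \<gamma> fine p\<rbrakk> \<Longrightarrow>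
         (\<Sum>(x, k)\<in>p. norm (measure lborel k *\<^sub>R f x - integral k f)) < e * \<eta>"
      using Henstock_lemma[of f a b "e * \<eta>"] f \<open>e > 0\<close> \<open>\<eta> > 0\<close> by auto
    \<comment> \<open>The interval between \<open>t\<close> and \<open>y\<close>, written as a
      closed ball because the Vitali theorem applied below covers with closed balls.\<close>
    define I where "I = (\<lambda>(t, y). cball ((t + y) / 2) (\<bar>y - t\<bar> / 2 :: real))"
    have I_eq: "I (t, y) = {min t y..max t y}" for t y
      by (auto simp: I_def cball_eq_atLeastAtMost abs_if field_simps split: if_splits)
    define Q where "Q = {(t, y). t \<in> {a..b} \<and> y \<in> {a..b} \<and> y \<noteq> t \<and> I (t, y) \<subseteq> \<gamma> t \<and>
        \<eta> * \<bar>y - t\<bar> < norm (F y - F t - (y - t) *\<^sub>R f t)}"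
    have "\<exists>i. i \<in> Q \<and> t \<in> cball ((fst i + snd i) / 2) (\<bar>snd i - fst i\<bar> / 2) \<and> \<bar>snd i - fst i\<bar> / 2 < d"
      if t: "t \<in> bad \<eta>" and "0 < d" for t d
    proof -
      obtain r where r: "r > 0" "ball t r \<subseteq> \<gamma> t"
        using \<gamma>(1) unfolding gauge_def by (metis open_contains_ball)
      obtain y where y: "y \<in> {a..b}" "y \<noteq> t" "\<bar>y - t\<bar> < min r d"
        "\<eta> * \<bar>y - t\<bar> < norm (F y - F t - (y - t) *\<^sub>R f t)"
        using t \<open>0 < d\<close> r unfolding bad_def by (force dest: spec[of _ "min r d"])
      have "I (t, y) \<subseteq> ball t r"
        using y by (auto simp: I_eq dist_real_def)
      then have "(t, y) \<in> Q"
        using y t r by (auto simp: Q_def bad_def)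
      moreover have "t \<in> cball ((t + y) / 2) (\<bar>y - t\<bar> / 2)" "\<bar>y - t\<bar> / 2 < d"
        using I_eq[of t y] y(3) by (auto simp: I_def)
      ultimately show ?thesis by (intro exI[of _ "(t, y)"]) simp
    qed
    note cover = this
    obtain C where C: "countable C" "C \<subseteq> Q"
        "pairwise (\<lambda>i j. disjnt (I i) (I j)) C" "negligible (bad \<eta> - (\<Union>i\<in>C. I i))"
    proof (rule Vitali_covering_theorem_cballs[of Q "\<lambda>i. \<bar>snd i - fst i\<bar> / 2" "bad \<eta>" "\<lambda>i. (fst i + snd i) / 2"])
      show "0 < \<bar>snd i - fst i\<bar> / 2" if "i \<in> Q" for i
        using that by (auto simp: Q_def)
    qed (use cover that in \<open>auto simp: I_def split_def\<close>)
    have bound: "measure lebesgue (\<Union>i\<in>C'. I i) \<le> e" if C': "C' \<subseteq> C" "finite C'" for C'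
    proof -
      define p where "p = (\<lambda>i. (fst i, I i)) ` C'"
      \<comment> \<open>A tag lies in its own interval, so two members of the disjoint family with
        the same interval coincide. This allows the sum over \<open>C'\<close> to be read as a sum
        over tagged intervals.\<close>
      have inj: "inj_on (\<lambda>i. (fst i, I i)) C'"
      proof (rule inj_onI)
        fix i j assume ij: "i \<in> C'" "j \<in> C'" "(fst i, I i) = (fst j, I j)"
        have "fst i \<in> I i" by (cases i) (simp add: I_eq)
        then have "\<not> disjnt (I i) (I j)" using ij by (auto simp: disjnt_def)
        then show "i = j" using C(3) C'(1) ij by (meson pairwiseD subsetD)
      qed
      have ptag: "p tagged_partial_division_of cbox a b"
        unfolding tagged_partial_division_of_def
      proof (intro conjI allI impI)
        show "finite p" using C' by (simp add: p_def)
        fix x K assume "(x, K) \<in> p"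
        then obtain y where y: "(x, y) \<in> C'" "K = I (x, y)" by (auto simp: p_def)
        then have "(x, y) \<in> Q" using C C' by auto
        then show "x \<in> K" "K \<subseteq> cbox a b" "\<exists>a b. K = cbox a b"
          using y by (auto simp: Q_def I_eq)
      next
        fix x K x' K' assume *: "(x, K) \<in> p \<and> (x', K') \<in> p \<and> (x, K) \<noteq> (x', K')"
        then have "(x, K) \<in> p" "(x', K') \<in> p" by auto
        then obtain y y' where y: "(x, y) \<in> C'" "K = I (x, y)" "(x', y') \<in> C'" "K' = I (x', y')"
          by (auto simp: p_def)
        then have "(x, y) \<noteq> (x', y')" using * by auto
        then have "disjnt K K'" using C(3) C'(1) y by (metis pairwiseD subsetD)
        then show "interior K \<inter> interior K' = {}"
          using interior_subset unfolding disjnt_def by blast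
      qed
      have "\<gamma> fine p"
        using C(2) C'(1) unfolding fine_def p_def by (fastforce simp: Q_def)
      have "(\<Sum>i\<in>C'. \<eta> * \<bar>snd i - fst i\<bar>) \<le>
          (\<Sum>i\<in>C'. norm (measure lborel (I i) *\<^sub>R f (fst i) - integral (I i) f))"
      proof (rule sum_mono)
        fix i assume "i \<in> C'"
        moreover obtain t y where i: "i = (t, y)" by (cases i)
        ultimately have Q: "(t, y) \<in> Q" using C C' by auto
        have "norm (F y - F t - (y - t) *\<^sub>R f t) = norm (measure lborel (I i) *\<^sub>R f t - integral (I i) f)"
        proof (cases "t \<le> y")
          case True
          with Q FD[of t y] show ?thesis
            by (auto simp: i I_eq Q_def norm_minus_commute)
        next
          case False
          with Q have "F y - F t - (y - t) *\<^sub>R f t = (t - y) *\<^sub>R f t - integral {y..t} f"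
            using FD[of y t] by (auto simp: Q_def algebra_simps)
          with False show ?thesis by (auto simp: i I_eq)
        qed
        then show "\<eta> * \<bar>snd i - fst i\<bar> \<le> norm (measure lborel (I i) *\<^sub>R f (fst i) - integral (I i) f)"
          using Q by (auto simp: i Q_def)
      qed
      also have "\<dots> = (\<Sum>(x, k)\<in>p. norm (measure lborel k *\<^sub>R f x - integral k f))"
        unfolding p_def by (subst sum.reindex[OF inj]) simp
      also have "\<dots> < e * \<eta>" by (rule \<gamma>(2)[OF ptag \<open>\<gamma> fine p\<close>])
      finally have "(\<Sum>i\<in>C'. \<bar>snd i - fst i\<bar>) < e"
        using \<open>\<eta> > 0\<close> by (simp add: sum_distrib_left[symmetric] mult.commute)
      moreover have "measure lebesgue (I i) = \<bar>snd i - fst i\<bar>" for i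
        by (cases i) (auto simp: I_eq max_def min_def)
      moreover have "I i \<in> lmeasurable" for i
        by (cases i) (simp add: I_eq)
      ultimately show ?thesis
        using measure_UNION_le[OF C'(2), of I lebesgue] by (simp add: fmeasurableD)
    qed
    have Im: "I i \<in> lmeasurable" for i by (cases i) (simp add: I_eq)
    have U: "(\<Union>i\<in>C. I i) \<in> lmeasurable" "measure lebesgue (\<Union>i\<in>C. I i) \<le> e"
      using fmeasurable_UN_bound[OF C(1), of I lebesgue e] measure_UN_bound[OF C(1), of I lebesgue e] Im bound \<open>e > 0\<close>
      by auto
    have nm: "bad \<eta> - (\<Union>i\<in>C. I i) \<in> null_sets lebesgue"
      using C(4) by (simp add: negligible_iff_null_sets)
    show "\<exists>T. bad \<eta> \<subseteq> T \<and> T \<in> lmeasurable \<and> measure lebesgue T \<le> e"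
    proof (intro exI conjI)
      show "bad \<eta> \<subseteq> (\<Union>i\<in>C. I i) \<union> (bad \<eta> - (\<Union>i\<in>C. I i))" by auto
      show "(\<Union>i\<in>C. I i) \<union> (bad \<eta> - (\<Union>i\<in>C. I i)) \<in> lmeasurable"
        by (rule fmeasurable.Un[OF U(1) negligible_imp_measurable[OF C(4)]])
      show "measure lebesgue ((\<Union>i\<in>C. I i) \<union> (bad \<eta> - (\<Union>i\<in>C. I i))) \<le> e"
        using U measure_Un_null_set[OF fmeasurableD[OF U(1)] nm] by simp
    qed
  qed
  show ?thesis
  proof (rule that)
    show "negligible (\<Union>n. bad (1 / real (Suc n)))"
      by (intro negligible_countable_Union) (auto intro: neg)
    fix t assume t: "t \<in> {a..b} - (\<Union>n. bad (1 / real (Suc n)))"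
    have "(F has_vector_derivative f t) (at t within {a..b})"
      unfolding has_vector_derivative_def has_derivative_within_alt
    proof (intro conjI allI impI)
      show "bounded_linear (\<lambda>h. h *\<^sub>R f t)" by (rule bounded_linear_scaleR_left)
      fix e :: real assume "e > 0"
      then obtain n where n: "1 / real (Suc n) < e" using nat_approx_posE by metis
      have "t \<in> {a..b}" "t \<notin> bad (1 / real (Suc n))" using t by auto
      then obtain d where d: "d > 0" "\<And>y. \<lbrakk>y \<in> {a..b}; y \<noteq> t; \<bar>y - t\<bar> < d\<rbrakk> \<Longrightarrow>
          norm (F y - F t - (y - t) *\<^sub>R f t) \<le> 1 / real (Suc n) * \<bar>y - t\<bar>"
        unfolding bad_def by (force simp: not_less)
      show "\<exists>d>0. \<forall>y\<in>{a..b}. norm (y - t) < d \<longrightarrow>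
          norm (F y - F t - (y - t) *\<^sub>R f t) \<le> e * norm (y - t)"
      proof (intro exI[of _ d] conjI ballI impI d)
        fix y assume y: "y \<in> {a..b}" "norm (y - t) < d"
        show "norm (F y - F t - (y - t) *\<^sub>R f t) \<le> e * norm (y - t)"
        proof (cases "y = t")
          case False
          then have "norm (F y - F t - (y - t) *\<^sub>R f t) \<le> 1 / real (Suc n) * \<bar>y - t\<bar>"
            using d(2)[of y] y by simp
          also have "\<dots> \<le> e * \<bar>y - t\<bar>" using n by (intro mult_right_mono) auto
          finally show ?thesis by simp
        qed simp
      qed
    qed
    then show "((\<lambda>t. integral {a..t} f) has_vector_derivative f t) (at t within {a..b})"
      by (simp add: F_def[abs_def])
  qed
qed

text \<open>Truncate \<open>norm (f t)\<close> at a height \<open>n\<close> for which the part above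
  has integral less than \<open>e / 2\<close>. The part below contributes at most \<open>n\<close>
  per unit of length, which fixes the length bound \<open>e / (2 * (real n + 1))\<close>.\<close>

lemma absolutely_cont_on_indefinite_integral:
  fixes f :: "real \<Rightarrow> 'n::euclidean_space"
  assumes f: "f absolutely_integrable_on {a..b}"
  shows "absolutely_cont_on a b (\<lambda>t. \<xi> + integral {a..t} f)"
  unfolding absolutely_cont_on_def
proof (intro allI impI)
  fix e :: real assume "e > 0"
  define g where "g n t = min (norm (f t)) (real n)" for n t
  have nf: "(\<lambda>t. norm (f t)) integrable_on {a..b}" and fi: "f integrable_on {a..b}"
    using f by (auto simp: absolutely_integrable_on_def)
  have gi: "g n integrable_on {a..b}" for n
  proof -
    have "(\<lambda>t. min (norm (f t)) (real n)) absolutely_integrable_on {a..b}"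
      using f by (intro absolutely_integrable_min_1) (auto intro: absolutely_integrable_norm[unfolded o_def])
    then show ?thesis by (auto simp: g_def[abs_def] absolutely_integrable_on_def)
  qed
  have "(\<lambda>n. integral {a..b} (g n)) \<longlonglongrightarrow> integral {a..b} (\<lambda>t. norm (f t))"
  proof (rule dominated_convergence(2)[OF gi nf])
    show "norm (g n t) \<le> norm (f t)" for n t by (auto simp: g_def)
    show "(\<lambda>n. g n t) \<longlonglongrightarrow> norm (f t)" for t
    proof (rule tendsto_eventually)
      obtain m where "norm (f t) \<le> real m" using real_arch_simple by blast
      then show "\<forall>\<^sub>F n in sequentially. g n t = norm (f t)"
        unfolding eventually_sequentially g_def by (intro exI[of _ m]) (auto simp: min_def)
    qed
  qed
  then obtain n where "\<bar>integral {a..b} (g n) - integral {a..b} (\<lambda>t. norm (f t))\<bar> < e / 2"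
    using \<open>e > 0\<close> unfolding LIMSEQ_def dist_real_def by (meson half_gt_zero order_refl)
  then have "integral {a..b} (\<lambda>t. norm (f t)) - integral {a..b} (g n) < e / 2" by linarith
  then have n: "integral {a..b} (\<lambda>t. norm (f t) - g n t) < e / 2"
    by (simp add: Henstock_Kurzweil_Integration.integral_diff[OF nf gi])
  have di: "(\<lambda>t. norm (f t) - g n t) integrable_on {a..b}"
    by (intro integrable_diff nf gi)
  show "\<exists>\<delta>>0. \<forall>D S. D division_of S \<and> S \<subseteq> {a..b} \<and> (\<Sum>K\<in>D. Sup K - Inf K) < \<delta>
        \<longrightarrow> (\<Sum>K\<in>D. norm (\<xi> + integral {a..Sup K} f - (\<xi> + integral {a..Inf K} f))) < e"
  proof (intro exI[of _ "e / (2 * (real n + 1))"] conjI allI impI)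
    show "0 < e / (2 * (real n + 1))" using \<open>e > 0\<close> by simp
    fix D S assume "D division_of S \<and> S \<subseteq> {a..b} \<and> (\<Sum>K\<in>D. Sup K - Inf K) < e / (2 * (real n + 1))"
    then have D: "D division_of S" and S: "S \<subseteq> {a..b}"
      and len: "(\<Sum>K\<in>D. Sup K - Inf K) < e / (2 * (real n + 1))" by auto
    have KS: "K \<subseteq> {a..b}" if "K \<in> D" for K using D S that by (meson division_ofD(2) order_trans)
    have Kdi: "(\<lambda>t. norm (f t) - g n t) integrable_on K" "g n integrable_on K" if K: "K \<in> D" for K
      using di gi KS[OF K] division_ofD(4)[OF D K] by (metis integrable_on_subcbox box_real(2))+
    have "norm (\<xi> + integral {a..Sup K} f - (\<xi> + integral {a..Inf K} f))
        \<le> integral K (\<lambda>t. norm (f t) - g n t) + real n * (Sup K - Inf K)" if K: "K \<in> D" for K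
    proof -
      obtain u v where uv: "u \<le> v" "K = {u..v}" "Inf K = u" "Sup K = v"
        using division_interval_real[OF D K] by metis
      have uvab: "a \<le> u" "v \<le> b" using KS[OF K] uv by auto
      have "integral {a..v} f - integral {a..u} f = integral K f"
        using Henstock_Kurzweil_Integration.integral_combine[of a u v f] uv uvab
          integrable_on_subinterval[OF fi, of a v] by (auto simp: algebra_simps)
      then have "norm (\<xi> + integral {a..Sup K} f - (\<xi> + integral {a..Inf K} f)) = norm (integral K f)"
        using uv by simp
      also have "\<dots> \<le> integral K (\<lambda>t. norm (f t))"
        using uv KS[OF K] f
        by (intro Henstock_Kurzweil_Integration.integral_norm_bound_integral)
           (auto intro: integrable_on_subinterval[OF fi] integrable_on_subinterval[OF nf])
      also have "\<dots> = integral K (\<lambda>t. (norm (f t) - g n t) + g n t)" by simp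
      also have "\<dots> = integral K (\<lambda>t. norm (f t) - g n t) + integral K (g n)"
        by (intro Henstock_Kurzweil_Integration.integral_add Kdi K)
      also have "integral K (g n) \<le> integral K (\<lambda>_. real n)"
        using uv by (intro integral_le Kdi K) (auto simp: g_def)
      also have "\<dots> = real n * (Sup K - Inf K)" using uv by simp
      finally show ?thesis by simp
    qed
    then have "(\<Sum>K\<in>D. norm (\<xi> + integral {a..Sup K} f - (\<xi> + integral {a..Inf K} f)))
       \<le> (\<Sum>K\<in>D. integral K (\<lambda>t. norm (f t) - g n t) + real n * (Sup K - Inf K))"
      by (rule sum_mono)
    also have "\<dots> = (\<Sum>K\<in>D. integral K (\<lambda>t. norm (f t) - g n t)) + real n * (\<Sum>K\<in>D. Sup K - Inf K)"
      by (simp add: sum.distrib sum_distrib_left)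
    also have "(\<Sum>K\<in>D. integral K (\<lambda>t. norm (f t) - g n t)) = integral S (\<lambda>t. norm (f t) - g n t)"
      by (rule integral_combine_division_bottomup[symmetric, OF D Kdi(1)])
    also have "\<dots> \<le> integral {a..b} (\<lambda>t. norm (f t) - g n t)"
      using S di integrable_on_subdivision[OF D di S] by (intro integral_subset_le) (auto simp: g_def)
    also have "real n * (\<Sum>K\<in>D. Sup K - Inf K) \<le> real n * (e / (2 * (real n + 1)))"
      using len by (intro mult_left_mono) auto
    also have "\<dots> \<le> e / 2" using \<open>e > 0\<close> by (simp add: field_simps)
    finally show "(\<Sum>K\<in>D. norm (\<xi> + integral {a..Sup K} f - (\<xi> + integral {a..Inf K} f))) < e"
      using n by simp
  qed
qed

section \<open>Caratheodory differential equations\<close>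

lemma AE_lebesgue_on_iff:
  assumes "S \<in> sets lebesgue"
  shows "(AE t in lebesgue_on S. P t) \<longleftrightarrow> (\<exists>N. negligible N \<and> (\<forall>t\<in>S - N. P t))" (is "?l \<longleftrightarrow> ?r")
proof -
  have l: "?l \<longleftrightarrow> (AE t in lebesgue. t \<in> S \<longrightarrow> P t)"
    using assms by (simp add: AE_restrict_space_iff)
  show ?thesis
  proof
    assume ?l
    then have "AE t in lebesgue. t \<in> S \<longrightarrow> P t" using l by blast
    then obtain N where "{t. \<not> (t \<in> S \<longrightarrow> P t)} \<subseteq> N" "N \<in> null_sets lebesgue"
      unfolding eventually_ae_filter by auto
    then show ?r by (intro exI[of _ N]) (auto simp: negligible_iff_null_sets)
  next
    assume ?r
    then obtain N where N: "negligible N" "\<forall>t\<in>S - N. P t" by blast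
    then have "N \<in> null_sets lebesgue" by (simp add: negligible_iff_null_sets)
    then have "AE t in lebesgue. t \<in> S \<longrightarrow> P t" by (rule AE_I') (use N in auto)
    then show ?l using l by blast
  qed
qed

lemma absolutely_integrable_scaleR_continuous:
  fixes \<phi> :: "real \<Rightarrow> 'b::euclidean_space"
  assumes k: "k absolutely_integrable_on {a..b}" and \<phi>: "continuous_on {a..b} \<phi>"
  shows "(\<lambda>s. k s *\<^sub>R \<phi> s) absolutely_integrable_on {a..b}"
proof (rule absolutely_integrable_bounded_measurable_product[where h = "\<lambda>x y. y *\<^sub>R x", OF _ _ _ _ k])
  show "bilinear (\<lambda>(x::'b) (y::real). y *\<^sub>R x)"
    by (auto simp: bilinear_def algebra_simps intro!: linearI)
  show "\<phi> \<in> borel_measurable (lebesgue_on {a..b})"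
    using \<phi> by (rule continuous_imp_measurable_on_sets_lebesgue) auto
  show "bounded (\<phi> ` {a..b})"
    using \<phi> by (intro compact_imp_bounded compact_continuous_image) auto
qed auto

lemma absolutely_integrable_mult_continuous:
  fixes \<phi> :: "real \<Rightarrow> real"
  assumes k: "k absolutely_integrable_on {a..b}" and \<phi>: "continuous_on {a..b} \<phi>"
  shows "(\<lambda>s. k s * \<phi> s) absolutely_integrable_on {a..b}"
  using absolutely_integrable_scaleR_continuous[OF assms] by simp

lemma absolutely_integrable_on_imp_integrable_on:
  fixes f :: "'a::euclidean_space \<Rightarrow> 'b::euclidean_space"
  shows "f absolutely_integrable_on S \<Longrightarrow> f integrable_on S"
  by (rule set_lebesgue_integral_eq_integral)

text \<open>The antiderivative is half of the exponential. Since \<open>k\<close> is only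
  integrable, the chain rule holds almost everywhere, and absolute continuity is what makes the
  fundamental theorem applicable. The factor 1/2 becomes the contraction factor.\<close>

lemma has_integral_exp_kernel:
  fixes k :: "real \<Rightarrow> real"
  assumes k: "k absolutely_integrable_on {0..T}" and t: "t \<in> {0..T}"
  shows "((\<lambda>s. k s * exp (2 * integral {0..s} k)) has_integral (exp (2 * integral {0..t} k) - 1) / 2) {0..t}"
proof -
  define K where "K s = integral {0..s} k" for s
  have "absolutely_cont_on 0 T K"
    using absolutely_cont_on_indefinite_integral[OF k, of 0] by (simp add: K_def[abs_def])
  then have "absolutely_cont_on 0 t K"
    by (rule absolutely_cont_on_subset) (use t in auto)
  then have "absolutely_cont_on 0 t (\<lambda>s. 2 * K s)"
    by (rule absolutely_cont_on_bound[where M = 1, OF \<open>absolutely_cont_on 0 t K\<close>]) (auto simp: abs_if)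
  then have ac: "absolutely_cont_on 0 t (\<lambda>s. exp (2 * K s))"
    by (rule absolutely_cont_on_exp)
  have "k integrable_on {0..t}"
    using t by (intro absolutely_integrable_on_imp_integrable_on absolutely_integrable_on_subinterval[OF k]) auto
  from has_vector_derivative_indefinite_integral_AE[OF this] obtain N where N: "negligible N"
    "\<And>s. s \<in> {0..t} - N \<Longrightarrow> ((\<lambda>s. integral {0..s} k) has_vector_derivative k s) (at s within {0..t})"
    by metis
  have K': "K = (\<lambda>s. integral {0..s} k)" by (simp add: K_def fun_eq_iff)
  have "((\<lambda>s. 2 * (k s * exp (2 * K s))) has_integral exp (2 * K t) - exp (2 * K 0)) {0..t}"
  proof (rule absolutely_cont_on_has_integral[OF _ ac N(1)])
    fix s assume "s \<in> {0..t} - N"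
    from N(2)[OF this] show "((\<lambda>s. exp (2 * K s)) has_vector_derivative 2 * (k s * exp (2 * K s))) (at s within {0..t})"
      unfolding has_real_derivative_iff_has_vector_derivative[symmetric] K'[symmetric]
      by (auto intro!: derivative_eq_intros)
  qed (use t in auto)
  from has_integral_mult_right[OF this, of "1/2"] show ?thesis
    by (simp add: K_def)
qed

lemma indefinite_integral_mono:
  fixes k :: "real \<Rightarrow> real"
  assumes "k absolutely_integrable_on {0..T}" "\<And>s. s \<in> {0..T} \<Longrightarrow> 0 \<le> k s" "0 \<le> s" "s \<le> t" "t \<le> T"
  shows "integral {0..s} k \<le> integral {0..t} k"
proof (rule integral_subset_le)
  show "k integrable_on {0..s}" "k integrable_on {0..t}"
    using assms by (auto intro!: absolutely_integrable_on_imp_integrable_on absolutely_integrable_on_subinterval[OF assms(1)])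
qed (use assms in auto)

text \<open>The kernel weight \<open>exp (-2 K)\<close> makes the integral operator a contraction with factor 1/2
  (Bielecki norm); here this gives Gronwall's inequality with the constant 2.\<close>
lemma gronwall:
  fixes k z :: "real \<Rightarrow> real"
  assumes k: "k absolutely_integrable_on {0..T}" and k0: "\<And>s. s \<in> {0..T} \<Longrightarrow> 0 \<le> k s"
    and z: "continuous_on {0..T} z" and z0: "\<And>s. s \<in> {0..T} \<Longrightarrow> 0 \<le> z s"
    and bd: "\<And>t. t \<in> {0..T} \<Longrightarrow> z t \<le> A + integral {0..t} (\<lambda>s. k s * z s)"
    and t: "t \<in> {0..T}"
  shows "z t \<le> 2 * A * exp (2 * integral {0..T} k)"
proof -
  define K where "K s = integral {0..s} k" for s
  have Kc: "continuous_on {0..T} K"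
    unfolding K_def[abs_def] using k
    by (intro indefinite_integral_continuous_1 absolutely_integrable_on_imp_integrable_on)
  then have "continuous_on {0..T} (\<lambda>s. z s * exp (- 2 * K s))"
    by (intro continuous_intros z)
  \<comment> \<open>At a maximizer \<open>r\<close> of the weighted function the integral inequality
    involves the single number \<open>m\<close>, so the claim becomes scalar.\<close>
  then obtain r where r: "r \<in> {0..T}" "\<And>s. s \<in> {0..T} \<Longrightarrow> z s * exp (- 2 * K s) \<le> z r * exp (- 2 * K r)"
    using continuous_attains_sup[of "{0..T}" "\<lambda>s. z s * exp (- 2 * K s)"] t by auto
  define m where "m = z r * exp (- 2 * K r)"
  have m0: "m \<ge> 0" using z0 r(1) by (simp add: m_def)
  have zm: "z s \<le> m * exp (2 * K s)" if "s \<in> {0..T}" for s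
    using r(2)[OF that] by (simp add: m_def exp_minus field_simps)
  have "z 0 \<le> A" using bd[of 0] t by auto
  then have A0: "A \<ge> 0" using z0[of 0] t by auto
  have K0: "K r \<ge> 0" using indefinite_integral_mono[OF k k0, of 0 r] r by (simp add: K_def)
  have sub: "{0..r} \<subseteq> {0..T}" using r by auto
  have exp_int: "((\<lambda>s. k s * exp (2 * K s)) has_integral (exp (2 * K r) - 1) / 2) {0..r}"
    using has_integral_exp_kernel[OF k r(1)] by (simp add: K_def)
  have "integral {0..r} (\<lambda>s. k s * z s) \<le> integral {0..r} (\<lambda>s. m * (k s * exp (2 * K s)))"
  proof (rule integral_le)
    show "(\<lambda>s. k s * z s) integrable_on {0..r}"
      using sub absolutely_integrable_mult_continuous[OF k z]
      by (meson absolutely_integrable_on_imp_integrable_on absolutely_integrable_on_subinterval)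
    show "(\<lambda>s. m * (k s * exp (2 * K s))) integrable_on {0..r}"
      using has_integral_mult_right[OF exp_int] by blast
    fix s assume "s \<in> {0..r}"
    then have s: "s \<in> {0..T}" using sub by auto
    have "k s * z s \<le> k s * (m * exp (2 * K s))" using zm[OF s] k0[OF s] by (rule mult_left_mono)
    then show "k s * z s \<le> m * (k s * exp (2 * K s))" by (simp add: mult_ac)
  qed
  also have "\<dots> = m * ((exp (2 * K r) - 1) / 2)"
    by (rule integral_unique[OF has_integral_mult_right[OF exp_int]])
  finally have "z r \<le> A + m * ((exp (2 * K r) - 1) / 2)" using bd[OF r(1)] by simp
  moreover have "z r = m * exp (2 * K r)" by (simp add: m_def exp_minus)
  \<comment> \<open>With \<open>E = exp (2 * K r)\<close> the two facts give
    \<open>m * E \<le> A + m * (E - 1) / 2\<close>. Doubling and moving one \<open>m * E\<close> to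
    the left yields this; as \<open>m \<le> m * E\<close>, it follows that
    \<open>m \<le> A\<close>.\<close>
  ultimately have "m * exp (2 * K r) \<le> 2 * A - m" by (simp add: field_simps)
  moreover have "m * 1 \<le> m * exp (2 * K r)" using K0 m0 by (intro mult_left_mono) auto
  ultimately have m: "m \<le> A" by simp
  have "z t \<le> m * exp (2 * K t)" by (rule zm[OF t])
  also have "\<dots> \<le> A * exp (2 * K T)"
    using m A0 indefinite_integral_mono[OF k k0, of t T] t by (intro mult_mono) (auto simp: K_def)
  also have "\<dots> \<le> 2 * A * exp (2 * K T)" using A0 by simp
  finally show ?thesis by (simp add: K_def)
qed

text \<open>Banach's fixed point theorem in the unknown
  \<open>exp (- 2 * K t) *\<^sub>R x t\<close>, whose supremum norm is the Bielecki norm of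
  \<open>x\<close>. The operator then contracts on all of \<open>[0,T]\<close> at once, with no
  gluing of short intervals. Integrability of \<open>g\<close> along continuous curves is a
  hypothesis, so no measurability in two variables is discussed here.\<close>

theorem caratheodory_integral_equation:
  fixes g :: "real \<Rightarrow> 'a::euclidean_space \<Rightarrow> 'a"
  assumes T: "0 \<le> T" and k: "k absolutely_integrable_on {0..T}" and k0: "\<And>s. s \<in> {0..T} \<Longrightarrow> 0 \<le> k s"
    and lip: "\<And>s x y. s \<in> {0..T} \<Longrightarrow> norm (g s x - g s y) \<le> k s * norm (x - y)"
    and gi: "\<And>y. continuous_on {0..T} y \<Longrightarrow> (\<lambda>s. g s (y s)) absolutely_integrable_on {0..T}"
  obtains x where "continuous_on {0..T} x"
    "\<And>t. t \<in> {0..T} \<Longrightarrow> x t = \<xi> + integral {0..t} (\<lambda>s. g s (x s))"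
proof -
  define K where "K s = integral {0..s} k" for s
  have Kc: "continuous_on {0..T} K"
    unfolding K_def[abs_def] using k
    by (intro indefinite_integral_continuous_1 absolutely_integrable_on_imp_integrable_on)
  \<comment> \<open>Bounded continuous functions form a complete space on the whole line; clamping
    time extends data on \<open>[0,T]\<close> by constants.\<close>
  define c where "c t = max 0 (min T t)" for t
  have c: "c t \<in> {0..T}" for t using T by (auto simp: c_def)
  have c_id: "c t = t" if "t \<in> {0..T}" for t using that by (auto simp: c_def)
  \<comment> \<open>Undoes the weight: \<open>w y\<close> is the candidate trajectory represented by
    \<open>y\<close>.\<close>
  define w where "w y s = exp (2 * K s) *\<^sub>R apply_bcontfun y s" for y :: "real \<Rightarrow>\<^sub>C 'a" and s
  have wc: "continuous_on {0..T} (w y)" for y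
    unfolding w_def[abs_def] by (intro continuous_intros Kc) auto
  define I where "I y t = \<xi> + integral {0..t} (\<lambda>s. g s (w y s))" for y t
  have Ic: "continuous_on {0..T} (I y)" for y
    unfolding I_def[abs_def]
    by (intro continuous_intros indefinite_integral_continuous_1 absolutely_integrable_on_imp_integrable_on gi wc)
  define P where "P y = Bcontfun (\<lambda>t. exp (- 2 * K (c t)) *\<^sub>R I y (c t))" for y
  have "(\<lambda>t. exp (- 2 * K (c t)) *\<^sub>R I y (c t)) \<in> bcontfun" for y
  proof -
    let ?h = "\<lambda>t. exp (- 2 * K t) *\<^sub>R I y t"
    have h: "continuous_on {0..T} ?h" by (intro continuous_intros Kc Ic)
    have "continuous_on UNIV c" unfolding c_def[abs_def] by (intro continuous_intros)
    then have "continuous_on UNIV (\<lambda>t. ?h (c t))"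
      by (rule continuous_on_compose2[OF h]) (use c in auto)
    moreover have "bounded (range (\<lambda>t. ?h (c t)))"
      using compact_imp_bounded[OF compact_continuous_image[OF h compact_Icc]]
      by (rule bounded_subset) (use c in auto)
    ultimately show ?thesis by (simp add: bcontfun_def)
  qed
  then have P: "apply_bcontfun (P y) t = exp (- 2 * K (c t)) *\<^sub>R I y (c t)" for y t
    by (simp add: P_def Bcontfun_inverse)
  have contr: "dist (P y) (P z) \<le> 1/2 * dist y z" for y z
  proof (rule dist_bound)
    fix u
    define t where "t = c u"
    have t: "t \<in> {0..T}" unfolding t_def by (rule c)
    then have sub: "{0..t} \<subseteq> {0..T}" by auto
    have gt: "(\<lambda>s. g s (w y s)) integrable_on {0..t}" for y
      using absolutely_integrable_on_subinterval[OF gi[OF wc] sub] by (rule absolutely_integrable_on_imp_integrable_on)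
    have exp_int: "((\<lambda>s. dist y z * (k s * exp (2 * K s))) has_integral dist y z * ((exp (2 * K t) - 1) / 2)) {0..t}"
      using has_integral_mult_right[OF has_integral_exp_kernel[OF k t]] by (simp add: K_def)
    have "I y t - I z t = integral {0..t} (\<lambda>s. g s (w y s) - g s (w z s))"
      by (simp add: I_def Henstock_Kurzweil_Integration.integral_diff[OF gt gt])
    also have "norm \<dots> \<le> integral {0..t} (\<lambda>s. dist y z * (k s * exp (2 * K s)))"
    proof (rule Henstock_Kurzweil_Integration.integral_norm_bound_integral)
      show "(\<lambda>s. g s (w y s) - g s (w z s)) integrable_on {0..t}" by (intro integrable_diff gt)
      fix s assume "s \<in> {0..t}"
      then have s: "s \<in> {0..T}" using sub by auto
      have "norm (g s (w y s) - g s (w z s)) \<le> k s * norm (w y s - w z s)" by (rule lip[OF s])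
      also have "norm (w y s - w z s) = exp (2 * K s) * dist (y s) (z s)"
        by (simp add: w_def dist_norm scaleR_diff_right[symmetric])
      also have "k s * \<dots> \<le> k s * (exp (2 * K s) * dist y z)"
        by (intro mult_left_mono k0 s dist_bounded) auto
      finally show "norm (g s (w y s) - g s (w z s)) \<le> dist y z * (k s * exp (2 * K s))"
        by (simp add: mult_ac)
    qed (use exp_int in blast)
    also have "\<dots> = dist y z * ((exp (2 * K t) - 1) / 2)" using exp_int by (rule integral_unique)
    finally have *: "norm (I y t - I z t) \<le> dist y z * ((exp (2 * K t) - 1) / 2)" .
    have "dist (apply_bcontfun (P y) u) (apply_bcontfun (P z) u) = exp (- 2 * K t) * norm (I y t - I z t)"
      by (simp add: P t_def dist_norm scaleR_diff_right[symmetric])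
    also have "\<dots> \<le> exp (- 2 * K t) * (dist y z * ((exp (2 * K t) - 1) / 2))"
      by (intro mult_left_mono *) auto
    also have "\<dots> = 1/2 * dist y z * (1 - exp (- 2 * K t))"
      by (simp add: exp_minus field_simps)
    also have "\<dots> \<le> 1/2 * dist y z" by (intro mult_left_le) auto
    finally show "dist (apply_bcontfun (P y) u) (apply_bcontfun (P z) u) \<le> 1/2 * dist y z" .
  qed
  then obtain y where y: "P y = y"
    using banach_fix_type[of "1/2" P] by auto
  have wI: "w y t = I y t" if t: "t \<in> {0..T}" for t
  proof -
    have "apply_bcontfun y t = exp (- 2 * K t) *\<^sub>R I y t" using P[of y t] c_id[OF t] y by simp
    then show ?thesis by (simp add: w_def exp_minus)
  qed
  show ?thesis
    by (rule that[OF wc]) (use wI in \<open>simp add: I_def\<close>)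
qed

text \<open>Differential and integral form agree through the two theorems on absolute continuity:
  Lebesgue differentiation gives this direction, Newton-Leibniz the converse below.\<close>

lemma caratheodory_solutionI:
  fixes x :: "real \<Rightarrow> 'a::euclidean_space"
  assumes gi: "(\<lambda>s. g s (x s)) absolutely_integrable_on {0..T}"
    and x: "\<And>t. t \<in> {0..T} \<Longrightarrow> x t = \<xi> + integral {0..t} (\<lambda>s. g s (x s))"
  shows "caratheodory_solution T g x"
  unfolding caratheodory_solution_def
proof
  let ?y = "\<lambda>t. \<xi> + integral {0..t} (\<lambda>s. g s (x s))"
  have y: "absolutely_cont_on 0 T ?y"
    by (rule absolutely_cont_on_indefinite_integral[OF gi])
  show "absolutely_cont_on 0 T x"
    by (rule absolutely_cont_on_bound[OF y y, where M = 1]) (use x in auto)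
  obtain N where N: "negligible N"
    "\<And>t. t \<in> {0..T} - N \<Longrightarrow> ((\<lambda>t. integral {0..t} (\<lambda>s. g s (x s))) has_vector_derivative g t (x t)) (at t within {0..T})"
    using has_vector_derivative_indefinite_integral_AE[OF absolutely_integrable_on_imp_integrable_on[OF gi]] by blast
  have "(x has_vector_derivative g t (x t)) (at t within {0..T})" if t: "t \<in> {0..T} - N" for t
  proof (rule has_vector_derivative_transform)
    show "t \<in> {0..T}" using t by auto
    show "((\<lambda>t. \<xi> + integral {0..t} (\<lambda>s. g s (x s))) has_vector_derivative g t (x t)) (at t within {0..T})"
      using has_vector_derivative_add[OF has_vector_derivative_const N(2)[OF t]] by simp
  qed (use x in auto)
  then show "AE t in lebesgue_on {0..T}. (x has_vector_derivative g t (x t)) (at t within {0..T})"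
    using N(1) by (subst AE_lebesgue_on_iff) auto
qed

lemma caratheodory_solution_has_integral:
  fixes x :: "real \<Rightarrow> 'a::euclidean_space"
  assumes x: "caratheodory_solution T g x" and st: "0 \<le> s" "s \<le> t" "t \<le> T"
  shows "((\<lambda>r. g r (x r)) has_integral x t - x s) {s..t}"
proof -
  obtain N where N: "negligible N"
    "\<And>t. t \<in> {0..T} - N \<Longrightarrow> (x has_vector_derivative g t (x t)) (at t within {0..T})"
    using x unfolding caratheodory_solution_def by (subst (asm) AE_lebesgue_on_iff) auto
  show ?thesis
  proof (rule absolutely_cont_on_has_integral[OF st(2) _ N(1)])
    show "absolutely_cont_on s t x"
      by (rule absolutely_cont_on_subset[of 0 T]) (use x st in \<open>auto simp: caratheodory_solution_def\<close>)
    fix r assume "r \<in> {s..t} - N"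
    then have "(x has_vector_derivative g r (x r)) (at r within {0..T})" using st by (intro N) auto
    then show "(x has_vector_derivative g r (x r)) (at r within {s..t})"
      by (rule has_vector_derivative_within_subset) (use st in auto)
  qed
qed

lemma caratheodory_solution_continuous_on:
  "caratheodory_solution T g x \<Longrightarrow> continuous_on {0..T} x"
  unfolding caratheodory_solution_def by (simp add: absolutely_cont_on_imp_continuous_on)

lemma has_integral_reflect_affine:
  fixes f :: "real \<Rightarrow> 'a::euclidean_space"
  assumes "(f has_integral I) {a..b}"
  shows "((\<lambda>r. f (T - r)) has_integral I) {T - b..T - a}"
proof -
  have "((\<lambda>x. f (- 1 *\<^sub>R x + T)) has_integral (1 / \<bar>-1\<bar> ^ DIM(real)) *\<^sub>R I)
     ((\<lambda>x. (1 / - 1) *\<^sub>R x + - ((1 / - 1) *\<^sub>R T)) ` cbox a b)"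
    using assms by (intro has_integral_affinity) auto
  moreover have "(\<lambda>x. (1 / - 1) *\<^sub>R x + - ((1 / - 1) *\<^sub>R T)) ` cbox a b = {T - b..T - a}"
  proof (intro set_eqI iffI)
    fix x assume "x \<in> {T - b..T - a}"
    then show "x \<in> (\<lambda>x. (1 / - 1) *\<^sub>R x + - ((1 / - 1) *\<^sub>R T)) ` cbox a b"
      by (intro image_eqI[of _ _ "T - x"]) auto
  qed auto
  ultimately show ?thesis by (simp add: algebra_simps)
qed

lemma absolutely_integrable_reflect_affine:
  fixes f :: "real \<Rightarrow> 'a::euclidean_space"
  assumes "f absolutely_integrable_on {0..T}"
  shows "(\<lambda>r. f (T - r)) absolutely_integrable_on {0..T}"
  using assms has_integral_reflect_affine[of f _ 0 T T] has_integral_reflect_affine[of "\<lambda>x. norm (f x)" _ 0 T T]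
  unfolding absolutely_integrable_on_def integrable_on_def by auto

text \<open>Common form of the state equation and of the time-reversed adjoint equation. All
  irregularity in time sits in the scalar weights \<open>\<omega>\<close>, while the fields are
  jointly continuous. Integrability along continuous curves and the Lipschitz kernel
  \<open>L * \<kappa> s\<close> follow, and one theorem on dependence on parameters serves both
  equations.\<close>

locale ode_family =
  fixes T L :: real and \<Theta> :: "'p::metric_space set"
    and \<omega> :: "'i::finite \<Rightarrow> real \<Rightarrow> real"
    and H :: "'i \<Rightarrow> real \<Rightarrow> 'a::euclidean_space \<Rightarrow> 'p \<Rightarrow> 'a"
    and \<xi> :: "'p \<Rightarrow> 'a"
  assumes T: "0 \<le> T" and \<Theta>: "compact \<Theta>" and L: "0 \<le> L"
    and \<omega>: "\<omega> i absolutely_integrable_on {0..T}"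
    and lipschitz: "s \<in> {0..T} \<Longrightarrow> \<theta> \<in> \<Theta> \<Longrightarrow> norm (H i s x \<theta> - H i s y \<theta>) \<le> L * norm (x - y)"
    and H_cont: "continuous_on ({0..T} \<times> UNIV \<times> \<Theta>) (\<lambda>(s, x, \<theta>). H i s x \<theta>)"
    and \<xi>_cont: "continuous_on \<Theta> \<xi>"
begin

definition "\<kappa> s = (\<Sum>i\<in>UNIV. \<bar>\<omega> i s\<bar>)"
definition "field \<theta> s x = (\<Sum>i\<in>UNIV. \<omega> i s *\<^sub>R H i s x \<theta>)"

lemma \<kappa>_nonneg: "0 \<le> \<kappa> s"
  by (simp add: \<kappa>_def sum_nonneg)

lemma \<kappa>_integrable: "\<kappa> absolutely_integrable_on {0..T}"
  unfolding \<kappa>_def[abs_def]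
  using absolutely_integrable_norm[OF \<omega>] by (intro absolutely_integrable_sum) (auto simp: o_def)

lemma H_comp_cont:
  assumes "\<theta> \<in> \<Theta>" "continuous_on {0..T} y"
  shows "continuous_on {0..T} (\<lambda>s. H i s (y s) \<theta>)"
proof -
  have "continuous_on {0..T} (\<lambda>s. (\<lambda>(s, x, \<theta>). H i s x \<theta>) (s, y s, \<theta>))"
    by (rule continuous_on_compose2[OF H_cont]) (use assms in \<open>auto intro!: continuous_intros\<close>)
  then show ?thesis by simp
qed

lemma field_integrable:
  assumes "\<theta> \<in> \<Theta>" "continuous_on {0..T} y"
  shows "(\<lambda>s. field \<theta> s (y s)) absolutely_integrable_on {0..T}"
  unfolding field_def
  by (intro absolutely_integrable_sum absolutely_integrable_scaleR_continuous \<omega> H_comp_cont assms) simp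

lemma field_lipschitz:
  assumes "s \<in> {0..T}" "\<theta> \<in> \<Theta>"
  shows "norm (field \<theta> s x - field \<theta> s y) \<le> L * \<kappa> s * norm (x - y)"
proof -
  have "field \<theta> s x - field \<theta> s y = (\<Sum>i\<in>UNIV. \<omega> i s *\<^sub>R (H i s x \<theta> - H i s y \<theta>))"
    by (simp add: field_def sum_subtractf scaleR_diff_right)
  also have "norm \<dots> \<le> (\<Sum>i\<in>UNIV. \<bar>\<omega> i s\<bar> * (L * norm (x - y)))"
    by (intro sum_norm_le) (auto intro!: mult_left_mono lipschitz assms)
  also have "\<dots> = L * \<kappa> s * norm (x - y)"
    by (simp add: \<kappa>_def sum_distrib_left sum_distrib_right mult_ac)
  finally show ?thesis .
qed

lemma exists_solution:
  assumes \<theta>: "\<theta> \<in> \<Theta>"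
  obtains x where "continuous_on {0..T} x"
    "\<And>t. t \<in> {0..T} \<Longrightarrow> x t = \<xi> \<theta> + integral {0..t} (\<lambda>s. field \<theta> s (x s))"
proof (rule caratheodory_integral_equation[OF T, of "\<lambda>s. L * \<kappa> s" "field \<theta>" "\<xi> \<theta>"])
  show "(\<lambda>s. L * \<kappa> s) absolutely_integrable_on {0..T}"
    using absolutely_integrable_scaleR_left[OF \<kappa>_integrable] by simp
qed (use L \<kappa>_nonneg field_lipschitz field_integrable \<theta> that in auto)

text \<open>Gronwall's inequality against the trajectory of a fixed \<open>\<theta>0\<close>.
  Inserting \<open>field \<theta> s (X s \<theta>0)\<close> separates a Lipschitz term from the
  change of the fields along one fixed curve; the latter is small because that curve stays in a
  compact set.\<close>

lemma solution_cont:
  assumes X: "\<And>\<theta>. \<theta> \<in> \<Theta> \<Longrightarrow> continuous_on {0..T} (\<lambda>t. X t \<theta>)"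
    and eq: "\<And>\<theta> t. \<theta> \<in> \<Theta> \<Longrightarrow> t \<in> {0..T} \<Longrightarrow> X t \<theta> = \<xi> \<theta> + integral {0..t} (\<lambda>s. field \<theta> s (X s \<theta>))"
  shows "continuous_on ({0..T} \<times> \<Theta>) (\<lambda>(t, \<theta>). X t \<theta>)"
  unfolding continuous_on_iff
proof (intro ballI allI impI, clarify)
  fix t0 \<theta>0 and e :: real assume t0: "t0 \<in> {0..T}" and \<theta>0: "\<theta>0 \<in> \<Theta>" and e: "0 < e"
  \<comment> \<open>Gronwall's factor when the initial values differ by at most
    \<open>\<eta>\<close> and the fields along the reference curve by at most
    \<open>\<eta> * \<kappa> s\<close>.\<close>
  define B where "B = 2 * (1 + integral {0..T} \<kappa>) * exp (2 * integral {0..T} (\<lambda>s. L * \<kappa> s))"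
  have "integral {0..T} \<kappa> \<ge> 0"
    by (intro integral_nonneg absolutely_integrable_on_imp_integrable_on \<kappa>_integrable \<kappa>_nonneg)
  then have B: "B > 0" by (simp add: B_def)
  define \<eta> where "\<eta> = e / (2 * B)"
  have \<eta>: "\<eta> > 0" using e B by (simp add: \<eta>_def)
  \<comment> \<open>Packing the finite family into one vector yields a single modulus of continuity
    for all indices.\<close>
  define \<Phi> where "\<Phi> = (\<lambda>(s, \<theta>). \<chi> i. H i s (X s \<theta>0) \<theta>)"
  have "continuous_on ({0..T} \<times> \<Theta>) (\<lambda>p. H i (fst p) (X (fst p) \<theta>0) (snd p))" for i
  proof -
    have "continuous_on ({0..T} \<times> \<Theta>) (\<lambda>p. X (fst p) \<theta>0)"
      by (rule continuous_on_compose2[OF X[OF \<theta>0]]) (auto intro!: continuous_intros)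
    then have "continuous_on ({0..T} \<times> \<Theta>) (\<lambda>p. (\<lambda>(s, x, \<theta>). H i s x \<theta>) (fst p, X (fst p) \<theta>0, snd p))"
      by (intro continuous_on_compose2[OF H_cont]) (auto intro!: continuous_intros)
    then show ?thesis by simp
  qed
  then have "continuous_on ({0..T} \<times> \<Theta>) \<Phi>"
    unfolding \<Phi>_def split_def by (intro continuous_on_vec_lambda)
  then have "uniformly_continuous_on ({0..T} \<times> \<Theta>) \<Phi>"
    by (intro compact_uniformly_continuous compact_Times \<Theta>) auto
  then obtain d1 where d1: "d1 > 0" "\<And>p q. \<lbrakk>p \<in> {0..T} \<times> \<Theta>; q \<in> {0..T} \<times> \<Theta>; dist q p < d1\<rbrakk> \<Longrightarrow> dist (\<Phi> q) (\<Phi> p) < \<eta>"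
    using \<eta> unfolding uniformly_continuous_on_def by metis
  obtain d2 where d2: "d2 > 0" "\<And>\<theta>. \<lbrakk>\<theta> \<in> \<Theta>; dist \<theta> \<theta>0 < d2\<rbrakk> \<Longrightarrow> dist (\<xi> \<theta>) (\<xi> \<theta>0) < \<eta>"
    using \<xi>_cont \<theta>0 \<eta> unfolding continuous_on_iff by metis
  obtain d3 where d3: "d3 > 0" "\<And>t. \<lbrakk>t \<in> {0..T}; dist t t0 < d3\<rbrakk> \<Longrightarrow> dist (X t \<theta>0) (X t0 \<theta>0) < e / 2"
    using X[OF \<theta>0] t0 e unfolding continuous_on_iff by (metis half_gt_zero)
  have key: "norm (X t \<theta> - X t \<theta>0) \<le> B * \<eta>" if \<theta>: "\<theta> \<in> \<Theta>" "dist \<theta> \<theta>0 < min d1 d2" and t: "t \<in> {0..T}" for t \<theta>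
  proof -
    let ?z = "\<lambda>t. norm (X t \<theta> - X t \<theta>0)"
    have zc: "continuous_on {0..T} ?z" using X \<theta>(1) \<theta>0 by (intro continuous_intros) auto
    have Lk: "(\<lambda>s. L * \<kappa> s) absolutely_integrable_on {0..T}"
      using absolutely_integrable_scaleR_left[OF \<kappa>_integrable] by simp
    have "?z t \<le> 2 * (\<eta> * (1 + integral {0..T} \<kappa>)) * exp (2 * integral {0..T} (\<lambda>s. L * \<kappa> s))"
    proof (rule gronwall[OF Lk _ zc _ _ t])
      fix t assume t: "t \<in> {0..T}"
      then have sub: "{0..t} \<subseteq> {0..T}" by auto
      note sub_int = absolutely_integrable_on_imp_integrable_on[OF absolutely_integrable_on_subinterval[OF _ sub]]
      have fi: "(\<lambda>s. field \<theta>' s (X s \<theta>')) integrable_on {0..t}" if "\<theta>' \<in> \<Theta>" for \<theta>'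
        using that by (intro sub_int field_integrable X)
      have \<kappa>i: "\<kappa> integrable_on {0..t}" by (intro sub_int \<kappa>_integrable)
      have zi: "(\<lambda>s. L * \<kappa> s * ?z s) integrable_on {0..t}"
        by (intro sub_int absolutely_integrable_mult_continuous Lk zc)
      have "X t \<theta> - X t \<theta>0 = (\<xi> \<theta> - \<xi> \<theta>0) + integral {0..t} (\<lambda>s. field \<theta> s (X s \<theta>) - field \<theta>0 s (X s \<theta>0))"
        using eq[OF \<theta>(1) t] eq[OF \<theta>0 t] \<theta>(1) \<theta>0
        by (simp add: Henstock_Kurzweil_Integration.integral_diff[OF fi fi])
      also have "norm \<dots> \<le> \<eta> + norm (integral {0..t} (\<lambda>s. field \<theta> s (X s \<theta>) - field \<theta>0 s (X s \<theta>0)))"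
        using d2(2)[OF \<theta>(1)] \<theta>(2) by (intro order_trans[OF norm_triangle_ineq] add_right_mono) (auto simp: dist_norm)
      also have "norm (integral {0..t} (\<lambda>s. field \<theta> s (X s \<theta>) - field \<theta>0 s (X s \<theta>0)))
          \<le> integral {0..t} (\<lambda>s. L * \<kappa> s * ?z s + \<eta> * \<kappa> s)"
      proof (rule Henstock_Kurzweil_Integration.integral_norm_bound_integral)
        show "(\<lambda>s. field \<theta> s (X s \<theta>) - field \<theta>0 s (X s \<theta>0)) integrable_on {0..t}"
          by (intro integrable_diff fi \<theta>(1) \<theta>0)
        show "(\<lambda>s. L * \<kappa> s * ?z s + \<eta> * \<kappa> s) integrable_on {0..t}"
          using integrable_on_mult_right[OF \<kappa>i] by (intro integrable_add zi) auto
        fix s assume "s \<in> {0..t}"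
        then have s: "s \<in> {0..T}" using sub by auto
        have "norm (H i s (X s \<theta>0) \<theta> - H i s (X s \<theta>0) \<theta>0) \<le> \<eta>" for i
        proof -
          have "dist (\<Phi> (s, \<theta>)) (\<Phi> (s, \<theta>0)) < \<eta>"
            using s \<theta> \<theta>0 by (intro d1) (auto simp: dist_Pair_Pair)
          then show ?thesis
            using Finite_Cartesian_Product.norm_nth_le[of "\<Phi> (s, \<theta>) - \<Phi> (s, \<theta>0)" i] by (simp add: \<Phi>_def dist_norm)
        qed
        then have "norm (\<Sum>i\<in>UNIV. \<omega> i s *\<^sub>R (H i s (X s \<theta>0) \<theta> - H i s (X s \<theta>0) \<theta>0)) \<le> (\<Sum>i\<in>UNIV. \<bar>\<omega> i s\<bar> * \<eta>)"
          by (intro sum_norm_le) (auto intro!: mult_left_mono)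
        moreover have "field \<theta> s (X s \<theta>0) - field \<theta>0 s (X s \<theta>0)
            = (\<Sum>i\<in>UNIV. \<omega> i s *\<^sub>R (H i s (X s \<theta>0) \<theta> - H i s (X s \<theta>0) \<theta>0))"
          by (simp add: field_def sum_subtractf scaleR_diff_right)
        ultimately have 2: "norm (field \<theta> s (X s \<theta>0) - field \<theta>0 s (X s \<theta>0)) \<le> \<eta> * \<kappa> s"
          by (simp add: \<kappa>_def sum_distrib_left mult_ac)
        have 1: "norm (field \<theta> s (X s \<theta>) - field \<theta> s (X s \<theta>0)) \<le> L * \<kappa> s * ?z s"
          by (rule field_lipschitz[OF s \<theta>(1)])
        show "norm (field \<theta> s (X s \<theta>) - field \<theta>0 s (X s \<theta>0)) \<le> L * \<kappa> s * ?z s + \<eta> * \<kappa> s"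
          using norm_diff_triangle_le[OF 1 2] .
      qed
      also have "\<dots> = integral {0..t} (\<lambda>s. L * \<kappa> s * ?z s) + \<eta> * integral {0..t} \<kappa>"
        using integrable_on_mult_right[OF \<kappa>i]
        by (subst Henstock_Kurzweil_Integration.integral_add[OF zi]) auto
      also have "\<eta> * integral {0..t} \<kappa> \<le> \<eta> * integral {0..T} \<kappa>"
        using \<eta> t \<kappa>_nonneg by (intro mult_left_mono indefinite_integral_mono[OF \<kappa>_integrable]) auto
      finally show "?z t \<le> \<eta> * (1 + integral {0..T} \<kappa>) + integral {0..t} (\<lambda>s. L * \<kappa> s * ?z s)"
        by (simp add: algebra_simps)
    qed (use L \<kappa>_nonneg in auto)
    then show ?thesis by (simp add: B_def mult_ac)
  qed
  show "\<exists>d>0. \<forall>p'\<in>{0..T} \<times> \<Theta>. dist p' (t0, \<theta>0) < d \<longrightarrow>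
      dist (case p' of (t, \<theta>) \<Rightarrow> X t \<theta>) (X t0 \<theta>0) < e"
  proof (intro exI[of _ "min d3 (min d1 d2)"] conjI ballI impI)
    show "0 < min d3 (min d1 d2)" using d1 d2 d3 by simp
    fix p' assume p': "p' \<in> {0..T} \<times> \<Theta>" "dist p' (t0, \<theta>0) < min d3 (min d1 d2)"
    obtain t \<theta> where p: "p' = (t, \<theta>)" "t \<in> {0..T}" "\<theta> \<in> \<Theta>" using p'(1) by auto
    have "dist t t0 < d3" "dist \<theta> \<theta>0 < min d1 d2"
      using p'(2) dist_fst_le[of p' "(t0, \<theta>0)"] dist_snd_le[of p' "(t0, \<theta>0)"] by (auto simp: p)
    then have "norm (X t \<theta> - X t \<theta>0) \<le> B * \<eta>" and 2: "dist (X t \<theta>0) (X t0 \<theta>0) < e / 2"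
      using key[OF p(3) _ p(2)] d3(2)[OF p(2)] by blast+
    moreover have "B * \<eta> = e / 2" using B by (simp add: \<eta>_def)
    moreover have "dist (X t \<theta>) (X t0 \<theta>0) \<le> norm (X t \<theta> - X t \<theta>0) + dist (X t \<theta>0) (X t0 \<theta>0)"
      using dist_triangle[of "X t \<theta>" "X t0 \<theta>0" "X t \<theta>0"] by (simp add: dist_norm)
    ultimately show "dist (case p' of (t, \<theta>) \<Rightarrow> X t \<theta>) (X t0 \<theta>0) < e" by (simp add: p)
  qed
qed

end

section \<open>Control-affine systems and the adjoint equation\<close>

lemma bounded_bilinear_vector_matrix_mult:
  "bounded_bilinear (\<lambda>(y::real^'m) (A::real^'n^'m). y v* A)"
  unfolding bilinear_conv_bounded_bilinear[symmetric] bilinear_def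
  by (auto intro!: linearI
      simp: vec_eq_iff vector_matrix_mult_def sum.distrib sum_distrib_left algebra_simps)

lemma bounded_bilinear_matrix_vector_mult:
  "bounded_bilinear (\<lambda>(A::real^'n^'m) (y::real^'n). A *v y)"
  unfolding bilinear_conv_bounded_bilinear[symmetric] bilinear_def
  by (auto intro!: linearI
      simp: vec_eq_iff matrix_vector_mult_def sum.distrib sum_distrib_left algebra_simps)

text \<open>The mean value inequality on a ball where the derivative oscillates by at most
  \<open>\<eta>\<close>; compactness makes its radius independent of \<open>x\<close> and
  \<open>\<theta>\<close>. The pairing \<open>pr\<close> is abstract because the result is applied
  to Jacobians acting on vectors and to gradients under the inner product.\<close>

lemma uniform_linearization:
  fixes F :: "'a::euclidean_space \<Rightarrow> 'p::metric_space \<Rightarrow> 'b::real_normed_vector"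
    and D :: "'a \<Rightarrow> 'p \<Rightarrow> 'c::real_normed_vector" and pr :: "'c \<Rightarrow> 'a \<Rightarrow> 'b"
  assumes bil: "bounded_bilinear pr" and \<Theta>: "compact \<Theta>"
    and deriv: "\<And>x \<theta>. \<theta> \<in> \<Theta> \<Longrightarrow> ((\<lambda>z. F z \<theta>) has_derivative pr (D x \<theta>)) (at x)"
    and D: "continuous_on (UNIV \<times> \<Theta>) (\<lambda>(x, \<theta>). D x \<theta>)"
    and \<eta>: "0 < \<eta>"
  obtains \<delta> where "\<delta> > 0"
    "\<And>\<theta> x z. \<lbrakk>\<theta> \<in> \<Theta>; x \<in> cball 0 R; norm (z - x) < \<delta>\<rbrakk> \<Longrightarrow>
        norm (F z \<theta> - F x \<theta> - pr (D x \<theta>) (z - x)) \<le> \<eta> * norm (z - x)"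
proof -
  interpret bounded_bilinear pr by (rule bil)
  obtain K where K: "K > 0" "\<And>a b. norm (pr a b) \<le> norm a * norm b * K"
    using pos_bounded by blast
  \<comment> \<open>The margin 1 leaves room for the points of a ball around \<open>x\<close>, hence
    the radius \<open>min 1 d\<close> below.\<close>
  have "uniformly_continuous_on (cball 0 (R + 1) \<times> \<Theta>) (\<lambda>(x, \<theta>). D x \<theta>)"
    by (intro compact_uniformly_continuous compact_Times \<Theta> compact_cball continuous_on_subset[OF D]) auto
  then obtain d where d: "d > 0"
    "\<And>p q. \<lbrakk>p \<in> cball 0 (R + 1) \<times> \<Theta>; q \<in> cball 0 (R + 1) \<times> \<Theta>; dist q p < d\<rbrakk> \<Longrightarrow>
      dist (case q of (x, \<theta>) \<Rightarrow> D x \<theta>) (case p of (x, \<theta>) \<Rightarrow> D x \<theta>) < \<eta> / K"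
    using \<eta> K(1) unfolding uniformly_continuous_on_def by (metis divide_pos_pos)
  show ?thesis
  proof (rule that[of "min 1 d"])
    show "0 < min 1 d" using d by simp
    fix \<theta> and x z :: 'a assume \<theta>: "\<theta> \<in> \<Theta>" and x: "x \<in> cball 0 R" and z: "norm (z - x) < min 1 d"
    have "norm (F z \<theta> - F x \<theta> - pr (D x \<theta>) (z - x)) \<le> norm (z - x) * \<eta>"
    proof (rule differentiable_bound_linearization[where S = "ball x (min 1 d)" and f' = "\<lambda>y. pr (D y \<theta>)"])
      fix t :: real assume "t \<in> {0..1}"
      then have "norm (t *\<^sub>R (z - x)) \<le> 1 * norm (z - x)"
        unfolding norm_scaleR by (intro mult_right_mono) auto
      then show "x + t *\<^sub>R (z - x) \<in> ball x (min 1 d)"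
        using z by (simp add: dist_norm)
    next
      fix y assume y: "y \<in> ball x (min 1 d)"
      show "((\<lambda>z. F z \<theta>) has_derivative pr (D y \<theta>)) (at y within ball x (min 1 d))"
        by (rule has_derivative_at_withinI[OF deriv[OF \<theta>]])
      have "norm y \<le> norm x + norm (x - y)" by (metis norm_triangle_sub norm_minus_commute)
      then have "norm y \<le> R + 1" using x y by (auto simp: dist_norm)
      then have "dist (D y \<theta>) (D x \<theta>) < \<eta> / K"
        using d(2)[of "(x, \<theta>)" "(y, \<theta>)"] x y \<theta> by (auto simp: dist_Pair_Pair dist_commute)
      then have *: "norm (D y \<theta> - D x \<theta>) * K \<le> \<eta>"
        using K(1) by (simp add: dist_norm field_simps)
      show "onorm (pr (D y \<theta>) - pr (D x \<theta>)) \<le> \<eta>"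
      proof (rule onorm_le)
        fix h
        have "norm ((pr (D y \<theta>) - pr (D x \<theta>)) h) = norm (pr (D y \<theta> - D x \<theta>) h)"
          by (simp add: diff_left)
        also have "\<dots> \<le> norm (D y \<theta> - D x \<theta>) * norm h * K" by (rule K)
        also have "\<dots> = (norm (D y \<theta> - D x \<theta>) * K) * norm h" by simp
        also have "\<dots> \<le> \<eta> * norm h" by (intro mult_right_mono *) auto
        finally show "norm ((pr (D y \<theta>) - pr (D x \<theta>)) h) \<le> \<eta> * norm h" .
      qed
    qed (use d in auto)
    then show "norm (F z \<theta> - F x \<theta> - pr (D x \<theta>) (z - x)) \<le> \<eta> * norm (z - x)"
      by (simp add: mult.commute)
  qed
qed

lemma continuous_on_compact_norm_bound:
  fixes f :: "'a::topological_space \<Rightarrow> 'b::real_normed_vector"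
  assumes "compact S" "continuous_on S f"
  obtains B where "B > 0" "\<And>x. x \<in> S \<Longrightarrow> norm (f x) \<le> B"
  using compact_imp_bounded[OF compact_continuous_image[OF assms(2,1)]]
  unfolding bounded_pos by auto

lemma finite_family_norm_bound:
  fixes h :: "'i::finite \<Rightarrow> 'a::topological_space \<Rightarrow> 'b::real_normed_vector"
  assumes "compact S" "\<And>i. continuous_on S (h i)"
  obtains B where "B > 0" "\<And>i x. x \<in> S \<Longrightarrow> norm (h i x) \<le> B"
proof (rule continuous_on_compact_norm_bound[OF assms(1)])
  show "continuous_on S (\<lambda>x. \<chi> i. h i x)"
    by (intro continuous_on_vec_lambda assms(2))
  fix B assume B: "B > 0" "\<And>x. x \<in> S \<Longrightarrow> norm (\<chi> i. h i x) \<le> B"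
  have "norm (h i x) \<le> B" if "x \<in> S" for i x
    using Finite_Cartesian_Product.norm_nth_le[of "\<chi> i. h i x" i] B(2)[OF that] by simp
  with B(1) show thesis by (rule that)
qed

text \<open>The integrable weights do not depend on the parameter, so uniform continuity of the
  factors \<open>\<phi> i\<close> bounds the change of the integrand by a small multiple of one
  fixed integrable function.\<close>

lemma continuous_on_parametric_integral:
  fixes \<phi> :: "'i::finite \<Rightarrow> real \<Rightarrow> 'p::metric_space \<Rightarrow> real"
  assumes \<Theta>: "compact \<Theta>" and w: "\<And>i. w i absolutely_integrable_on {a..b}"
    and \<phi>: "\<And>i. continuous_on ({a..b} \<times> \<Theta>) (\<lambda>(t, \<theta>). \<phi> i t \<theta>)"
  shows "continuous_on \<Theta> (\<lambda>\<theta>. integral {a..b} (\<lambda>t. \<Sum>i\<in>UNIV. w i t * \<phi> i t \<theta>))"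
  unfolding continuous_on_iff
proof (intro ballI allI impI)
  fix \<theta>0 and e :: real assume \<theta>0: "\<theta>0 \<in> \<Theta>" and e: "e > 0"
  define \<kappa> where "\<kappa> t = (\<Sum>i\<in>UNIV. \<bar>w i t\<bar>)" for t
  have \<kappa>: "\<kappa> absolutely_integrable_on {a..b}"
    unfolding \<kappa>_def[abs_def]
    using absolutely_integrable_norm[OF w] by (intro absolutely_integrable_sum) (auto simp: o_def)
  then have \<kappa>i: "\<kappa> integrable_on {a..b}" by (rule absolutely_integrable_on_imp_integrable_on)
  have \<kappa>0: "0 \<le> integral {a..b} \<kappa>"
    by (intro integral_nonneg \<kappa>i) (auto simp: \<kappa>_def intro: sum_nonneg)
  define \<eta> where "\<eta> = e / (2 * (integral {a..b} \<kappa> + 1))"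
  have \<eta>: "\<eta> > 0" using e \<kappa>0 by (simp add: \<eta>_def)
  have "continuous_on ({a..b} \<times> \<Theta>) (\<lambda>p. \<chi> i. (\<lambda>(t, \<theta>). \<phi> i t \<theta>) p)"
    by (intro continuous_on_vec_lambda \<phi>)
  then have "uniformly_continuous_on ({a..b} \<times> \<Theta>) (\<lambda>p. \<chi> i. (\<lambda>(t, \<theta>). \<phi> i t \<theta>) p)"
    by (intro compact_uniformly_continuous compact_Times \<Theta>) auto
  then obtain d where d: "d > 0" "\<And>p q. \<lbrakk>p \<in> {a..b} \<times> \<Theta>; q \<in> {a..b} \<times> \<Theta>; dist q p < d\<rbrakk> \<Longrightarrow>
      dist (\<chi> i. (\<lambda>(t, \<theta>). \<phi> i t \<theta>) q) (\<chi> i. (\<lambda>(t, \<theta>). \<phi> i t \<theta>) p) < \<eta>"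
    using \<eta> unfolding uniformly_continuous_on_def by metis
  have int: "(\<lambda>t. \<Sum>i\<in>UNIV. w i t * \<phi> i t \<theta>) integrable_on {a..b}" if \<theta>: "\<theta> \<in> \<Theta>" for \<theta>
  proof (intro absolutely_integrable_on_imp_integrable_on absolutely_integrable_sum absolutely_integrable_mult_continuous w)
    fix i
    have "continuous_on {a..b} (\<lambda>t. (\<lambda>(t, \<theta>). \<phi> i t \<theta>) (t, \<theta>))"
      by (rule continuous_on_compose2[OF \<phi>]) (auto intro!: continuous_intros \<theta>)
    then show "continuous_on {a..b} (\<lambda>t. \<phi> i t \<theta>)" by simp
  qed auto
  show "\<exists>d>0. \<forall>\<theta>\<in>\<Theta>. dist \<theta> \<theta>0 < d \<longrightarrow>
      dist (integral {a..b} (\<lambda>t. \<Sum>i\<in>UNIV. w i t * \<phi> i t \<theta>)) (integral {a..b} (\<lambda>t. \<Sum>i\<in>UNIV. w i t * \<phi> i t \<theta>0)) < e"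
  proof (intro exI[of _ d] conjI ballI impI d)
    fix \<theta> assume \<theta>: "\<theta> \<in> \<Theta>" "dist \<theta> \<theta>0 < d"
    have "norm (integral {a..b} (\<lambda>t. (\<Sum>i\<in>UNIV. w i t * \<phi> i t \<theta>) - (\<Sum>i\<in>UNIV. w i t * \<phi> i t \<theta>0)))
        \<le> integral {a..b} (\<lambda>t. \<kappa> t * \<eta>)"
    proof (rule Henstock_Kurzweil_Integration.integral_norm_bound_integral)
      fix t assume t: "t \<in> {a..b}"
      have "norm (\<phi> i t \<theta> - \<phi> i t \<theta>0) \<le> \<eta>" for i
        using d(2)[of "(t, \<theta>0)" "(t, \<theta>)"] t \<theta> \<theta>0
          Finite_Cartesian_Product.norm_nth_le[of "(\<chi> i. \<phi> i t \<theta>) - (\<chi> i. \<phi> i t \<theta>0)" i]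
        by (simp add: dist_Pair_Pair dist_norm)
      then have "norm (\<Sum>i\<in>UNIV. w i t * (\<phi> i t \<theta> - \<phi> i t \<theta>0)) \<le> (\<Sum>i\<in>UNIV. \<bar>w i t\<bar> * \<eta>)"
        by (intro sum_norm_le) (auto simp: abs_mult intro!: mult_left_mono)
      then show "norm ((\<Sum>i\<in>UNIV. w i t * \<phi> i t \<theta>) - (\<Sum>i\<in>UNIV. w i t * \<phi> i t \<theta>0)) \<le> \<kappa> t * \<eta>"
        by (simp add: \<kappa>_def sum_distrib_right sum_subtractf right_diff_distrib)
    qed (auto intro!: integrable_diff int \<theta> \<theta>0 integrable_on_mult_left \<kappa>i)
    also have "\<dots> = integral {a..b} \<kappa> * \<eta>" by simp
    also have "\<dots> < e"
      using mult_strict_left_mono[of "integral {a..b} \<kappa>" "2 * (integral {a..b} \<kappa> + 1)" e] e \<kappa>0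
      by (simp add: \<eta>_def pos_divide_less_eq mult.commute)
    finally show "dist (integral {a..b} (\<lambda>t. \<Sum>i\<in>UNIV. w i t * \<phi> i t \<theta>)) (integral {a..b} (\<lambda>t. \<Sum>i\<in>UNIV. w i t * \<phi> i t \<theta>0)) < e"
      by (simp add: dist_norm Henstock_Kurzweil_Integration.integral_diff[OF int[OF \<theta>(1)] int[OF \<theta>0]])
  qed
qed

text \<open>Drift and controlled fields share one index type, so that a control is just a family of
  weights. \<open>J\<close> and \<open>a'\<close> are data characterized by their derivative
  property, which keeps the analysis free of the operators \<open>jacobian\<close> and
  \<open>gradient\<close>.\<close>

locale affine_system =
  fixes T L :: real and \<Theta> :: "'p::metric_space set"
    and G :: "'i::finite \<Rightarrow> real^'d \<Rightarrow> 'p \<Rightarrow> real^'d"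
    and J :: "'i \<Rightarrow> real^'d \<Rightarrow> 'p \<Rightarrow> real^'d^'d"
    and x0 :: "'p \<Rightarrow> real^'d"
    and a :: "real^'d \<Rightarrow> 'p \<Rightarrow> real"
    and a' :: "real^'d \<Rightarrow> 'p \<Rightarrow> real^'d"
  assumes T: "0 \<le> T" and \<Theta>: "compact \<Theta>" and L: "0 \<le> L"
    and G_lipschitz: "\<theta> \<in> \<Theta> \<Longrightarrow> norm (G i x \<theta> - G i y \<theta>) \<le> L * norm (x - y)"
    and G_cont: "continuous_on (UNIV \<times> \<Theta>) (\<lambda>(x, \<theta>). G i x \<theta>)"
    and G_deriv: "\<theta> \<in> \<Theta> \<Longrightarrow> ((\<lambda>z. G i z \<theta>) has_derivative (\<lambda>h. J i x \<theta> *v h)) (at x)"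
    and J_cont: "continuous_on (UNIV \<times> \<Theta>) (\<lambda>(x, \<theta>). J i x \<theta>)"
    and x0_cont: "continuous_on \<Theta> x0"
    and a_deriv: "\<theta> \<in> \<Theta> \<Longrightarrow> ((\<lambda>z. a z \<theta>) has_derivative (\<lambda>h. a' x \<theta> \<bullet> h)) (at x)"
    and a'_cont: "continuous_on (UNIV \<times> \<Theta>) (\<lambda>(x, \<theta>). a' x \<theta>)"
begin

definition vfield :: "('i \<Rightarrow> real \<Rightarrow> real) \<Rightarrow> 'p \<Rightarrow> real \<Rightarrow> real^'d \<Rightarrow> real^'d" where
  "vfield \<omega> \<theta> s x = (\<Sum>i\<in>UNIV. \<omega> i s *\<^sub>R G i x \<theta>)"

text \<open>A predicate instead of a function: everything below holds for any solution, in
  particular for the one picked by \<open>SOME\<close> in \<open>state_map\<close>.\<close>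

definition is_state :: "('i \<Rightarrow> real \<Rightarrow> real) \<Rightarrow> 'p \<Rightarrow> (real \<Rightarrow> real^'d) \<Rightarrow> bool" where
  "is_state \<omega> \<theta> x \<longleftrightarrow> caratheodory_solution T (vfield \<omega> \<theta>) x \<and> x 0 = x0 \<theta>"

definition is_adjoint :: "('i \<Rightarrow> real \<Rightarrow> real) \<Rightarrow> 'p \<Rightarrow> (real \<Rightarrow> real^'d) \<Rightarrow> (real \<Rightarrow> real^'d) \<Rightarrow> bool" where
  "is_adjoint \<omega> \<theta> x l \<longleftrightarrow>
     caratheodory_solution T (\<lambda>s y. - (y v* (\<Sum>i\<in>UNIV. \<omega> i s *\<^sub>R J i (x s) \<theta>))) l \<and> l T = - a' (x T) \<theta>"

definition admissible :: "('i \<Rightarrow> real \<Rightarrow> real) \<Rightarrow> bool" where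
  "admissible \<omega> \<longleftrightarrow> (\<forall>i. \<omega> i absolutely_integrable_on {0..T})"

section \<open>Existence and continuous dependence of states and adjoints\<close>

lemma state_ode: "admissible \<omega> \<Longrightarrow> ode_family T L \<Theta> \<omega> (\<lambda>i s. G i) x0"
proof (unfold_locales, goal_cases)
  case (6 i)
  have "continuous_on ({0..T} \<times> UNIV \<times> \<Theta>) (\<lambda>p. (\<lambda>(x, \<theta>). G i x \<theta>) (snd p))"
    by (rule continuous_on_compose2[OF G_cont]) (auto intro!: continuous_intros)
  then show ?case by (simp add: split_def)
qed (use T \<Theta> L G_lipschitz x0_cont in \<open>auto simp: admissible_def\<close>)

lemma state_field: "admissible \<omega> \<Longrightarrow> ode_family.field \<omega> (\<lambda>i s. G i) = vfield \<omega>"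
  by (simp add: fun_eq_iff vfield_def ode_family.field_def[OF state_ode])

lemma vfield_integrable:
  assumes "admissible \<omega>" "\<theta> \<in> \<Theta>" "continuous_on {0..T} y"
  shows "(\<lambda>s. vfield \<omega> \<theta> s (y s)) absolutely_integrable_on {0..T}"
  using ode_family.field_integrable[OF state_ode] assms by (simp add: state_field)

lemma state_exists:
  assumes "admissible \<omega>" "\<theta> \<in> \<Theta>"
  shows "\<exists>x. is_state \<omega> \<theta> x"
proof -
  obtain x where x: "continuous_on {0..T} x"
    "\<And>t. t \<in> {0..T} \<Longrightarrow> x t = x0 \<theta> + integral {0..t} (\<lambda>s. vfield \<omega> \<theta> s (x s))"
    using ode_family.exists_solution[OF state_ode, OF assms]
    unfolding state_field[OF assms(1)] by blast
  have "caratheodory_solution T (vfield \<omega> \<theta>) x"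
    by (rule caratheodory_solutionI[where g = "vfield \<omega> \<theta>" and x = x, OF vfield_integrable[OF assms x(1)] x(2)])
  moreover have "x 0 = x0 \<theta>" using x(2)[of 0] T by simp
  ultimately show ?thesis by (auto simp: is_state_def)
qed

lemma is_state_cont: "is_state \<omega> \<theta> x \<Longrightarrow> continuous_on {0..T} x"
  by (auto simp: is_state_def intro: caratheodory_solution_continuous_on)

lemma is_state_eq:
  assumes "is_state \<omega> \<theta> x" "t \<in> {0..T}"
  shows "x t = x0 \<theta> + integral {0..t} (\<lambda>s. vfield \<omega> \<theta> s (x s))"
  using caratheodory_solution_has_integral[of T "vfield \<omega> \<theta>" x 0 t] assms
  by (auto simp: is_state_def integral_unique)

lemma state_cont:
  assumes "admissible \<omega>" "\<And>\<theta>. \<theta> \<in> \<Theta> \<Longrightarrow> is_state \<omega> \<theta> (\<lambda>t. X t \<theta>)"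
  shows "continuous_on ({0..T} \<times> \<Theta>) (\<lambda>(t, \<theta>). X t \<theta>)"
  by (rule ode_family.solution_cont[OF state_ode[OF assms(1)]])
     (use assms is_state_cont is_state_eq in \<open>auto simp: state_field\<close>)

lemma comp_cont:
  fixes M :: "real^'d \<Rightarrow> 'p \<Rightarrow> 'e::topological_space"
  assumes "continuous_on (UNIV \<times> \<Theta>) (\<lambda>(x, \<theta>). M x \<theta>)" "continuous_on ({0..T} \<times> \<Theta>) (\<lambda>(t, \<theta>). X t \<theta>)"
  shows "continuous_on ({0..T} \<times> \<Theta>) (\<lambda>(t, \<theta>). M (X t \<theta>) \<theta>)"
proof -
  have "continuous_on ({0..T} \<times> \<Theta>) (\<lambda>p. (\<lambda>(x, \<theta>). M x \<theta>) ((\<lambda>(t, \<theta>). X t \<theta>) p, snd p))"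
    by (rule continuous_on_compose2[OF assms(1)]) (auto intro!: continuous_intros assms(2))
  then show ?thesis by (simp add: split_def)
qed

lemma continuous_on_slice:
  assumes "continuous_on (S \<times> \<Theta>) (\<lambda>(t, \<theta>). h t \<theta>)" "\<theta> \<in> \<Theta>"
  shows "continuous_on S (\<lambda>t. h t \<theta>)"
proof -
  have "continuous_on S (\<lambda>t. (\<lambda>(t, \<theta>). h t \<theta>) (t, \<theta>))"
    by (rule continuous_on_compose2[OF assms(1)]) (auto intro!: continuous_intros assms(2))
  then show ?thesis by simp
qed

text \<open>Brings the right-hand side of the adjoint equation into the weighted form that
  \<open>ode_family\<close> expects.\<close>

lemma adjoint_field:
  "y v* (\<Sum>i\<in>UNIV. c i *\<^sub>R A i) = (\<Sum>i\<in>UNIV. c i *\<^sub>R ((y::real^'d) v* (A i :: real^'d^'d)))"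
proof -
  interpret bounded_bilinear "\<lambda>(y::real^'d) (A::real^'d^'d). y v* A"
    by (rule bounded_bilinear_vector_matrix_mult)
  show ?thesis by (simp add: sum_right scaleR_right)
qed

text \<open>The adjoint equation becomes an initial value problem under the time reversal \<open>t \<mapsto> T - t\<close>.\<close>
lemma adjoint_ode:
  assumes \<omega>: "admissible \<omega>" and X: "continuous_on ({0..T} \<times> \<Theta>) (\<lambda>(t, \<theta>). X t \<theta>)"
  obtains N where "ode_family T N \<Theta> (\<lambda>i s. \<omega> i (T - s)) (\<lambda>i s y \<theta>. y v* J i (X (T - s) \<theta>) \<theta>) (\<lambda>\<theta>. - a' (X T \<theta>) \<theta>)"
proof -
  interpret bounded_bilinear "\<lambda>(y::real^'d) (A::real^'d^'d). y v* A"
    by (rule bounded_bilinear_vector_matrix_mult)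
  obtain K where K: "K > 0" "\<And>y A. norm ((y::real^'d) v* (A::real^'d^'d)) \<le> norm y * norm A * K"
    using pos_bounded by blast
  have JX: "continuous_on ({0..T} \<times> \<Theta>) (\<lambda>(t, \<theta>). J i (X t \<theta>) \<theta>)" for i
    by (rule comp_cont[OF J_cont X])
  obtain B where B: "B > 0" "\<And>i p. p \<in> {0..T} \<times> \<Theta> \<Longrightarrow> norm (case p of (t, \<theta>) \<Rightarrow> J i (X t \<theta>) \<theta>) \<le> B"
    by (rule finite_family_norm_bound[OF compact_Times[OF compact_Icc \<Theta>] JX]) (rule that)
  show ?thesis
  proof (rule that[of "B * K"], unfold_locales, goal_cases)
    case 3
    show ?case using B(1) K(1) by simp
  next
    case (4 i)
    show ?case using absolutely_integrable_reflect_affine[where f = "\<omega> i" and T = T] \<omega> by (simp add: admissible_def)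
  next
    case (5 s \<theta> i x y)
    have "norm (x v* J i (X (T - s) \<theta>) \<theta> - y v* J i (X (T - s) \<theta>) \<theta>) = norm ((x - y) v* J i (X (T - s) \<theta>) \<theta>)"
      by (simp add: diff_left)
    also have "\<dots> \<le> norm (x - y) * norm (J i (X (T - s) \<theta>) \<theta>) * K" by (rule K)
    also have "\<dots> \<le> norm (x - y) * B * K"
      using B(2)[of "(T - s, \<theta>)" i] 5 K(1) by (intro mult_left_mono mult_right_mono) auto
    finally show ?case by (simp add: mult_ac)
  next
    case (6 i)
    have "continuous_on ({0..T} \<times> (UNIV::(real^'d) set) \<times> \<Theta>)
        (\<lambda>p. (\<lambda>(t, \<theta>). J i (X t \<theta>) \<theta>) (T - fst p, snd (snd p)))"
      by (rule continuous_on_compose2[OF JX]) (auto intro!: continuous_intros)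
    then have "continuous_on ({0..T} \<times> (UNIV::(real^'d) set) \<times> \<Theta>)
        (\<lambda>p. fst (snd p) v* J i (X (T - fst p) (snd (snd p))) (snd (snd p)))"
      by (intro continuous_on continuous_intros) simp
    then show ?case by (simp add: split_def)
  next
    case 7
    have "continuous_on \<Theta> (\<lambda>\<theta>. (\<lambda>(t, \<theta>). a' (X t \<theta>) \<theta>) (T, \<theta>))"
      by (rule continuous_on_compose2[OF comp_cont[OF a'_cont X]]) (auto intro!: continuous_intros simp: T)
    then show ?case by (simp add: continuous_on_minus)
  qed (use T \<Theta> in auto)
qed

lemma adjoint_field_integrable:
  assumes \<omega>: "admissible \<omega>" and X: "continuous_on ({0..T} \<times> \<Theta>) (\<lambda>(t, \<theta>). X t \<theta>)" and \<theta>: "\<theta> \<in> \<Theta>"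
    and y: "continuous_on {0..T} y"
  shows "(\<lambda>s. - (y s v* (\<Sum>i\<in>UNIV. \<omega> i s *\<^sub>R J i (X s \<theta>) \<theta>))) absolutely_integrable_on {0..T}"
proof -
  interpret bounded_bilinear "\<lambda>(y::real^'d) (A::real^'d^'d). y v* A"
    by (rule bounded_bilinear_vector_matrix_mult)
  have "continuous_on {0..T} (\<lambda>s. J i (X s \<theta>) \<theta>)" for i
    by (rule continuous_on_slice[OF comp_cont[OF J_cont X] \<theta>])
  then have "continuous_on {0..T} (\<lambda>s. y s v* J i (X s \<theta>) \<theta>)" for i
    by (intro continuous_on y)
  then have "(\<lambda>s. \<Sum>i\<in>UNIV. \<omega> i s *\<^sub>R (y s v* J i (X s \<theta>) \<theta>)) absolutely_integrable_on {0..T}"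
    using \<omega> by (intro absolutely_integrable_sum absolutely_integrable_scaleR_continuous) (auto simp: admissible_def)
  from absolutely_integrable_scaleR_left[OF this, of "-1"] show ?thesis
    by (simp add: adjoint_field)
qed

lemma adjoint_exists:
  assumes \<omega>: "admissible \<omega>" and X: "continuous_on ({0..T} \<times> \<Theta>) (\<lambda>(t, \<theta>). X t \<theta>)" and \<theta>: "\<theta> \<in> \<Theta>"
  shows "\<exists>l. is_adjoint \<omega> \<theta> (\<lambda>t. X t \<theta>) l"
proof -
  obtain N where N: "ode_family T N \<Theta> (\<lambda>i s. \<omega> i (T - s)) (\<lambda>i s y \<theta>. y v* J i (X (T - s) \<theta>) \<theta>) (\<lambda>\<theta>. - a' (X T \<theta>) \<theta>)"
    using adjoint_ode[OF \<omega> X] .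
  define h where "h s y = (\<Sum>i\<in>UNIV. \<omega> i (T - s) *\<^sub>R (y v* J i (X (T - s) \<theta>) \<theta>))" for s y
  obtain \<eta> where \<eta>: "continuous_on {0..T} \<eta>"
    "\<And>t. t \<in> {0..T} \<Longrightarrow> \<eta> t = - a' (X T \<theta>) \<theta> + integral {0..t} (\<lambda>s. h s (\<eta> s))"
    using ode_family.exists_solution[OF N \<theta>] unfolding ode_family.field_def[OF N] h_def by blast
  define l where "l t = \<eta> (T - t)" for t
  define g where "g s = - (l s v* (\<Sum>i\<in>UNIV. \<omega> i s *\<^sub>R J i (X s \<theta>) \<theta>))" for s
  have lc: "continuous_on {0..T} l"
    unfolding l_def[abs_def] by (rule continuous_on_compose2[OF \<eta>(1)]) (auto intro!: continuous_intros)
  have gi: "g absolutely_integrable_on {0..T}"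
    unfolding g_def[abs_def] by (rule adjoint_field_integrable[OF \<omega> X \<theta> lc])
  have gh: "g (T - r) = - h r (\<eta> r)" for r
    by (simp add: g_def h_def adjoint_field l_def)
  have g_int: "g integrable_on {u..v}" if "0 \<le> u" "v \<le> T" for u v
    using that by (intro absolutely_integrable_on_imp_integrable_on absolutely_integrable_on_subinterval[OF gi]) auto
  have l_eq: "l t = - a' (X T \<theta>) \<theta> - integral {t..T} g" if t: "t \<in> {0..T}" for t
  proof -
    have "((\<lambda>r. g (T - r)) has_integral integral {t..T} g) {T - T..T - t}"
      using t by (intro has_integral_reflect_affine integrable_integral g_int) auto
    then have "((\<lambda>r. - (h r (\<eta> r))) has_integral integral {t..T} g) {0..T - t}" by (simp add: gh)
    from has_integral_neg[OF this] have "integral {0..T - t} (\<lambda>r. h r (\<eta> r)) = - integral {t..T} g"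
      by (simp add: integral_unique)
    then show ?thesis using \<eta>(2)[of "T - t"] t by (simp add: l_def)
  qed
  \<comment> \<open>The reversed problem yields an equation integrated backwards from
    \<open>T\<close>, whereas \<open>caratheodory_solutionI\<close> needs one starting at 0;
    additivity of the integral converts it.\<close>
  have "l t = l 0 + integral {0..t} g" if t: "t \<in> {0..T}" for t
  proof -
    have "integral {0..t} g + integral {t..T} g = integral {0..T} g"
      using t g_int[of 0 T] by (intro Henstock_Kurzweil_Integration.integral_combine) auto
    then have "l 0 = - a' (X T \<theta>) \<theta> - (integral {0..t} g + integral {t..T} g)" using l_eq[of 0] T by simp
    then show ?thesis using l_eq[OF t] by simp
  qed
  note l_int = this[unfolded g_def[abs_def]]
  have "caratheodory_solution T (\<lambda>s y. - (y v* (\<Sum>i\<in>UNIV. \<omega> i s *\<^sub>R J i (X s \<theta>) \<theta>))) l"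
    by (rule caratheodory_solutionI[where g = "\<lambda>s y. - (y v* (\<Sum>i\<in>UNIV. \<omega> i s *\<^sub>R J i (X s \<theta>) \<theta>))",
          OF gi[unfolded g_def[abs_def]] l_int])
  moreover have "l T = - a' (X T \<theta>) \<theta>" using l_eq[of T] T by simp
  ultimately show ?thesis by (auto simp: is_adjoint_def)
qed

lemma is_adjoint_cont: "is_adjoint \<omega> \<theta> x l \<Longrightarrow> continuous_on {0..T} l"
  by (auto simp: is_adjoint_def intro: caratheodory_solution_continuous_on)

lemma adjoint_cont:
  assumes \<omega>: "admissible \<omega>" and X: "continuous_on ({0..T} \<times> \<Theta>) (\<lambda>(t, \<theta>). X t \<theta>)"
    and l: "\<And>\<theta>. \<theta> \<in> \<Theta> \<Longrightarrow> is_adjoint \<omega> \<theta> (\<lambda>t. X t \<theta>) (\<lambda>t. l t \<theta>)"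
  shows "continuous_on ({0..T} \<times> \<Theta>) (\<lambda>(t, \<theta>). l t \<theta>)"
proof -
  obtain N where N: "ode_family T N \<Theta> (\<lambda>i s. \<omega> i (T - s)) (\<lambda>i s y \<theta>. y v* J i (X (T - s) \<theta>) \<theta>) (\<lambda>\<theta>. - a' (X T \<theta>) \<theta>)"
    using adjoint_ode[OF \<omega> X] .
  have "continuous_on ({0..T} \<times> \<Theta>) (\<lambda>(t, \<theta>). l (T - t) \<theta>)"
  proof (rule ode_family.solution_cont[OF N])
    fix \<theta> assume \<theta>: "\<theta> \<in> \<Theta>"
    show "continuous_on {0..T} (\<lambda>t. l (T - t) \<theta>)"
      by (rule continuous_on_compose2[OF is_adjoint_cont[OF l[OF \<theta>]]]) (auto intro!: continuous_intros)
    fix t assume t: "t \<in> {0..T}"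
    define g where "g s = - (l s \<theta> v* (\<Sum>i\<in>UNIV. \<omega> i s *\<^sub>R J i (X s \<theta>) \<theta>))" for s
    have "(g has_integral l T \<theta> - l (T - t) \<theta>) {T - t..T}"
      using caratheodory_solution_has_integral[of T "\<lambda>s y. - (y v* (\<Sum>i\<in>UNIV. \<omega> i s *\<^sub>R J i (X s \<theta>) \<theta>))" "\<lambda>t. l t \<theta>" "T - t" T]
        l[OF \<theta>] t
      by (auto simp: is_adjoint_def g_def[abs_def])
    from has_integral_neg[OF has_integral_reflect_affine[OF this, of T]]
    have "((\<lambda>r. - g (T - r)) has_integral l (T - t) \<theta> - l T \<theta>) {0..t}" by simp
    moreover have "- g (T - r) = ode_family.field (\<lambda>i s. \<omega> i (T - s)) (\<lambda>i s y \<theta>. y v* J i (X (T - s) \<theta>) \<theta>) \<theta> r (l (T - r) \<theta>)" for r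
      by (simp add: g_def adjoint_field ode_family.field_def[OF N])
    moreover have "l T \<theta> = - a' (X T \<theta>) \<theta>" using l[OF \<theta>] by (simp add: is_adjoint_def)
    ultimately show "l (T - t) \<theta> = - a' (X T \<theta>) \<theta> + integral {0..t} (\<lambda>s.
        ode_family.field (\<lambda>i s. \<omega> i (T - s)) (\<lambda>i s y \<theta>. y v* J i (X (T - s) \<theta>) \<theta>) \<theta> s (l (T - s) \<theta>))"
      by (simp add: integral_unique)
  qed
  then have "continuous_on ({0..T} \<times> \<Theta>) (\<lambda>p. (\<lambda>(t, \<theta>). l (T - t) \<theta>) (T - fst p, snd p))"
    by (rule continuous_on_compose2) (auto intro!: continuous_intros)
  then show ?thesis by (simp add: split_def)
qed

text \<open>Minus the derivative of the end-point cost in the direction \<open>w\<close>. The sign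
  comes from the terminal value \<open>- a'\<close> of the adjoint.\<close>

definition sensitivity where
  "sensitivity w X l \<theta> = integral {0..T} (\<lambda>t. \<Sum>i\<in>UNIV. w i t * (l t \<theta> \<bullet> G i (X t \<theta>) \<theta>))"

lemma sensitivity_cont:
  assumes "admissible w" and X: "continuous_on ({0..T} \<times> \<Theta>) (\<lambda>(t, \<theta>). X t \<theta>)"
    and l: "continuous_on ({0..T} \<times> \<Theta>) (\<lambda>(t, \<theta>). l t \<theta>)"
  shows "continuous_on \<Theta> (sensitivity w X l)"
  unfolding sensitivity_def[abs_def]
proof (rule continuous_on_parametric_integral[OF \<Theta>])
  fix i
  show "continuous_on ({0..T} \<times> \<Theta>) (\<lambda>(t, \<theta>). l t \<theta> \<bullet> G i (X t \<theta>) \<theta>)"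
    using continuous_on_inner[OF l comp_cont[OF G_cont X]] by (simp add: split_def)
qed (use assms in \<open>simp add: admissible_def\<close>)

section \<open>First order expansion of the end-point cost\<close>

lemma admissible_kernel:
  assumes "admissible w"
  shows "(\<lambda>s. \<Sum>i\<in>UNIV. \<bar>w i s\<bar>) absolutely_integrable_on {0..T}"
proof (rule absolutely_integrable_sum)
  fix i
  have "w i absolutely_integrable_on {0..T}" using assms by (simp add: admissible_def)
  from absolutely_integrable_norm[OF this] show "(\<lambda>s. \<bar>w i s\<bar>) absolutely_integrable_on {0..T}"
    by (simp add: o_def)
qed simp

lemma admissible_add_scaled:
  assumes "admissible \<omega>" "admissible w"
  shows "admissible (\<lambda>i s. \<omega> i s + \<epsilon> * w i s)"
  unfolding admissible_def
proof
  fix i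
  have "(\<lambda>s. \<epsilon> *\<^sub>R w i s) absolutely_integrable_on {0..T}"
    using assms by (intro absolutely_integrable_scaleR_left) (simp add: admissible_def)
  then show "(\<lambda>s. \<omega> i s + \<epsilon> * w i s) absolutely_integrable_on {0..T}"
    using assms by (auto simp: admissible_def)
qed

text \<open>Only the term \<open>\<epsilon> * w\<close>, multiplied by the fields along the
  unperturbed trajectories, drives the two solutions apart, and those fields are bounded by
  compactness. For \<open>\<epsilon> \<le> 1\<close> the perturbed weights are dominated by
  \<open>\<bar>\<omega> i s\<bar> + \<bar>w i s\<bar>\<close>, so Gronwall's constant does not
  depend on \<open>\<epsilon>\<close>.\<close>

lemma perturbed_bound:
  assumes \<omega>: "admissible \<omega>" and w: "admissible w"
    and X: "\<And>\<theta>. \<theta> \<in> \<Theta> \<Longrightarrow> is_state \<omega> \<theta> (\<lambda>t. X t \<theta>)"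
  obtains C where "C > 0" "\<And>\<epsilon> \<theta> x t. \<lbrakk>0 \<le> \<epsilon>; \<epsilon> \<le> 1; \<theta> \<in> \<Theta>; is_state (\<lambda>i s. \<omega> i s + \<epsilon> * w i s) \<theta> x; t \<in> {0..T}\<rbrakk>
      \<Longrightarrow> norm (x t - X t \<theta>) \<le> C * \<epsilon>"
proof -
  define \<kappa>w where "\<kappa>w s = (\<Sum>i\<in>UNIV. \<bar>w i s\<bar>)" for s
  define \<kappa> where "\<kappa> s = (\<Sum>i\<in>UNIV. \<bar>\<omega> i s\<bar>) + \<kappa>w s" for s
  have \<kappa>w: "\<kappa>w absolutely_integrable_on {0..T}"
    unfolding \<kappa>w_def[abs_def] by (rule admissible_kernel[OF w])
  have \<kappa>: "\<kappa> absolutely_integrable_on {0..T}"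
    unfolding \<kappa>_def[abs_def] using \<kappa>w admissible_kernel[OF \<omega>] by auto
  have pos: "0 \<le> \<kappa>w s" "0 \<le> \<kappa> s" for s
    by (auto simp: \<kappa>w_def \<kappa>_def intro!: sum_nonneg add_nonneg_nonneg)
  have L\<kappa>: "(\<lambda>s. L * \<kappa> s) absolutely_integrable_on {0..T}"
    using absolutely_integrable_scaleR_left[OF \<kappa>] by simp
  have Xc: "continuous_on ({0..T} \<times> \<Theta>) (\<lambda>(t, \<theta>). X t \<theta>)" by (rule state_cont[OF \<omega> X])
  have GX: "continuous_on ({0..T} \<times> \<Theta>) (\<lambda>(t, \<theta>). G i (X t \<theta>) \<theta>)" for i
    by (rule comp_cont[OF G_cont Xc])
  obtain M where M: "M > 0" "\<And>i p. p \<in> {0..T} \<times> \<Theta> \<Longrightarrow> norm (case p of (t, \<theta>) \<Rightarrow> G i (X t \<theta>) \<theta>) \<le> M"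
    by (rule finite_family_norm_bound[OF compact_Times[OF compact_Icc \<Theta>] GX]) (rule that)
  define W where "W = integral {0..T} \<kappa>w"
  have W: "W \<ge> 0" unfolding W_def
    by (intro integral_nonneg absolutely_integrable_on_imp_integrable_on \<kappa>w pos)
  \<comment> \<open>The summand 1 keeps \<open>C\<close> positive for the zero direction as well;
    later estimates divide by it.\<close>
  define C where "C = 2 * (M * W) * exp (2 * integral {0..T} (\<lambda>s. L * \<kappa> s)) + 1"
  show ?thesis
  proof (rule that[of C])
    show "C > 0" using M W by (simp add: C_def add_nonneg_pos)
    fix \<epsilon> \<theta> x t
    assume \<epsilon>: "0 \<le> \<epsilon>" "\<epsilon> \<le> 1" and \<theta>: "\<theta> \<in> \<Theta>"
      and x: "is_state (\<lambda>i s. \<omega> i s + \<epsilon> * w i s) \<theta> x" and t: "t \<in> {0..T}"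
    let ?\<omega> = "\<lambda>i s. \<omega> i s + \<epsilon> * w i s" and ?z = "\<lambda>t. norm (x t - X t \<theta>)"
    have zc: "continuous_on {0..T} ?z"
      by (intro continuous_intros is_state_cont[OF x] is_state_cont[OF X[OF \<theta>]])
    have "?z t \<le> 2 * (\<epsilon> * M * W) * exp (2 * integral {0..T} (\<lambda>s. L * \<kappa> s))"
    proof (rule gronwall[OF L\<kappa> _ zc _ _ t])
      fix t assume t: "t \<in> {0..T}"
      then have sub: "{0..t} \<subseteq> {0..T}" by auto
      note sub_int = absolutely_integrable_on_imp_integrable_on[OF absolutely_integrable_on_subinterval[OF _ sub]]
      have f1: "(\<lambda>s. vfield ?\<omega> \<theta> s (x s)) integrable_on {0..t}"
        by (intro sub_int vfield_integrable admissible_add_scaled \<omega> w \<theta> is_state_cont[OF x])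
      have f2: "(\<lambda>s. vfield \<omega> \<theta> s (X s \<theta>)) integrable_on {0..t}"
        by (intro sub_int vfield_integrable \<omega> \<theta> is_state_cont[OF X[OF \<theta>]])
      have zi: "(\<lambda>s. L * \<kappa> s * ?z s) integrable_on {0..t}"
        by (intro sub_int absolutely_integrable_mult_continuous L\<kappa> zc)
      have wi: "(\<lambda>s. \<epsilon> * M * \<kappa>w s) integrable_on {0..t}"
        using integrable_on_mult_right[OF sub_int[OF \<kappa>w]] .
      have "?z t = norm (integral {0..t} (\<lambda>s. vfield ?\<omega> \<theta> s (x s) - vfield \<omega> \<theta> s (X s \<theta>)))"
        using is_state_eq[OF x t] is_state_eq[OF X[OF \<theta>] t]
        by (simp add: Henstock_Kurzweil_Integration.integral_diff[OF f1 f2])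
      also have "\<dots> \<le> integral {0..t} (\<lambda>s. L * \<kappa> s * ?z s + \<epsilon> * M * \<kappa>w s)"
      proof (rule Henstock_Kurzweil_Integration.integral_norm_bound_integral)
        show "(\<lambda>s. vfield ?\<omega> \<theta> s (x s) - vfield \<omega> \<theta> s (X s \<theta>)) integrable_on {0..t}"
          by (intro integrable_diff f1 f2)
        show "(\<lambda>s. L * \<kappa> s * ?z s + \<epsilon> * M * \<kappa>w s) integrable_on {0..t}"
          by (intro integrable_add zi wi)
        fix s assume "s \<in> {0..t}"
        then have s: "s \<in> {0..T}" using sub by auto
        \<comment> \<open>The unperturbed trajectory is inserted into the perturbing term too, so
          that its field is evaluated where the bound \<open>M\<close> is known.\<close>
        have eq: "vfield ?\<omega> \<theta> s (x s) - vfield \<omega> \<theta> s (X s \<theta>) =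
            (\<Sum>i\<in>UNIV. (\<omega> i s + \<epsilon> * w i s) *\<^sub>R (G i (x s) \<theta> - G i (X s \<theta>) \<theta>) + (\<epsilon> * w i s) *\<^sub>R G i (X s \<theta>) \<theta>)"
          by (simp add: vfield_def algebra_simps sum.distrib sum_subtractf)
        have "norm (vfield ?\<omega> \<theta> s (x s) - vfield \<omega> \<theta> s (X s \<theta>))
            \<le> (\<Sum>i\<in>UNIV. (\<bar>\<omega> i s\<bar> + \<bar>w i s\<bar>) * (L * ?z s) + \<epsilon> * \<bar>w i s\<bar> * M)"
          unfolding eq
        proof (intro sum_norm_le)
          fix i
          have "\<bar>\<omega> i s + \<epsilon> * w i s\<bar> \<le> \<bar>\<omega> i s\<bar> + \<epsilon> * \<bar>w i s\<bar>"
            using \<epsilon> abs_triangle_ineq[of "\<omega> i s" "\<epsilon> * w i s"] by (simp add: abs_mult)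
          also have "\<epsilon> * \<bar>w i s\<bar> \<le> \<bar>w i s\<bar>" using \<epsilon> by (simp add: mult_left_le_one_le)
          finally have "\<bar>\<omega> i s + \<epsilon> * w i s\<bar> \<le> \<bar>\<omega> i s\<bar> + \<bar>w i s\<bar>" by simp
          then have 1: "norm ((\<omega> i s + \<epsilon> * w i s) *\<^sub>R (G i (x s) \<theta> - G i (X s \<theta>) \<theta>)) \<le> (\<bar>\<omega> i s\<bar> + \<bar>w i s\<bar>) * (L * ?z s)"
            unfolding norm_scaleR by (intro mult_mono G_lipschitz \<theta>) auto
          have 2: "norm ((\<epsilon> * w i s) *\<^sub>R G i (X s \<theta>) \<theta>) \<le> \<epsilon> * \<bar>w i s\<bar> * M"
            using M(2)[of "(s, \<theta>)" i] s \<theta> \<epsilon> by (auto simp: abs_mult intro!: mult_left_mono)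
          show "norm ((\<omega> i s + \<epsilon> * w i s) *\<^sub>R (G i (x s) \<theta> - G i (X s \<theta>) \<theta>) + (\<epsilon> * w i s) *\<^sub>R G i (X s \<theta>) \<theta>)
              \<le> (\<bar>\<omega> i s\<bar> + \<bar>w i s\<bar>) * (L * ?z s) + \<epsilon> * \<bar>w i s\<bar> * M"
            by (rule norm_triangle_le[OF add_mono[OF 1 2]])
        qed
        also have "\<dots> = \<kappa> s * (L * ?z s) + \<epsilon> * \<kappa>w s * M"
          unfolding \<kappa>_def \<kappa>w_def by (simp only: sum.distrib[symmetric] sum_distrib_left sum_distrib_right)
        also have "\<dots> = L * \<kappa> s * ?z s + \<epsilon> * M * \<kappa>w s" by (simp add: mult_ac)
        finally show "norm (vfield ?\<omega> \<theta> s (x s) - vfield \<omega> \<theta> s (X s \<theta>)) \<le> L * \<kappa> s * ?z s + \<epsilon> * M * \<kappa>w s" .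
      qed
      also have "\<dots> = integral {0..t} (\<lambda>s. L * \<kappa> s * ?z s) + \<epsilon> * M * integral {0..t} \<kappa>w"
        by (simp add: Henstock_Kurzweil_Integration.integral_add[OF zi wi])
      also have "\<epsilon> * M * integral {0..t} \<kappa>w \<le> \<epsilon> * M * W"
        unfolding W_def using \<epsilon> M t pos by (intro mult_left_mono indefinite_integral_mono[OF \<kappa>w]) auto
      finally show "?z t \<le> \<epsilon> * M * W + integral {0..t} (\<lambda>s. L * \<kappa> s * ?z s)" by simp
    qed (use L pos in auto)
    also have "\<dots> = (C - 1) * \<epsilon>" by (simp add: C_def)
    also have "\<dots> \<le> C * \<epsilon>" using \<epsilon> by (intro mult_right_mono) auto
    finally show "?z t \<le> C * \<epsilon>" .
  qed
qed

text \<open>Differentiating \<open>\<lambda> \<bullet> (x\<^sub>\<epsilon> - x)\<close> along the trajectories, the first order terms in the state cancel.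
  This expresses the variation of the end-point cost without solving the linearized equation.\<close>
lemma endpoint_expansion:
  assumes \<omega>: "admissible \<omega>" and w: "admissible w"
    and X: "\<And>\<theta>. \<theta> \<in> \<Theta> \<Longrightarrow> is_state \<omega> \<theta> (\<lambda>t. X t \<theta>)"
    and l: "\<And>\<theta>. \<theta> \<in> \<Theta> \<Longrightarrow> is_adjoint \<omega> \<theta> (\<lambda>t. X t \<theta>) (\<lambda>t. l t \<theta>)"
    and \<eta>: "0 < \<eta>"
  obtains \<delta> where "\<delta> > 0" "\<And>\<epsilon> \<theta> x. \<lbrakk>0 < \<epsilon>; \<epsilon> < \<delta>; \<theta> \<in> \<Theta>; is_state (\<lambda>i s. \<omega> i s + \<epsilon> * w i s) \<theta> x\<rbrakk>
      \<Longrightarrow> \<bar>a (x T) \<theta> - a (X T \<theta>) \<theta> + \<epsilon> * sensitivity w X l \<theta>\<bar> \<le> \<eta> * \<epsilon>"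
proof -
  have Xc: "continuous_on ({0..T} \<times> \<Theta>) (\<lambda>(t, \<theta>). X t \<theta>)" by (rule state_cont[OF \<omega> X])
  have lc: "continuous_on ({0..T} \<times> \<Theta>) (\<lambda>(t, \<theta>). l t \<theta>)" by (rule adjoint_cont[OF \<omega> Xc l])
  define \<kappa>w where "\<kappa>w s = (\<Sum>i\<in>UNIV. \<bar>w i s\<bar>)" for s
  define \<kappa> where "\<kappa> s = (\<Sum>i\<in>UNIV. \<bar>\<omega> i s\<bar>)" for s
  have \<kappa>w: "\<kappa>w integrable_on {0..T}" and \<kappa>: "\<kappa> integrable_on {0..T}"
    unfolding \<kappa>w_def[abs_def] \<kappa>_def[abs_def]
    by (intro absolutely_integrable_on_imp_integrable_on admissible_kernel w \<omega>)+
  define W where "W = integral {0..T} \<kappa>w"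
  define K where "K = integral {0..T} \<kappa>"
  have WK: "W \<ge> 0" "K \<ge> 0" unfolding W_def K_def
    by (intro integral_nonneg \<kappa>w \<kappa>; simp add: \<kappa>w_def \<kappa>_def sum_nonneg)+
  obtain C where C: "C > 0" "\<And>\<epsilon> \<theta> x t. \<lbrakk>0 \<le> \<epsilon>; \<epsilon> \<le> 1; \<theta> \<in> \<Theta>; is_state (\<lambda>i s. \<omega> i s + \<epsilon> * w i s) \<theta> x; t \<in> {0..T}\<rbrakk>
      \<Longrightarrow> norm (x t - X t \<theta>) \<le> C * \<epsilon>"
    using perturbed_bound[OF \<omega> w X] by blast
  obtain R where R: "R > 0" "\<And>p. p \<in> {0..T} \<times> \<Theta> \<Longrightarrow> norm (case p of (t, \<theta>) \<Rightarrow> X t \<theta>) \<le> R"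
    by (rule continuous_on_compact_norm_bound[OF compact_Times[OF compact_Icc \<Theta>] Xc]) (rule that)
  obtain M where M: "M > 0" "\<And>p. p \<in> {0..T} \<times> \<Theta> \<Longrightarrow> norm (case p of (t, \<theta>) \<Rightarrow> l t \<theta>) \<le> M"
    by (rule continuous_on_compact_norm_bound[OF compact_Times[OF compact_Icc \<Theta>] lc]) (rule that)
  \<comment> \<open>Half of the error budget goes to linearization remainders: \<open>C\<close>
    accounts for the end-point cost, \<open>M * C * K\<close> for the fields along the
    trajectory.\<close>
  define \<eta>1 where "\<eta>1 = \<eta> / (2 * (C + M * C * K))"
  have CMK: "C + M * C * K > 0" using C(1) M(1) WK by (simp add: add_pos_nonneg)
  then have \<eta>1: "\<eta>1 > 0" using \<eta> by (simp add: \<eta>1_def)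
  have "\<exists>\<delta>>0. \<forall>\<theta> x z. \<theta> \<in> \<Theta> \<longrightarrow> x \<in> cball 0 R \<longrightarrow> norm (z - x) < \<delta> \<longrightarrow>
      norm (G i z \<theta> - G i x \<theta> - J i x \<theta> *v (z - x)) \<le> \<eta>1 * norm (z - x)" for i
    by (rule uniform_linearization[where R = R, OF bounded_bilinear_matrix_vector_mult \<Theta> G_deriv[of _ i] J_cont[of i] \<eta>1]) blast+
  then have "\<exists>\<delta>. \<forall>i. \<delta> i > 0 \<and> (\<forall>\<theta> x z. \<theta> \<in> \<Theta> \<longrightarrow> x \<in> cball 0 R \<longrightarrow> norm (z - x) < \<delta> i \<longrightarrow>
      norm (G i z \<theta> - G i x \<theta> - J i x \<theta> *v (z - x)) \<le> \<eta>1 * norm (z - x))"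
    by (intro choice allI)
  then obtain \<delta>G where \<delta>G: "\<And>i. \<delta>G i > 0" "\<And>i \<theta> x z. \<lbrakk>\<theta> \<in> \<Theta>; x \<in> cball 0 R; norm (z - x) < \<delta>G i\<rbrakk> \<Longrightarrow>
      norm (G i z \<theta> - G i x \<theta> - J i x \<theta> *v (z - x)) \<le> \<eta>1 * norm (z - x)" by blast
  obtain \<delta>a where \<delta>a: "\<delta>a > 0" "\<And>\<theta> x z. \<lbrakk>\<theta> \<in> \<Theta>; x \<in> cball 0 R; norm (z - x) < \<delta>a\<rbrakk> \<Longrightarrow>
      norm (a z \<theta> - a x \<theta> - a' x \<theta> \<bullet> (z - x)) \<le> \<eta>1 * norm (z - x)"
    by (rule uniform_linearization[where R = R, OF bounded_bilinear_inner \<Theta> a_deriv a'_cont \<eta>1]) blast+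
  define \<delta>1 where "\<delta>1 = min \<delta>a (Min (range \<delta>G))"
  have \<delta>1: "\<delta>1 > 0" using \<delta>a(1) \<delta>G(1) by (simp add: \<delta>1_def)
  have \<delta>1_le: "\<delta>1 \<le> \<delta>a" "\<delta>1 \<le> \<delta>G i" for i
    by (auto simp: \<delta>1_def intro: min.coboundedI2)
  \<comment> \<open>The three bounds make \<open>perturbed_bound\<close> applicable, keep the
    deviation \<open>C * \<epsilon>\<close> within the range of linearization, and hold the term
    quadratic in \<open>\<epsilon>\<close> below the other half of the budget.\<close>
  define \<delta> where "\<delta> = min 1 (min (\<delta>1 / C) (\<eta> / (2 * (M * C * L * W + 1))))"
  have MCLW: "M * C * L * W \<ge> 0" using M C L WK by simp
  show ?thesis
  proof (rule that[of \<delta>])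
    show "\<delta> > 0" using \<delta>1 C(1) \<eta> MCLW by (simp add: \<delta>_def)
    fix \<epsilon> \<theta> x
    assume \<epsilon>: "0 < \<epsilon>" "\<epsilon> < \<delta>" and \<theta>: "\<theta> \<in> \<Theta>" and x: "is_state (\<lambda>i s. \<omega> i s + \<epsilon> * w i s) \<theta> x"
    have \<epsilon>': "\<epsilon> \<le> 1" "\<epsilon> * C < \<delta>1" "\<epsilon> * (M * C * L * W) \<le> \<eta> / 2"
    proof -
      show "\<epsilon> \<le> 1" using \<epsilon> by (simp add: \<delta>_def)
      show "\<epsilon> * C < \<delta>1" using \<epsilon> C(1) by (simp add: \<delta>_def pos_less_divide_eq)
      have "\<epsilon> * (2 * (M * C * L * W + 1)) < \<eta>"
        using \<epsilon> MCLW by (simp add: \<delta>_def pos_less_divide_eq)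
      then show "\<epsilon> * (M * C * L * W) \<le> \<eta> / 2" using \<epsilon>(1) by (simp add: algebra_simps)
    qed
    define \<Delta> where "\<Delta> t = x t - X t \<theta>" for t
    have \<Delta>C: "norm (\<Delta> t) \<le> C * \<epsilon>" if "t \<in> {0..T}" for t
      unfolding \<Delta>_def using C(2)[OF _ \<epsilon>'(1) \<theta> x that] \<epsilon> by simp
    have \<Delta>1: "norm (\<Delta> t) < \<delta>1" if "t \<in> {0..T}" for t
      using \<Delta>C[OF that] \<epsilon>'(2) by (simp add: mult.commute)
    have XR: "X t \<theta> \<in> cball 0 R" and lM: "norm (l t \<theta>) \<le> M" if "t \<in> {0..T}" for t
      using R(2)[of "(t, \<theta>)"] M(2)[of "(t, \<theta>)"] that \<theta> by auto
    have ac: "absolutely_cont_on 0 T (\<lambda>t. l t \<theta> \<bullet> \<Delta> t)"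
      unfolding \<Delta>_def using x X[OF \<theta>] l[OF \<theta>]
      by (intro absolutely_cont_on_inner absolutely_cont_on_diff)
         (auto simp: is_state_def is_adjoint_def caratheodory_solution_def)
    define A where "A s = (\<Sum>i\<in>UNIV. \<omega> i s *\<^sub>R J i (X s \<theta>) \<theta>)" for s
    define r where "r s = l s \<theta> \<bullet> (vfield (\<lambda>i s. \<omega> i s + \<epsilon> * w i s) \<theta> s (x s) - vfield \<omega> \<theta> s (X s \<theta>))
        + (- (l s \<theta> v* A s)) \<bullet> \<Delta> s" for s
    obtain N1 where N1: "negligible N1" "\<And>t. t \<in> {0..T} - N1 \<Longrightarrow>
        (x has_vector_derivative vfield (\<lambda>i s. \<omega> i s + \<epsilon> * w i s) \<theta> t (x t)) (at t within {0..T})"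
      using x unfolding is_state_def caratheodory_solution_def by (subst (asm) AE_lebesgue_on_iff) auto
    obtain N2 where N2: "negligible N2" "\<And>t. t \<in> {0..T} - N2 \<Longrightarrow>
        ((\<lambda>t. X t \<theta>) has_vector_derivative vfield \<omega> \<theta> t (X t \<theta>)) (at t within {0..T})"
      using X[OF \<theta>] unfolding is_state_def caratheodory_solution_def by (subst (asm) AE_lebesgue_on_iff) auto
    obtain N3 where N3: "negligible N3" "\<And>t. t \<in> {0..T} - N3 \<Longrightarrow>
        ((\<lambda>t. l t \<theta>) has_vector_derivative - (l t \<theta> v* A t)) (at t within {0..T})"
      using l[OF \<theta>] unfolding is_adjoint_def caratheodory_solution_def A_def by (subst (asm) AE_lebesgue_on_iff) auto
    have "(r has_integral l T \<theta> \<bullet> \<Delta> T - l 0 \<theta> \<bullet> \<Delta> 0) {0..T}"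
    proof (rule absolutely_cont_on_has_integral[OF T ac])
      show "negligible (N1 \<union> N2 \<union> N3)" using N1 N2 N3 by simp
      fix t assume t: "t \<in> {0..T} - (N1 \<union> N2 \<union> N3)"
      show "((\<lambda>t. l t \<theta> \<bullet> \<Delta> t) has_vector_derivative r t) (at t within {0..T})"
        unfolding r_def \<Delta>_def using t
        by (intro bounded_bilinear.has_vector_derivative[OF bounded_bilinear_inner]
            has_vector_derivative_diff N1(2) N2(2) N3(2)) auto
    qed
    moreover have "\<Delta> 0 = 0" using x X[OF \<theta>] by (simp add: \<Delta>_def is_state_def)
    ultimately have r: "(r has_integral l T \<theta> \<bullet> \<Delta> T) {0..T}" by simp
    define q where "q s = (\<Sum>i\<in>UNIV. w i s * (l s \<theta> \<bullet> G i (X s \<theta>) \<theta>))" for s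
    have "continuous_on {0..T} (\<lambda>s. l s \<theta> \<bullet> G i (X s \<theta>) \<theta>)" for i
      by (intro continuous_on_inner continuous_on_slice[OF lc \<theta>] continuous_on_slice[OF comp_cont[OF G_cont Xc] \<theta>])
    then have q: "q integrable_on {0..T}"
      unfolding q_def[abs_def] using w
      by (intro absolutely_integrable_on_imp_integrable_on absolutely_integrable_sum absolutely_integrable_mult_continuous)
         (auto simp: admissible_def)
    \<comment> \<open>After the cancellation there remain linearization errors weighted by
      \<open>\<omega>\<close>, and \<open>\<epsilon>\<close> times a field increment that is itself
      of order \<open>\<epsilon>\<close>.\<close>
    have r_eq: "r s - \<epsilon> * q s = (\<Sum>i\<in>UNIV. \<omega> i s * (l s \<theta> \<bullet> (G i (x s) \<theta> - G i (X s \<theta>) \<theta> - J i (X s \<theta>) \<theta> *v \<Delta> s))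
        + \<epsilon> * w i s * (l s \<theta> \<bullet> (G i (x s) \<theta> - G i (X s \<theta>) \<theta>)))" for s
    proof -
      have "(- (l s \<theta> v* A s)) \<bullet> \<Delta> s = - (\<Sum>i\<in>UNIV. \<omega> i s * (l s \<theta> \<bullet> (J i (X s \<theta>) \<theta> *v \<Delta> s)))"
        by (simp add: A_def adjoint_field inner_sum_left dot_lmul_matrix)
      then show ?thesis
        by (simp add: r_def q_def vfield_def inner_diff_right inner_sum_right inner_add_right
            algebra_simps sum.distrib sum_subtractf sum_distrib_left)
    qed
    have "norm (integral {0..T} (\<lambda>s. r s - \<epsilon> * q s)) \<le> integral {0..T} (\<lambda>s. M * C * \<epsilon> * \<eta>1 * \<kappa> s + \<epsilon> * (M * L * (C * \<epsilon>)) * \<kappa>w s)"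
    proof (rule Henstock_Kurzweil_Integration.integral_norm_bound_integral)
      show "(\<lambda>s. r s - \<epsilon> * q s) integrable_on {0..T}"
        using r q by (intro integrable_diff integrable_on_mult_right) auto
      show "(\<lambda>s. M * C * \<epsilon> * \<eta>1 * \<kappa> s + \<epsilon> * (M * L * (C * \<epsilon>)) * \<kappa>w s) integrable_on {0..T}"
        by (intro integrable_add integrable_on_mult_right \<kappa> \<kappa>w)
      fix s assume s: "s \<in> {0..T}"
      have "norm (r s - \<epsilon> * q s) \<le> (\<Sum>i\<in>UNIV. \<bar>\<omega> i s\<bar> * (M * (\<eta>1 * (C * \<epsilon>))) + \<epsilon> * \<bar>w i s\<bar> * (M * (L * (C * \<epsilon>))))"
        unfolding r_eq
      proof (rule sum_norm_le)
        fix i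
        have "norm (G i (x s) \<theta> - G i (X s \<theta>) \<theta> - J i (X s \<theta>) \<theta> *v \<Delta> s) \<le> \<eta>1 * norm (\<Delta> s)"
          using \<delta>G(2)[OF \<theta> XR[OF s], of "x s" i] \<Delta>1[OF s] \<delta>1_le(2)[of i] by (simp add: \<Delta>_def)
        also have "\<dots> \<le> \<eta>1 * (C * \<epsilon>)" using \<Delta>C[OF s] \<eta>1 by simp
        finally have 1: "\<bar>l s \<theta> \<bullet> (G i (x s) \<theta> - G i (X s \<theta>) \<theta> - J i (X s \<theta>) \<theta> *v \<Delta> s)\<bar> \<le> M * (\<eta>1 * (C * \<epsilon>))"
          using lM[OF s] M(1) by (intro order_trans[OF Cauchy_Schwarz_ineq2] mult_mono) auto
        have "norm (G i (x s) \<theta> - G i (X s \<theta>) \<theta>) \<le> L * (C * \<epsilon>)"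
          using \<Delta>C[OF s] L by (intro order_trans[OF G_lipschitz[OF \<theta>]] mult_left_mono) (auto simp: \<Delta>_def)
        then have 2: "\<bar>l s \<theta> \<bullet> (G i (x s) \<theta> - G i (X s \<theta>) \<theta>)\<bar> \<le> M * (L * (C * \<epsilon>))"
          using lM[OF s] M(1) by (intro order_trans[OF Cauchy_Schwarz_ineq2] mult_mono) auto
        show "norm (\<omega> i s * (l s \<theta> \<bullet> (G i (x s) \<theta> - G i (X s \<theta>) \<theta> - J i (X s \<theta>) \<theta> *v \<Delta> s))
            + \<epsilon> * w i s * (l s \<theta> \<bullet> (G i (x s) \<theta> - G i (X s \<theta>) \<theta>)))
          \<le> \<bar>\<omega> i s\<bar> * (M * (\<eta>1 * (C * \<epsilon>))) + \<epsilon> * \<bar>w i s\<bar> * (M * (L * (C * \<epsilon>)))"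
          using \<epsilon>(1) 1 2 by (intro norm_triangle_le add_mono) (auto simp: abs_mult intro!: mult_left_mono)
      qed
      also have "\<dots> = \<kappa> s * (M * (\<eta>1 * (C * \<epsilon>))) + \<epsilon> * \<kappa>w s * (M * (L * (C * \<epsilon>)))"
        unfolding \<kappa>_def \<kappa>w_def by (simp only: sum.distrib[symmetric] sum_distrib_left sum_distrib_right)
      also have "\<dots> = M * C * \<epsilon> * \<eta>1 * \<kappa> s + \<epsilon> * (M * L * (C * \<epsilon>)) * \<kappa>w s" by (simp add: mult_ac)
      finally show "norm (r s - \<epsilon> * q s) \<le> M * C * \<epsilon> * \<eta>1 * \<kappa> s + \<epsilon> * (M * L * (C * \<epsilon>)) * \<kappa>w s" .
    qed
    also have "\<dots> = M * C * \<epsilon> * \<eta>1 * K + \<epsilon> * (M * L * (C * \<epsilon>)) * W"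
      using integrable_on_mult_right[OF \<kappa>] integrable_on_mult_right[OF \<kappa>w]
      by (subst Henstock_Kurzweil_Integration.integral_add) (auto simp: K_def W_def)
    also have "integral {0..T} (\<lambda>s. r s - \<epsilon> * q s) = l T \<theta> \<bullet> \<Delta> T - \<epsilon> * sensitivity w X l \<theta>"
      using r integrable_on_mult_right[OF q, of \<epsilon>]
      by (subst Henstock_Kurzweil_Integration.integral_diff)
         (auto simp: integral_unique sensitivity_def q_def[abs_def])
    finally have 1: "\<bar>l T \<theta> \<bullet> \<Delta> T - \<epsilon> * sensitivity w X l \<theta>\<bar> \<le> \<epsilon> * (\<eta>1 * (M * C * K) + \<epsilon> * (M * C * L * W))"
      by (simp add: algebra_simps)
    have TT: "T \<in> {0..T}" using T by simp
    have "\<bar>a (x T) \<theta> - a (X T \<theta>) \<theta> - a' (X T \<theta>) \<theta> \<bullet> \<Delta> T\<bar> \<le> \<eta>1 * norm (\<Delta> T)"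
      using \<delta>a(2)[OF \<theta> XR[OF TT], of "x T"] \<Delta>1[OF TT] \<delta>1_le(1) by (simp add: \<Delta>_def)
    also have "\<dots> \<le> \<epsilon> * (\<eta>1 * C)" using \<Delta>C[OF TT] \<eta>1 by (simp add: mult_ac)
    finally have 2: "\<bar>a (x T) \<theta> - a (X T \<theta>) \<theta> - a' (X T \<theta>) \<theta> \<bullet> \<Delta> T\<bar> \<le> \<epsilon> * (\<eta>1 * C)" .
    have "l T \<theta> = - a' (X T \<theta>) \<theta>" using l[OF \<theta>] by (simp add: is_adjoint_def)
    then have "\<bar>a (x T) \<theta> - a (X T \<theta>) \<theta> + \<epsilon> * sensitivity w X l \<theta>\<bar>
        \<le> \<epsilon> * (\<eta>1 * C) + \<epsilon> * (\<eta>1 * (M * C * K) + \<epsilon> * (M * C * L * W))"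
      using 1 2 by simp
    also have "\<dots> = \<epsilon> * (\<eta>1 * (C + M * C * K) + \<epsilon> * (M * C * L * W))" by (simp add: algebra_simps)
    also have "\<eta>1 * (C + M * C * K) = \<eta> / 2"
      unfolding \<eta>1_def using CMK by (metis divide_divide_eq_left less_irrefl mult.commute nonzero_eq_divide_eq)
    also have "\<epsilon> * (\<eta> / 2 + \<epsilon> * (M * C * L * W)) \<le> \<epsilon> * (\<eta> / 2 + \<eta> / 2)"
      using \<epsilon>(1) \<epsilon>'(3) by (intro mult_left_mono) auto
    finally show "\<bar>a (x T) \<theta> - a (X T \<theta>) \<theta> + \<epsilon> * sensitivity w X l \<theta>\<bar> \<le> \<eta> * \<epsilon>"
      by (simp add: mult.commute)
  qed
qed

end

section \<open>Minimax selection of a probability measure\<close>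

text \<open>Blackwell's approachability argument: answering the weights \<open>(max 0 (- s i))\<^sub>i\<close> of the current
  partial sums \<open>s\<close> keeps the squared distance of \<open>s\<close> to the nonnegative orthant linear in the number of steps.\<close>
lemma approachability:
  fixes h :: "nat \<Rightarrow> 'b \<Rightarrow> real"
  assumes bd: "\<And>i \<theta>. i < m \<Longrightarrow> \<theta> \<in> S \<Longrightarrow> \<bar>h i \<theta>\<bar> \<le> B"
    and resp: "\<And>\<alpha>. (\<And>i. 0 \<le> \<alpha> i) \<Longrightarrow> \<exists>\<theta>\<in>S. 0 \<le> (\<Sum>i<m. \<alpha> i * h i \<theta>)"
    and e: "0 < e"
  obtains N :: nat and \<sigma> :: "nat \<Rightarrow> 'b" where "N > 0" "\<And>j. \<sigma> j \<in> S"
    "\<And>i. i < m \<Longrightarrow> - e \<le> (\<Sum>j<N. h i (\<sigma> j)) / real N"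
proof -
  have "\<exists>\<theta>. \<theta> \<in> S \<and> 0 \<le> (\<Sum>i<m. max 0 (- s i) * h i \<theta>)" for s :: "nat \<Rightarrow> real"
    using resp[of "\<lambda>i. max 0 (- s i)"] by auto
  then obtain R where R: "\<And>s. R s \<in> S" "\<And>s. 0 \<le> (\<Sum>i<m. max 0 (- s i) * h i (R s))" by metis
  define s where "s = rec_nat (\<lambda>i::nat. 0::real) (\<lambda>_ s i. s i + h i (R s))"
  have s: "s 0 = (\<lambda>i. 0)" "s (Suc n) = (\<lambda>i. s n i + h i (R (s n)))" for n
    by (simp_all add: s_def)
  define \<sigma> where "\<sigma> j = R (s j)" for j
  have s_sum: "s n i = (\<Sum>j<n. h i (\<sigma> j))" for n i
    by (induction n) (simp_all add: s \<sigma>_def)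
  define D where "D n = (\<Sum>i<m. (max 0 (- s n i))\<^sup>2)" for n
  \<comment> \<open>After summation over \<open>i\<close> the cross term has a favourable sign by
    the choice of \<open>R\<close>, so one round raises the squared distance by at most
    \<open>real m * B\<^sup>2\<close>.\<close>
  have step: "(max 0 (- (x + y)))\<^sup>2 \<le> (max 0 (- x))\<^sup>2 - 2 * (max 0 (- x) * y) + y\<^sup>2" for x y :: real
  proof -
    have "max 0 (- (x + y)) \<le> \<bar>max 0 (- x) - y\<bar>" by (auto simp: max_def abs_if)
    then have "(max 0 (- (x + y)))\<^sup>2 \<le> \<bar>max 0 (- x) - y\<bar>\<^sup>2" by (intro power_mono) auto
    then show ?thesis by (simp add: power2_eq_square algebra_simps)
  qed
  have D: "D n \<le> real n * (real m * B\<^sup>2)" for n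
  proof (induction n)
    case 0
    show ?case by (simp add: D_def s)
  next
    case (Suc n)
    have "D (Suc n) \<le> (\<Sum>i<m. (max 0 (- s n i))\<^sup>2 - 2 * (max 0 (- s n i) * h i (R (s n))) + (h i (R (s n)))\<^sup>2)"
      unfolding D_def s(2) by (intro sum_mono step)
    also have "\<dots> = D n - 2 * (\<Sum>i<m. max 0 (- s n i) * h i (R (s n))) + (\<Sum>i<m. (h i (R (s n)))\<^sup>2)"
      by (simp add: D_def sum.distrib sum_subtractf sum_distrib_left)
    also have "\<dots> \<le> D n + (\<Sum>i<m. (h i (R (s n)))\<^sup>2)" using R(2)[of "s n"] by simp
    also have "(\<Sum>i<m. (h i (R (s n)))\<^sup>2) \<le> (\<Sum>i<m. B\<^sup>2)"
      using bd R(1) by (intro sum_mono) (metis abs_le_square_iff abs_ge_self lessThan_iff order_trans)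
    finally show ?case using Suc.IH by (simp add: algebra_simps)
  qed
  \<comment> \<open>A coordinate whose average lies below \<open>- e\<close> forces a squared
    distance of at least \<open>(e * real N)\<^sup>2\<close>, while the bound \<open>D\<close> grows
    only linearly in \<open>N\<close>.\<close>
  obtain N :: nat where N: "real m * B\<^sup>2 / e\<^sup>2 < real N" using reals_Archimedean2 by blast
  moreover have "0 \<le> real m * B\<^sup>2 / e\<^sup>2" by simp
  ultimately have "N > 0" by (metis le_less_trans of_nat_0_less_iff)
  show ?thesis
  proof (rule that[of N \<sigma>])
    fix i assume i: "i < m"
    show "- e \<le> (\<Sum>j<N. h i (\<sigma> j)) / real N"
    proof (rule ccontr)
      assume "\<not> ?thesis"
      then have "s N i < - (e * real N)" using \<open>N > 0\<close> by (simp add: s_sum field_simps)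
      then have "e * real N \<le> max 0 (- s N i)" by simp
      then have "(e * real N)\<^sup>2 \<le> (max 0 (- s N i))\<^sup>2" using e by (intro power_mono) auto
      also have "\<dots> \<le> D N" unfolding D_def using i by (intro member_le_sum) auto
      also have "\<dots> \<le> real N * (real m * B\<^sup>2)" by (rule D)
      finally have "real N * (e\<^sup>2 * real N) \<le> real N * (real m * B\<^sup>2)"
        by (simp add: power2_eq_square mult_ac)
      then have "e\<^sup>2 * real N \<le> real m * B\<^sup>2" using \<open>N > 0\<close> by simp
      then show False using N e by (simp add: field_simps)
    qed
  qed (use \<open>N > 0\<close> R(1) in \<open>auto simp: \<sigma>_def\<close>)
qed

text \<open>Greedy digits from the doubling map: \<open>r n\<close> is \<open>2 ^ n\<close> times
  the part of \<open>x\<close> not yet expanded. Remainders live in the closed unit interval;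
  \<open>x = 1\<close> keeps remainder 1 and receives only digits 1.\<close>

lemma binary_expansion:
  fixes x :: real
  assumes "x \<in> {0..1}"
  obtains b :: "nat \<Rightarrow> real" where "\<And>k. b k \<in> {0, 1}" "(\<lambda>k. b k * (1/2) ^ Suc k) sums x"
proof -
  define r where "r = rec_nat x (\<lambda>_ r. if r \<ge> 1/2 then 2 * r - 1 else 2 * r)"
  have r: "r 0 = x" "r (Suc n) = (if r n \<ge> 1/2 then 2 * r n - 1 else 2 * r n)" for n
    by (simp_all add: r_def)
  have r01: "r n \<in> {0..1}" for n
    by (induction n) (use assms in \<open>auto simp: r\<close>)
  define b where "b k = (if r k \<ge> 1/2 then 1 else 0 :: real)" for k
  have part: "(\<Sum>k<n. b k * (1/2) ^ Suc k) = x - r n * (1/2) ^ n" for n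
    by (induction n) (auto simp: r b_def field_simps)
  have "(\<lambda>n. r n * (1/2) ^ n) \<longlonglongrightarrow> 0"
  proof (rule tendsto_sandwich[OF always_eventually always_eventually tendsto_const])
    show "\<forall>n. 0 \<le> r n * (1/2) ^ n" using r01 by simp
    show "\<forall>n. r n * (1/2) ^ n \<le> (1/2) ^ n" using r01 by (auto intro!: mult_left_le_one_le)
  qed (rule LIMSEQ_power_zero, simp)
  from tendsto_diff[OF tendsto_const this, of x] have "(\<lambda>k. b k * (1/2) ^ Suc k) sums x"
    unfolding sums_def part by simp
  then show ?thesis by (rule that[rotated]) (simp add: b_def)
qed

text \<open>Schoenberg's curve. The profile \<open>p\<close> has period 2 and equals 0 on \<open>[0, 1/3]\<close> and 1 on \<open>[2/3, 1]\<close>,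
  so \<open>p (3 ^ n * t)\<close> reads off the digit \<open>B n\<close> of \<open>t = (\<Sum>n. 2 * B n / 3 ^ Suc n)\<close>.\<close>
lemma exists_space_filling_curve:
  obtains f :: "real \<Rightarrow> real^'n::finite" where "continuous_on UNIV f"
    "\<And>t i. f t $ i \<in> {0..1}" "\<And>x. (\<And>i. x $ i \<in> {0..1}) \<Longrightarrow> \<exists>t\<in>{0..1}. f t = x"
proof -
  \<comment> \<open>Clipping works because the cosine is at least 1/2 up to \<open>pi / 3\<close>
    and at most -1/2 from \<open>2 * pi / 3\<close> to \<open>pi\<close>; continuity and periodicity
    are inherited.\<close>
  define p where "p x = max 0 (min 1 (1/2 - cos (pi * x)))" for x :: real
  have p_cont: "continuous_on UNIV p" unfolding p_def by (intro continuous_intros)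
  have p01: "p x \<in> {0..1}" for x by (auto simp: p_def)
  have p_per: "p (2 * of_int z + y) = p y" for z y
  proof -
    have "cos (pi * (2 * of_int z + y)) = cos (pi * y + of_int z * (2 * pi))" by (simp add: algebra_simps)
    also have "\<dots> = cos (pi * y)"
      using cos.plus_of_int[of "pi * y" z] by (simp add: mult.commute)
    finally show ?thesis by (simp add: p_def)
  qed
  have p0: "p y = 0" if "0 \<le> y" "y \<le> 1/3" for y
  proof -
    have "cos (pi / 3) \<le> cos (pi * y)" using that by (intro cos_monotone_0_pi_le) auto
    then show ?thesis by (simp add: p_def cos_60)
  qed
  have p1: "p y = 1" if "2/3 \<le> y" "y \<le> 1" for y
  proof -
    have "cos (pi * y) \<le> cos (2 / 3 * pi)" using that by (intro cos_monotone_0_pi_le) auto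
    also have "\<dots> = - (1/2)" using cos_120 by (simp add: mult.commute)
    finally show ?thesis by (simp add: p_def)
  qed
  define c where "c = CARD('n)"
  have c: "c > 0" by (simp add: c_def)
  obtain idx :: "'n \<Rightarrow> nat" where idx: "bij_betw idx UNIV {0..<c}"
    using ex_bij_betw_finite_nat[of "UNIV :: 'n set"] unfolding c_def by auto
  then have idx_lt: "idx i < c" for i by (auto simp: bij_betw_def)
  \<comment> \<open>Coordinate \<open>i\<close> owns the positions congruent to \<open>idx i\<close>
    modulo \<open>c\<close> and sums the digits found there in base 2.\<close>
  define fi where "fi i t = (\<Sum>k. (1/2) ^ Suc k * p (3 ^ (c * k + idx i) * t))" for i :: 'n and t :: real
  have summ: "summable (\<lambda>k. (1/2::real) ^ Suc k)"
    using power_half_series sums_summable by blast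
  have ul: "uniform_limit UNIV (\<lambda>n t. \<Sum>k<n. (1/2) ^ Suc k * p (3 ^ (c * k + idx i) * t)) (fi i) sequentially" for i
    unfolding fi_def
  proof (rule Weierstrass_m_test[OF _ summ])
    show "norm ((1/2) ^ Suc n * p (3 ^ (c * n + idx i) * t)) \<le> (1/2) ^ Suc n" for n t
      using p01[of "3 ^ (c * n + idx i) * t"] by (simp add: abs_mult mult_left_le)
  qed
  have fi_cont: "continuous_on UNIV (fi i)" for i
  proof (rule uniform_limit_theorem[OF _ ul])
    show "\<forall>\<^sub>F n in sequentially. continuous_on UNIV (\<lambda>t. \<Sum>k<n. (1/2) ^ Suc k * p (3 ^ (c * k + idx i) * t))"
      by (intro always_eventually allI continuous_intros continuous_on_compose2[OF p_cont]) auto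
  qed auto
  have fi_summ: "summable (\<lambda>k. (1/2) ^ Suc k * p (3 ^ (c * k + idx i) * t))" for i t
    by (rule summable_comparison_test'[OF summ, of 0])
      (use p01 in \<open>auto simp: abs_mult intro!: mult_left_le\<close>)
  have fi01: "fi i t \<in> {0..1}" for i t
  proof -
    have "fi i t \<le> (\<Sum>k. (1/2::real) ^ Suc k)"
      unfolding fi_def using p01 by (intro suminf_le fi_summ summ mult_left_le) auto
    also have "\<dots> = 1" using power_half_series by (rule sums_unique[symmetric])
    finally have "fi i t \<le> 1" .
    moreover have "0 \<le> fi i t"
      unfolding fi_def using p01 by (intro suminf_nonneg fi_summ mult_nonneg_nonneg) auto
    ultimately show ?thesis by simp
  qed
  show ?thesis
  proof (rule that[of "\<lambda>t. \<chi> i. fi i t"])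
    show "continuous_on UNIV (\<lambda>t. \<chi> i. fi i t)" by (intro continuous_on_vec_lambda fi_cont)
    show "(\<chi> i. fi i t) $ i \<in> {0..1}" for t i using fi01 by simp
    fix x :: "real^'n" assume x: "\<And>i. x $ i \<in> {0..1}"
    have "\<exists>b :: nat \<Rightarrow> real. (\<forall>k. b k \<in> {0, 1}) \<and> (\<lambda>k. b k * (1/2) ^ Suc k) sums x $ i" for i
      using binary_expansion[OF x[of i]] by metis
    then obtain b :: "'n \<Rightarrow> nat \<Rightarrow> real" where b: "\<And>i k. b i k \<in> {0, 1}" "\<And>i. (\<lambda>k. b i k * (1/2) ^ Suc k) sums x $ i"
      by metis
    \<comment> \<open>The binary digits of all coordinates of the target, interleaved into one
      sequence.\<close>
    define B where "B n = b (inv_into UNIV idx (n mod c)) (n div c)" for n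
    have B01: "B n \<in> {0, 1}" for n using b by (auto simp: B_def)
    have B_idx: "B (c * k + idx i) = b i k" for i k
      using idx idx_lt[of i] by (simp add: B_def bij_betw_def inv_into_f_f)
    \<comment> \<open>\<open>y 0\<close> is the preimage, with ternary digits 0 and 2 only;
      \<open>y n\<close> is what its expansion leaves after a shift by \<open>n\<close>
      places.\<close>
    define y where "y n = (\<Sum>m. 2 * B (n + m) * (1/3) ^ Suc m)" for n
    have geo: "(\<lambda>m. 2 * (1/3::real) ^ Suc m) sums 1"
      using sums_mult[OF geometric_sums[of "1/3::real"], of "2/3"] by simp
    have y_summ: "summable (\<lambda>m. 2 * B (n + m) * (1/3) ^ Suc m)" for n
    proof (rule summable_comparison_test'[OF sums_summable[OF geo], of 0])
      show "norm (2 * B (n + m) * (1/3) ^ Suc m) \<le> 2 * (1/3) ^ Suc m" for m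
        using B01[of "n + m"] by auto
    qed
    have y01: "y n \<in> {0..1}" for n
    proof -
      have "y n \<le> (\<Sum>m. 2 * (1/3::real) ^ Suc m)"
        unfolding y_def
      proof (intro suminf_le y_summ sums_summable[OF geo])
        show "2 * B (n + m) * (1/3) ^ Suc m \<le> 2 * (1/3) ^ Suc m" for m
          using B01[of "n + m"] by auto
      qed
      also have "\<dots> = 1" using geo by (rule sums_unique[symmetric])
      moreover have "0 \<le> 2 * B (n + m) * (1/3) ^ Suc m" for m using B01[of "n + m"] by auto
      then have "0 \<le> y n" unfolding y_def by (intro suminf_nonneg y_summ)
      ultimately show ?thesis by simp
    qed
    have y_rec: "y n = (2 * B n + y (Suc n)) / 3" for n
    proof -
      have "(\<Sum>m. 2 * B (n + Suc m) * (1/3) ^ Suc (Suc m)) = y n - 2 * B n / 3"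
        unfolding y_def by (subst suminf_split_head[OF y_summ]) simp
      moreover have "(\<Sum>m. 2 * B (n + Suc m) * (1/3) ^ Suc (Suc m)) = 1/3 * y (Suc n)"
        unfolding y_def by (subst suminf_mult[OF y_summ, symmetric]) (simp add: mult_ac)
      ultimately show ?thesis by (simp add: field_simps)
    qed
    \<comment> \<open>All ternary digits are even, so the part of \<open>3 ^ n * y 0\<close> split
      off is an even integer and disappears by periodicity.\<close>
    have digits: "\<exists>z::int. 3 ^ n * y 0 = 2 * of_int z + y n" for n
    proof (induction n)
      case 0
      show ?case by (intro exI[of _ 0]) simp
    next
      case (Suc n)
      then obtain z :: int where "3 ^ n * y 0 = 2 * of_int z + y n" by blast
      moreover have "B n = of_int (if B n = 0 then 0 else 1)" using B01[of n] by auto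
      ultimately have "3 ^ Suc n * y 0 = 2 * of_int (3 * z + (if B n = 0 then 0 else 1)) + y (Suc n)"
        using y_rec[of n] by (simp add: field_simps)
      then show ?case by blast
    qed
    have pB: "p (3 ^ n * y 0) = B n" for n
    proof -
      obtain z :: int where z: "3 ^ n * y 0 = 2 * of_int z + y n" using digits by blast
      \<comment> \<open>A leading digit 0 puts \<open>y n\<close> into \<open>[0, 1/3]\<close>, a
        leading digit 2 into \<open>[2/3, 1]\<close>: exactly the plateaus.\<close>
      have "p (y n) = B n"
        using B01[of n] y01[of "Suc n"] y_rec[of n] p0[of "y n"] p1[of "y n"] by auto
      then show ?thesis unfolding z p_per .
    qed
    have "fi i (y 0) = x $ i" for i
      unfolding fi_def pB B_idx using sums_unique[OF b(2)[of i]] by (simp add: mult.commute)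
    then show "\<exists>t\<in>{0..1}. (\<chi> i. fi i t) = x"
      using y01[of 0] by (intro bexI[of _ "y 0"]) (simp_all add: vec_eq_iff)
  qed
qed

text \<open>A space-filling curve reduces weak compactness of measures on a compact subset of \<open>\<real>\<^sup>n\<close> to
  Helly's selection theorem on the line.\<close>
lemma empirical_measures_subsequence:
  fixes S :: "(real^'n::finite) set" and \<sigma> :: "nat \<Rightarrow> nat \<Rightarrow> real^'n"
  assumes S: "compact S" and N: "\<And>n. 0 < N n" and \<sigma>: "\<And>n j. \<sigma> n j \<in> S"
  obtains \<mu> r where "prob_space \<mu>" "sets \<mu> = sets borel" "AE x in \<mu>. x \<in> S" "strict_mono (r :: nat \<Rightarrow> nat)"
    "\<And>\<phi> :: real^'n \<Rightarrow> real. continuous_on UNIV \<phi> \<Longrightarrow> integrable \<mu> \<phi> \<and>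
        (\<lambda>n. (\<Sum>j<N (r n). \<phi> (\<sigma> (r n) j)) / real (N (r n))) \<longlonglongrightarrow> (LINT x|\<mu>. \<phi> x)"
proof -
  obtain f :: "real \<Rightarrow> real^'n" where f: "continuous_on UNIV f"
    "\<And>t i. f t $ i \<in> {0..1}" "\<And>x. (\<And>i. x $ i \<in> {0..1}) \<Longrightarrow> \<exists>t\<in>{0..1}. f t = x"
    using exists_space_filling_curve by metis
  obtain M where M: "M > 0" "\<And>x. x \<in> S \<Longrightarrow> norm x \<le> M"
    using compact_imp_bounded[OF S] unfolding bounded_pos by auto
  \<comment> \<open>Rescales the unit cube to a cube that contains \<open>S\<close>.\<close>
  define g where "g t = (\<chi> i. 2 * M * f t $ i - M)" for t
  have g_cont: "continuous_on UNIV g"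
    unfolding g_def[abs_def] using f(1) by (intro continuous_on_vec_lambda continuous_intros) auto
  have g_onto: "\<exists>t\<in>{0..1}. g t = x" if "x \<in> S" for x
  proof -
    have "\<bar>x $ i\<bar> \<le> M" for i
      using M(2)[OF that] component_le_norm_cart[of x i] by simp
    then have "(\<chi> i. (x $ i + M) / (2 * M)) $ i \<in> {0..1}" for i
      using M(1) abs_le_iff[of "x $ i" M] by (auto simp: field_simps)
    from f(3)[of "\<chi> i. (x $ i + M) / (2 * M)", OF this] obtain t where
      t: "t \<in> {0..1}" "f t = (\<chi> i. (x $ i + M) / (2 * M))" by blast
    have "g t = x" unfolding g_def t(2) using M(1) by (simp add: vec_eq_iff field_simps)
    with t(1) show ?thesis by blast
  qed
  have g_range: "g t \<in> cbox (\<chi> i. - M) (\<chi> i. M)" for t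
  proof -
    have "0 \<le> M * f t $ i" "M * f t $ i \<le> M" for i
      using f(2)[of t i] M(1) by (auto simp: mult_left_le)
    then show ?thesis by (auto simp: g_def mem_box_cart algebra_simps)
  qed
  have bounded_comp: "\<exists>B. \<forall>t. norm (\<phi> (g t)) \<le> B" if "continuous_on UNIV \<phi>" for \<phi> :: "real^'n \<Rightarrow> real"
  proof -
    have "bounded (\<phi> ` cbox (\<chi> i. - M) (\<chi> i. M))"
      by (intro compact_imp_bounded compact_continuous_image continuous_on_subset[OF that]) auto
    then show ?thesis using g_range unfolding bounded_iff by blast
  qed
  have "\<exists>t. \<forall>n j. t n j \<in> {0..1} \<and> g (t n j) = \<sigma> n j"
    using g_onto[OF \<sigma>] by (intro choice allI) blast
  then obtain t where t: "\<And>n j. t n j \<in> {0..1}" "\<And>n j. g (t n j) = \<sigma> n j" by blast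
  \<comment> \<open>The law of \<open>t n j\<close> for a uniformly random index
    \<open>j < N n\<close>: integrals against it are the averages in question.\<close>
  define \<nu> where "\<nu> n = distr (measure_pmf (pmf_of_set {..<N n})) borel (t n)" for n
  have \<nu>: "real_distribution (\<nu> n)" for n
    unfolding \<nu>_def by (intro prob_space.real_distribution_distr prob_space_measure_pmf) simp
  have ne: "{..<N n} \<noteq> {}" for n using N[of n] by auto
  have \<nu>_int: "(LINT s|\<nu> n. \<psi> s) = (\<Sum>j<N n. \<psi> (t n j)) / real (N n)" if "\<psi> \<in> borel_measurable borel" for \<psi> :: "real \<Rightarrow> real" and n
    unfolding \<nu>_def using that by (simp add: integral_distr integral_pmf_of_set[OF ne])
  have "tight \<nu>"
    unfolding tight_def
  proof (intro conjI allI impI \<nu>)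
    fix \<epsilon> :: real assume "\<epsilon> > 0"
    have "measure (\<nu> n) {-1<..1} = 1" for n
    proof -
      have "t n -` {-1<..1} = UNIV" using t(1)[of n] by (force simp: subset_eq)
      then show ?thesis unfolding \<nu>_def by (subst measure_distr) auto
    qed
    then show "\<exists>a b. a < b \<and> (\<forall>n. 1 - \<epsilon> < measure (\<nu> n) {a<..b})"
      using \<open>\<epsilon> > 0\<close> by (intro exI[of _ "-1"] exI[of _ 1]) auto
  qed
  then obtain r \<nu>' where r: "strict_mono (r :: nat \<Rightarrow> nat)" "real_distribution \<nu>'" "weak_conv_m (\<nu> \<circ> id \<circ> r) \<nu>'"
    using tight_imp_convergent_subsubsequence[of \<nu> id] by (auto simp: strict_mono_id)
  interpret \<nu>': real_distribution \<nu>' by (rule r(2))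
  have conv: "integrable \<nu>' (\<lambda>s. \<phi> (g s)) \<and>
      (\<lambda>n. (\<Sum>j<N (r n). \<phi> (\<sigma> (r n) j)) / real (N (r n))) \<longlonglongrightarrow> (LINT s|\<nu>'. \<phi> (g s))"
    if \<phi>: "continuous_on UNIV \<phi>" for \<phi> :: "real^'n \<Rightarrow> real"
  proof
    obtain B where B: "\<And>s. norm (\<phi> (g s)) \<le> B" using bounded_comp[OF \<phi>] by blast
    have c: "continuous_on UNIV (\<lambda>s. \<phi> (g s))"
      by (rule continuous_on_compose2[OF \<phi> g_cont]) auto
    then have m: "(\<lambda>s. \<phi> (g s)) \<in> borel_measurable borel" by (rule borel_measurable_continuous_onI)
    then show "integrable \<nu>' (\<lambda>s. \<phi> (g s))"
      using B by (intro \<nu>'.integrable_const_bound[where B = B]) auto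
    have "(\<lambda>n. LINT s|(\<nu> \<circ> id \<circ> r) n. \<phi> (g s)) \<longlonglongrightarrow> (LINT s|\<nu>'. \<phi> (g s))"
      using \<nu> r c B
      by (intro weak_conv_imp_integral_bdd_continuous_conv[where B = B]) (auto simp: continuous_on_eq_continuous_at o_def)
    then show "(\<lambda>n. (\<Sum>j<N (r n). \<phi> (\<sigma> (r n) j)) / real (N (r n))) \<longlonglongrightarrow> (LINT s|\<nu>'. \<phi> (g s))"
      by (simp add: \<nu>_int[OF m] t(2))
  qed
  have gm: "g \<in> borel_measurable \<nu>'"
    using borel_measurable_continuous_onI[OF g_cont] by simp
  define \<mu> where "\<mu> = distr \<nu>' borel g"
  have AE_S: "AE s in \<nu>'. g s \<in> S"
  proof -
    \<comment> \<open>A continuous test function that vanishes at every sample point. Its integral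
      in the limit is 0, which confines the limit measure to the closed set
      \<open>S\<close>.\<close>
    let ?\<phi> = "\<lambda>x. infdist x S"
    have \<phi>: "continuous_on UNIV ?\<phi>" by (intro continuous_intros)
    have "(\<lambda>n. 0) \<longlonglongrightarrow> (LINT s|\<nu>'. ?\<phi> (g s))"
      using conv[OF \<phi>] \<sigma> by simp
    then have "(LINT s|\<nu>'. ?\<phi> (g s)) = 0" using LIMSEQ_unique tendsto_const by blast
    then have "AE s in \<nu>'. ?\<phi> (g s) = 0"
      using conv[OF \<phi>] by (subst (asm) integral_nonneg_eq_0_iff_AE) (auto simp: infdist_nonneg)
    moreover have "S \<noteq> {}" using \<sigma> by auto
    ultimately show ?thesis
      using in_closed_iff_infdist_zero[OF compact_imp_closed[OF S]] by auto
  qed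
  show ?thesis
  proof (rule that[of \<mu> r])
    show "prob_space \<mu>" unfolding \<mu>_def by (intro \<nu>'.prob_space_distr gm)
    show "sets \<mu> = sets borel" by (simp add: \<mu>_def)
    show "AE x in \<mu>. x \<in> S"
      unfolding \<mu>_def using AE_S gm S by (subst AE_distr_iff) (auto simp: borel_compact)
    show "strict_mono r" by (rule r)
    fix \<phi> :: "real^'n \<Rightarrow> real" assume \<phi>: "continuous_on UNIV \<phi>"
    show "integrable \<mu> \<phi> \<and>
        (\<lambda>n. (\<Sum>j<N (r n). \<phi> (\<sigma> (r n) j)) / real (N (r n))) \<longlonglongrightarrow> (LINT x|\<mu>. \<phi> x)"
      using conv[OF \<phi>] gm borel_measurable_continuous_onI[OF \<phi>]
      unfolding \<mu>_def by (simp add: integral_distr integrable_distr_eq)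
  qed
qed

text \<open>For the first \<open>m\<close> functions, \<open>approachability\<close> turns the
  response condition into an empirical measure whose averages are at least
  \<open>- 1 / (m + 1)\<close>. A weak limit as \<open>m\<close> grows satisfies all countably many
  inequalities at once. The indicator confines the integrand to \<open>S\<close>, the only place
  where \<open>h i\<close> is known to be continuous.\<close>

theorem minimax_measure:
  fixes S :: "(real^'n::finite) set" and h :: "nat \<Rightarrow> real^'n \<Rightarrow> real"
  assumes S: "compact S" and h: "\<And>i. continuous_on S (h i)"
    and resp: "\<And>m \<alpha>. (\<And>i. 0 \<le> \<alpha> i) \<Longrightarrow> \<exists>\<theta>\<in>S. 0 \<le> (\<Sum>i<m. \<alpha> i * h i \<theta>)"
  obtains \<mu> where "prob_space \<mu>" "sets \<mu> = sets borel" "AE x in \<mu>. x \<in> S"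
    "\<And>i. 0 \<le> (LINT x|\<mu>. indicator S x * h i x)"
proof -
  have "\<exists>B>0. \<forall>\<theta>\<in>S. norm (h i \<theta>) \<le> B" for i
    by (rule continuous_on_compact_norm_bound[OF S h[of i]]) blast
  then obtain B where B: "\<And>i. B i > 0" "\<And>i \<theta>. \<theta> \<in> S \<Longrightarrow> norm (h i \<theta>) \<le> B i" by metis
  \<comment> \<open>Weak convergence is tested with functions continuous on the whole space, hence
    the Tietze extensions.\<close>
  have "\<exists>H. continuous_on UNIV H \<and> (\<forall>x\<in>S. H x = h i x)" for i
    by (rule Tietze[OF h[of i], of UNIV "B i"])
       (use B S in \<open>auto simp: less_imp_le compact_imp_closed\<close>)
  then obtain H where H: "\<And>i. continuous_on UNIV (H i)" "\<And>i x. x \<in> S \<Longrightarrow> H i x = h i x" by metis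
  have "\<exists>N \<sigma>. 0 < N \<and> (\<forall>j. \<sigma> j \<in> S) \<and> (\<forall>i<m. - (1 / real (Suc m)) \<le> (\<Sum>j<N. h i (\<sigma> j)) / real N)" for m
  proof -
    have "\<bar>h i \<theta>\<bar> \<le> (\<Sum>i<m. B i)" if "i < m" "\<theta> \<in> S" for i \<theta>
    proof -
      have "B i \<le> (\<Sum>i<m. B i)" using that B(1) by (intro member_le_sum) (auto intro: less_imp_le)
      then show ?thesis using B(2)[OF that(2), of i] by simp
    qed
    then show ?thesis
      by (rule approachability[of m S h "\<Sum>i<m. B i" "1 / real (Suc m)"]) (use resp in auto)
  qed
  then obtain N \<sigma> where N: "\<And>m. 0 < N m" "\<And>m j. \<sigma> m j \<in> S"
    "\<And>m i. i < m \<Longrightarrow> - (1 / real (Suc m)) \<le> (\<Sum>j<N m. h i (\<sigma> m j)) / real (N m)"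
    by metis
  obtain \<mu> r where \<mu>: "prob_space \<mu>" "sets \<mu> = sets borel" "AE x in \<mu>. x \<in> S" "strict_mono (r :: nat \<Rightarrow> nat)"
    "\<And>\<phi> :: real^'n \<Rightarrow> real. continuous_on UNIV \<phi> \<Longrightarrow> integrable \<mu> \<phi> \<and>
        (\<lambda>n. (\<Sum>j<N (r n). \<phi> (\<sigma> (r n) j)) / real (N (r n))) \<longlonglongrightarrow> (LINT x|\<mu>. \<phi> x)"
    by (rule empirical_measures_subsequence[of S N \<sigma>, OF S N(1) N(2)]) (rule that)
  show ?thesis
  proof (rule that[OF \<mu>(1-3)])
    fix i
    have "(\<lambda>n. (\<Sum>j<N (r n). H i (\<sigma> (r n) j)) / real (N (r n))) \<longlonglongrightarrow> (LINT x|\<mu>. H i x)"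
      using \<mu>(5)[OF H(1)] by blast
    then have lim: "(\<lambda>n. (\<Sum>j<N (r n). h i (\<sigma> (r n) j)) / real (N (r n))) \<longlonglongrightarrow> (LINT x|\<mu>. H i x)"
      using H(2) N(2) by simp
    have "(\<lambda>n. - (1 / real (Suc (r n)))) \<longlonglongrightarrow> - 0"
      using LIMSEQ_subseq_LIMSEQ[OF LIMSEQ_inverse_real_of_nat \<mu>(4)]
      by (intro tendsto_minus) (simp add: o_def inverse_eq_divide)
    moreover have "\<forall>\<^sub>F n in sequentially. - (1 / real (Suc (r n))) \<le> (\<Sum>j<N (r n). h i (\<sigma> (r n) j)) / real (N (r n))"
      using eventually_gt_at_top[of i]
    proof eventually_elim
      case (elim n)
      then show ?case using N(3)[of i "r n"] seq_suble[OF \<mu>(4), of n] by simp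
    qed
    ultimately have "- 0 \<le> (LINT x|\<mu>. H i x)"
      by (intro tendsto_le[OF sequentially_bot lim])
    also have "(LINT x|\<mu>. H i x) = (LINT x|\<mu>. indicator S x * h i x)"
    proof (rule integral_cong_AE)
      show Hm: "H i \<in> borel_measurable \<mu>"
        using borel_measurable_continuous_onI[OF H(1)] \<mu>(2) by (simp cong: measurable_cong_sets)
      have "S \<in> sets \<mu>" using S \<mu>(2) by (simp add: borel_compact)
      then have "(\<lambda>x. indicator S x * H i x) \<in> borel_measurable \<mu>" using Hm by measurable
      moreover have "(\<lambda>x. indicator S x * H i x) = (\<lambda>x. indicator S x * h i x)"
        using H(2) by (auto simp: fun_eq_iff indicator_def)
      ultimately show "(\<lambda>x. indicator S x * h i x) \<in> borel_measurable \<mu>" by simp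
      show "AE x in \<mu>. H i x = indicator S x * h i x"
        using \<mu>(3) by eventually_elim (simp add: H(2))
    qed
    finally show "0 \<le> (LINT x|\<mu>. indicator S x * h i x)" by simp
  qed
qed

section \<open>The ensemble problem\<close>

text \<open>\<open>gradient\<close> is a definite description, so both existence and uniqueness are
  due. The representing vector is read off from the values of the derivative on the basis.\<close>

lemma has_derivative_gradient:
  fixes g :: "'a::euclidean_space \<Rightarrow> real"
  assumes "g differentiable (at x)"
  shows "(g has_derivative (\<lambda>h. gradient g x \<bullet> h)) (at x)"
proof -
  obtain g' where g': "(g has_derivative g') (at x)" using assms by (auto simp: differentiable_def)
  then interpret g': linear g' by (rule has_derivative_linear)
  have g'_eq: "g' h = h \<bullet> (\<Sum>b\<in>Basis. g' b *\<^sub>R b)" for h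
  proof -
    have "g' h = g' (\<Sum>b\<in>Basis. (h \<bullet> b) *\<^sub>R b)" by (simp only: euclidean_representation)
    also have "\<dots> = (\<Sum>b\<in>Basis. (h \<bullet> b) *\<^sub>R g' b)" by (simp only: g'.sum g'.scale)
    also have "\<dots> = h \<bullet> (\<Sum>b\<in>Basis. g' b *\<^sub>R b)" by (simp add: inner_sum_right mult.commute)
    finally show ?thesis .
  qed
  then have "g' = (\<lambda>h. h \<bullet> (\<Sum>b\<in>Basis. g' b *\<^sub>R b))" by (rule ext)
  then have "GDERIV g x :> (\<Sum>b\<in>Basis. g' b *\<^sub>R b)"
    using g' unfolding gderiv_def by simp
  moreover have "D = D'" if "GDERIV g x :> D" "GDERIV g x :> D'" for D D'
    using has_derivative_unique[OF that[unfolded gderiv_def]] by (metis vector_eq_ldot)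
  ultimately have "GDERIV g x :> gradient g x"
    unfolding gradient_def by (metis theI)
  then show ?thesis by (simp add: gderiv_def inner_commute)
qed

text \<open>Rests on the completeness of Lebesgue measure; nothing is known about \<open>g\<close>
  on the exceptional set.\<close>

lemma borel_measurable_lebesgue_on_AE:
  fixes f g :: "'a::euclidean_space \<Rightarrow> 'b::euclidean_space"
  assumes f: "f \<in> borel_measurable (lebesgue_on S)" and S: "S \<in> sets lebesgue"
    and eq: "AE x in lebesgue_on S. f x = g x"
  shows "g \<in> borel_measurable (lebesgue_on S)"
proof (rule borel_measurable_if_D)
  show "(\<lambda>x. if x \<in> S then g x else 0) \<in> borel_measurable lebesgue"
  proof (rule borel_measurable_AE[OF borel_measurable_if_I[OF f S]])
    have "AE x in lebesgue. x \<in> S \<longrightarrow> f x = g x" using eq S by (simp add: AE_restrict_space_iff)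
    then show "AE x in lebesgue. (if x \<in> S then f x else 0) = (if x \<in> S then g x else 0)"
      by eventually_elim auto
  qed
qed

text \<open>Composition with a simple function is measurable piece by piece, and continuity in the
  second argument passes to the limit. Times without continuity form a negligible set, where the
  values are first replaced by 0.\<close>

lemma borel_measurable_caratheodory:
  fixes f :: "real \<Rightarrow> 'a::euclidean_space \<Rightarrow> real"
  assumes f: "\<And>v. (\<lambda>t. f t v) \<in> borel_measurable (lebesgue_on S)" and S: "S \<in> sets lebesgue"
    and cont: "AE t in lebesgue_on S. continuous_on UNIV (f t)"
    and u: "u \<in> borel_measurable (lebesgue_on S)"
  shows "(\<lambda>t. f t (u t)) \<in> borel_measurable (lebesgue_on S)"
proof -
  let ?M = "lebesgue_on S"
  obtain N where N: "negligible N" "\<And>t. t \<in> S - N \<Longrightarrow> continuous_on UNIV (f t)"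
    using cont unfolding AE_lebesgue_on_iff[OF S] by blast
  have Nm: "N \<in> sets lebesgue" using N(1) by (rule negligible_imp_sets)
  define g where "g t v = (if t \<in> N then 0 else f t v)" for t v
  have pred: "Measurable.pred ?M (\<lambda>t. t \<in> N)"
  proof -
    have "N \<inter> S \<in> sets ?M" using Nm S sets_restrict_space_iff[of S lebesgue "N \<inter> S"] by auto
    moreover have "{t \<in> space ?M. t \<in> N} = N \<inter> S" by auto
    ultimately show ?thesis unfolding pred_def by metis
  qed
  have g: "(\<lambda>t. g t v) \<in> borel_measurable ?M" for v
    unfolding g_def using pred f by measurable
  obtain s where s: "\<And>i. simple_function ?M (s i)" "\<And>x. x \<in> space ?M \<Longrightarrow> (\<lambda>i. s i x) \<longlonglongrightarrow> u x"
    using borel_measurable_implies_sequence_metric[OF u, of 0] by blast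
  have "(\<lambda>t. g t (s i t)) \<in> borel_measurable ?M" for i
  proof (rule measurable_compose_countable'[OF g])
    show "s i \<in> ?M \<rightarrow>\<^sub>M count_space (s i ` space ?M)"
      using s(1)[of i] by (subst measurable_count_space_eq2) (auto simp: simple_function_def)
    show "countable (s i ` space ?M)" using s(1)[of i] by (simp add: simple_function_def countable_finite)
  qed
  moreover have "(\<lambda>i. g t (s i t)) \<longlonglongrightarrow> g t (u t)" if t: "t \<in> space ?M" for t
  proof (cases "t \<in> N")
    case False
    then have "continuous_on UNIV (f t)" using N(2) t by simp
    then have "(\<lambda>i. f t (s i t)) \<longlonglongrightarrow> f t (u t)"
      by (rule continuous_on_tendsto_compose[OF _ s(2)[OF t]]) auto
    then show ?thesis using False by (simp add: g_def)
  qed (simp add: g_def)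
  ultimately have "(\<lambda>t. g t (u t)) \<in> borel_measurable ?M"
    by (rule borel_measurable_LIMSEQ_real[rotated])
  then show ?thesis
  proof (rule borel_measurable_lebesgue_on_AE[OF _ S])
    show "AE t in ?M. g t (u t) = f t (u t)"
      unfolding AE_lebesgue_on_iff[OF S] using N(1) by (auto simp: g_def)
  qed
qed

section \<open>Extended integrals\<close>

lemma extended_integral_eq_integral:
  assumes "integrable M g"
  shows "extended_integral M g = ereal (integral\<^sup>L M g)"
proof -
  have fin: "(\<integral>\<^sup>+ t. ennreal (g t) \<partial>M) \<noteq> \<infinity>" "(\<integral>\<^sup>+ t. ennreal (- g t) \<partial>M) \<noteq> \<infinity>"
    using assms by (auto simp: real_integrable_def)
  have *: "enn2ereal x = ereal (enn2real x)" if "x \<noteq> \<infinity>" for x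
    using that by (cases x) (auto simp: enn2ereal_ennreal)
  show ?thesis
    unfolding extended_integral_def real_lebesgue_integral_def[OF assms] using fin by (simp add: *)
qed

text \<open>The minorant \<open>- c\<close> makes the negative part finite, so an infinite positive
  part could not be compensated and would give the value infinity.\<close>

lemma integrable_if_extended_integral:
  assumes g: "g \<in> borel_measurable M" and c: "integrable M c" and lower: "AE t in M. - c t \<le> g t"
    and fin: "extended_integral M g \<noteq> \<infinity>"
  shows "integrable M g"
proof -
  have neg: "(\<integral>\<^sup>+ t. ennreal (- g t) \<partial>M) \<noteq> \<infinity>"
  proof -
    have "(\<integral>\<^sup>+ t. ennreal (- g t) \<partial>M) \<le> (\<integral>\<^sup>+ t. ennreal (c t) \<partial>M)"
      using lower by (intro nn_integral_mono_AE) (auto elim!: eventually_mono intro!: ennreal_leI)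
    then show ?thesis using c neq_top_trans by (fastforce simp: real_integrable_def)
  qed
  have "(\<integral>\<^sup>+ t. ennreal (g t) \<partial>M) \<noteq> \<infinity>"
  proof
    assume *: "(\<integral>\<^sup>+ t. ennreal (g t) \<partial>M) = \<infinity>"
    obtain r where "enn2ereal (\<integral>\<^sup>+ t. ennreal (- g t) \<partial>M) = ereal r"
      using neg by (cases "\<integral>\<^sup>+ t. ennreal (- g t) \<partial>M") (auto simp: enn2ereal_ennreal)
    then show False using fin * unfolding extended_integral_def by (simp add: top_ereal_def)
  qed
  with g neg show ?thesis by (simp add: real_integrable_def)
qed

section \<open>Functions with integrable power\<close>

lemma Lp_spaceI:
  assumes "v \<in> borel_measurable (lebesgue_on {0..T})" "integrable (lebesgue_on {0..T}) g"
    "\<And>t. t \<in> {0..T} \<Longrightarrow> norm (v t) powr p \<le> g t"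
  shows "v \<in> Lp_space p T"
  unfolding Lp_space_def
proof (safe intro!: assms(1))
  show "integrable (lebesgue_on {0..T}) (\<lambda>t. norm (v t) powr p)"
    by (rule Bochner_Integration.integrable_bound[OF assms(2)])
       (use assms in \<open>auto intro!: AE_I2 order_trans[OF _ abs_ge_self]\<close>)
qed

lemma Lp_space_measurable: "u \<in> Lp_space p T \<Longrightarrow> u \<in> borel_measurable (lebesgue_on {0..T})"
  by (simp add: Lp_space_def)

lemma Lp_space_imp_integrable:
  assumes "u \<in> Lp_space p T" "1 \<le> p"
  shows "integrable (lebesgue_on {0..T}) u"
proof (rule Bochner_Integration.integrable_bound)
  show "integrable (lebesgue_on {0..T}) (\<lambda>t. 1 + norm (u t) powr p)"
    using assms by (intro Bochner_Integration.integrable_add integrable_const_ivl)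
      (auto simp: Lp_space_def integrable_const_ivl)
  have "norm (u t) \<le> 1 + norm (u t) powr p" for t
  proof (cases "norm (u t) \<le> 1")
    case False
    then have "norm (u t) powr 1 \<le> norm (u t) powr p" using assms by (intro powr_mono) auto
    then show ?thesis using False by simp
  qed (simp add: add_increasing2)
  then show "AE t in lebesgue_on {0..T}. norm (u t) \<le> norm (1 + norm (u t) powr p)"
    by (intro AE_I2) (metis abs_ge_self order_trans real_norm_def)
qed (use assms in \<open>simp add: Lp_space_def\<close>)

lemma Lp_space_zero: "0 < p \<Longrightarrow> (\<lambda>t. 0) \<in> Lp_space p T"
  by (rule Lp_spaceI[where g = "\<lambda>_. 0"]) auto

lemma Lp_space_scaleR:
  assumes "u \<in> Lp_space p T"
  shows "(\<lambda>t. r *\<^sub>R u t) \<in> Lp_space p T"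
  by (rule Lp_spaceI[where g = "\<lambda>t. \<bar>r\<bar> powr p * norm (u t) powr p"])
     (use assms in \<open>auto simp: Lp_space_def powr_mult\<close>)

lemma powr_add_le:
  fixes x y p :: real
  assumes "0 \<le> x" "0 \<le> y" "0 \<le> p"
  shows "(x + y) powr p \<le> 2 powr p * (x powr p + y powr p)"
proof -
  have "(x + y) powr p \<le> (2 * max x y) powr p" using assms by (intro powr_mono2) auto
  also have "\<dots> = 2 powr p * max x y powr p" using assms by (simp add: powr_mult)
  also have "\<dots> \<le> 2 powr p * (x powr p + y powr p)"
    by (intro mult_left_mono) (auto simp: max_def)
  finally show ?thesis .
qed

lemma Lp_space_add:
  assumes u: "u \<in> Lp_space p T" and v: "v \<in> Lp_space p T" and p: "0 \<le> p"
  shows "(\<lambda>t. u t + v t) \<in> Lp_space p T"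
proof (rule Lp_spaceI[where g = "\<lambda>t. 2 powr p * (norm (u t) powr p + norm (v t) powr p)"])
  fix t
  have "norm (u t + v t) powr p \<le> (norm (u t) + norm (v t)) powr p"
    using p by (intro powr_mono2 norm_triangle_ineq) auto
  also have "\<dots> \<le> 2 powr p * (norm (u t) powr p + norm (v t) powr p)"
    using p by (intro powr_add_le) auto
  finally show "norm (u t + v t) powr p \<le> 2 powr p * (norm (u t) powr p + norm (v t) powr p)" .
qed (use u v in \<open>auto simp: Lp_space_def\<close>)

lemma Lp_space_sum:
  assumes "finite I" "\<And>i. i \<in> I \<Longrightarrow> u i \<in> Lp_space p T" "0 < p"
  shows "(\<lambda>t. \<Sum>i\<in>I. u i t) \<in> Lp_space p T"
  using assms by (induction I) (auto intro!: Lp_space_zero Lp_space_add)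

lemma Lp_norm_scaleR:
  assumes "0 \<le> r" "0 < p"
  shows "Lp_norm p T (\<lambda>t. r *\<^sub>R u t) = r * Lp_norm p T u"
proof -
  have "(LINT t|lebesgue_on {0..T}. norm (r *\<^sub>R u t) powr p) = r powr p * (LINT t|lebesgue_on {0..T}. norm (u t) powr p)"
    using assms by (simp add: powr_mult)
  then show ?thesis
    unfolding Lp_norm_def using assms by (simp add: powr_mult powr_powr)
qed

text \<open>The factor \<open>norm (x1 + x2)\<close> is unbounded globally, but with one point fixed
  it converges, so the right-hand side tends to 0.\<close>

lemma continuous_on_lipschitz_field:
  fixes F :: "'a::real_normed_vector \<Rightarrow> 'p::real_normed_vector \<Rightarrow> 'b::real_normed_vector"
  assumes "\<And>x1 x2 \<theta>1 \<theta>2. \<theta>1 \<in> \<Theta> \<Longrightarrow> \<theta>2 \<in> \<Theta> \<Longrightarrow>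
           norm (F x1 \<theta>1 - F x2 \<theta>2) \<le> L * (norm (x1 - x2) + norm (x1 + x2) * norm (\<theta>1 - \<theta>2))"
  shows "continuous_on (UNIV \<times> \<Theta>) (\<lambda>(x, \<theta>). F x \<theta>)"
  unfolding continuous_on_def
proof
  fix q :: "'a \<times> 'p" assume q: "q \<in> UNIV \<times> \<Theta>"
  let ?l = "\<lambda>r. L * (norm (fst r - fst q) + norm (fst r + fst q) * norm (snd r - snd q))"
  have "(?l \<longlongrightarrow> L * (norm (fst q - fst q) + norm (fst q + fst q) * norm (snd q - snd q))) (at q within UNIV \<times> \<Theta>)"
    by (intro tendsto_intros)
  then have l: "(?l \<longlongrightarrow> 0) (at q within UNIV \<times> \<Theta>)" by simp
  have "((\<lambda>r. (case r of (x, \<theta>) \<Rightarrow> F x \<theta>) - (case q of (x, \<theta>) \<Rightarrow> F x \<theta>)) \<longlongrightarrow> 0) (at q within UNIV \<times> \<Theta>)"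
  proof (rule Lim_null_comparison[OF _ l])
    show "\<forall>\<^sub>F r in at q within UNIV \<times> \<Theta>. norm ((case r of (x, \<theta>) \<Rightarrow> F x \<theta>) - (case q of (x, \<theta>) \<Rightarrow> F x \<theta>)) \<le> ?l r"
      unfolding eventually_at_filter using q assms by (intro always_eventually) (auto simp: split_def)
  qed
  then show "((\<lambda>(x, \<theta>). F x \<theta>) \<longlongrightarrow> (case q of (x, \<theta>) \<Rightarrow> F x \<theta>)) (at q within UNIV \<times> \<Theta>)"
    by (simp add: LIM_zero_iff split_def)
qed

lemma sum_UNIV_option:
  fixes h :: "'k::finite option \<Rightarrow> 'a::comm_monoid_add"
  shows "(\<Sum>i\<in>UNIV. h i) = h None + (\<Sum>j\<in>UNIV. h (Some j))"
  by (simp add: UNIV_option_conv sum.reindex)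

lemma field_matrix_mult:
  "field_matrix F x \<theta> *v v = (\<Sum>i\<in>UNIV. v $ i *\<^sub>R F i x \<theta>)"
  by (simp add: vec_eq_iff matrix_vector_mult_def field_matrix_def mult.commute)

lemma vector_field_matrix_mult:
  "(y v* field_matrix F x \<theta>) $ i = y \<bullet> F i x \<theta>"
  by (simp add: vector_matrix_mult_def field_matrix_def inner_vec_def mult.commute)

locale ensemble_problem =
  fixes p T L C :: real
    and \<Theta> :: "(real^'l) set"
    and F0 :: "real^'d \<Rightarrow> real^'l \<Rightarrow> real^'d"
    and F :: "'k::finite \<Rightarrow> real^'d \<Rightarrow> real^'l \<Rightarrow> real^'d"
    and x0 :: "real^'l \<Rightarrow> real^'d"
    and a :: "real^'d \<Rightarrow> real^'l \<Rightarrow> real"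
    and f :: "real \<Rightarrow> real^'k \<Rightarrow> real"
    and c c' :: "real \<Rightarrow> real"
    and u' :: "real^'k"
    and ustar :: "real \<Rightarrow> real^'k"
  assumes p: "1 < p" and T: "0 < T"
    and \<Theta>: "compact \<Theta>" "\<Theta> \<noteq> {}"
    and L: "0 < L"
    and F0_lipschitz: "\<And>x1 x2 \<theta>1 \<theta>2. \<theta>1 \<in> \<Theta> \<Longrightarrow> \<theta>2 \<in> \<Theta> \<Longrightarrow>
           norm (F0 x1 \<theta>1 - F0 x2 \<theta>2) \<le> L * (norm (x1 - x2) + norm (x1 + x2) * norm (\<theta>1 - \<theta>2))"
    and F_lipschitz: "\<And>i x1 x2 \<theta>1 \<theta>2. \<theta>1 \<in> \<Theta> \<Longrightarrow> \<theta>2 \<in> \<Theta> \<Longrightarrow>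
           norm (F i x1 \<theta>1 - F i x2 \<theta>2) \<le> L * (norm (x1 - x2) + norm (x1 + x2) * norm (\<theta>1 - \<theta>2))"
    and x0_cont: "continuous_on \<Theta> x0"
    and a_cont: "continuous_on (UNIV \<times> \<Theta>) (\<lambda>(x, \<theta>). a x \<theta>)"
    and f_measurable: "\<And>v. (\<lambda>t. f t v) \<in> borel_measurable (lebesgue_on {0..T})"
    and f_convex: "AE t in lebesgue_on {0..T}. continuous_on UNIV (f t) \<and> convex_on UNIV (f t)"
    and c_L1: "integrable (lebesgue_on {0..T}) c"
    and C: "0 < C"
    and f_coercive: "AE t in lebesgue_on {0..T}. \<forall>v. f t v \<ge> C * norm v powr p - c t"
    and c'_L1: "integrable (lebesgue_on {0..T}) c'"
    and f_u': "AE t in lebesgue_on {0..T}. \<bar>f t u'\<bar> \<le> c' t"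
    and F0_diff: "\<And>x \<theta>. \<theta> \<in> \<Theta> \<Longrightarrow> (\<lambda>z. F0 z \<theta>) differentiable (at x)"
    and F0_jacobian_cont: "continuous_on (UNIV \<times> \<Theta>) (\<lambda>(x, \<theta>). jacobian (\<lambda>z. F0 z \<theta>) (at x))"
    and F_diff: "\<And>i x \<theta>. \<theta> \<in> \<Theta> \<Longrightarrow> (\<lambda>z. F i z \<theta>) differentiable (at x)"
    and F_jacobian_cont:
          "\<And>i. continuous_on (UNIV \<times> \<Theta>) (\<lambda>(x, \<theta>). jacobian (\<lambda>z. F i z \<theta>) (at x))"
    and a_diff: "\<And>x \<theta>. \<theta> \<in> \<Theta> \<Longrightarrow> (\<lambda>z. a z \<theta>) differentiable (at x)"
    and a_gradient_cont: "continuous_on (UNIV \<times> \<Theta>) (\<lambda>(x, \<theta>). gradient (\<lambda>z. a z \<theta>) x)"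
    and local_min: "Lp_local_minimizer p T (cost_functional F0 F x0 a f T \<Theta>) ustar"
begin

abbreviation "M \<equiv> lebesgue_on {0..T}"

text \<open>The drift \<open>F0\<close> is the field with index \<open>None\<close>, driven by the constant control 1.\<close>
definition "G i x \<theta> = (case i of None \<Rightarrow> F0 x \<theta> | Some j \<Rightarrow> F j x \<theta>)"
definition "J i x \<theta> = (case i of None \<Rightarrow> jacobian (\<lambda>z. F0 z \<theta>) (at x) | Some j \<Rightarrow> jacobian (\<lambda>z. F j z \<theta>) (at x))"
definition coef :: "(real \<Rightarrow> real^'k) \<Rightarrow> 'k option \<Rightarrow> real \<Rightarrow> real" where
  "coef u i s = (case i of None \<Rightarrow> 1 | Some j \<Rightarrow> u s $ j)"
text \<open>A perturbation of the control leaves the drift alone, hence 0 at \<open>None\<close>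
  where \<open>coef\<close> has 1. This makes \<open>coef_add\<close> hold on the whole index
  type.\<close>

definition dir :: "(real \<Rightarrow> real^'k) \<Rightarrow> 'k option \<Rightarrow> real \<Rightarrow> real" where
  "dir w i s = (case i of None \<Rightarrow> 0 | Some j \<Rightarrow> w s $ j)"

sublocale sys: affine_system T L \<Theta> G J x0 a "\<lambda>x \<theta>. gradient (\<lambda>z. a z \<theta>) x"
proof (unfold_locales, goal_cases)
  case (4 \<theta> i x y)
  then show ?case
    using F0_lipschitz[of \<theta> \<theta> x y] F_lipschitz[of \<theta> \<theta> _ x y] by (auto simp: G_def split: option.split)
next
  case (5 i)
  show ?case
    using continuous_on_lipschitz_field[of \<Theta> F0 L, OF F0_lipschitz]
      continuous_on_lipschitz_field[of \<Theta> "F _" L, OF F_lipschitz]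
    by (cases i) (simp_all add: G_def)
next
  case (6 \<theta> i x)
  then show ?case
    using F0_diff[of \<theta> x] F_diff[of \<theta> _ x] by (auto simp: G_def J_def jacobian_works split: option.split)
next
  case (7 i)
  show ?case using F0_jacobian_cont F_jacobian_cont by (cases i) (auto simp: J_def)
next
  case (9 \<theta> x)
  then show ?case by (intro has_derivative_gradient a_diff)
qed (use T \<Theta> L x0_cont a_gradient_cont in auto)

abbreviation "St u \<equiv> state_map F0 F x0 T u"
abbreviation "X \<equiv> St ustar"
abbreviation "\<Lambda> \<equiv> adjoint_map F0 F x0 a T ustar"

section \<open>States, adjoints and cost of the ensemble\<close>

lemma vfield_coef: "sys.vfield (coef u) \<theta> = (\<lambda>s x. F0 x \<theta> + field_matrix F x \<theta> *v u s)"
  by (simp add: fun_eq_iff sys.vfield_def sum_UNIV_option coef_def G_def field_matrix_mult)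

lemma Lp_component:
  fixes u :: "real \<Rightarrow> real^'n"
  assumes "u \<in> Lp_space p T"
  shows "(\<lambda>s. u s $ j) absolutely_integrable_on {0..T}"
proof -
  have "u absolutely_integrable_on {0..T}"
    using Lp_space_imp_integrable[OF assms] p by (simp add: integrable_restrict_space set_integrable_def)
  then show ?thesis using absolutely_integrable_on_iff_component[of "{0..T}" u] by simp
qed

lemma admissible_coef:
  assumes "u \<in> Lp_space p T"
  shows "sys.admissible (coef u)"
  unfolding sys.admissible_def
proof
  show "coef u i absolutely_integrable_on {0..T}" for i
    using Lp_component[OF assms] by (cases i) (simp_all add: coef_def[abs_def] absolutely_integrable_continuous_real)
qed

lemma admissible_dir:
  assumes "w \<in> Lp_space p T"
  shows "sys.admissible (dir w)"
  unfolding sys.admissible_def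
proof
  show "dir w i absolutely_integrable_on {0..T}" for i
    using Lp_component[OF assms] by (cases i) (simp_all add: dir_def[abs_def])
qed

lemma coef_add: "coef (\<lambda>t. u t + \<epsilon> *\<^sub>R w t) = (\<lambda>i s. coef u i s + \<epsilon> * dir w i s)"
  by (auto simp: fun_eq_iff coef_def dir_def split: option.split)

lemma is_state_St:
  assumes "u \<in> Lp_space p T" "\<theta> \<in> \<Theta>"
  shows "sys.is_state (coef u) \<theta> (\<lambda>t. St u t \<theta>)"
proof -
  have "\<exists>x. sys.is_state (coef u) \<theta> x"
    by (intro sys.state_exists admissible_coef assms)
  from someI_ex[OF this] show ?thesis
    by (simp add: state_map_def sys.is_state_def vfield_coef)
qed

lemma ustar: "ustar \<in> Lp_space p T"
  using local_min by (simp add: Lp_local_minimizer_def)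

lemma St_cont:
  assumes "u \<in> Lp_space p T"
  shows "continuous_on ({0..T} \<times> \<Theta>) (\<lambda>(t, \<theta>). St u t \<theta>)"
  by (rule sys.state_cont[OF admissible_coef[OF assms] is_state_St[OF assms]])

lemma is_adjoint_\<Lambda>:
  assumes "\<theta> \<in> \<Theta>"
  shows "sys.is_adjoint (coef ustar) \<theta> (\<lambda>t. X t \<theta>) (\<lambda>t. \<Lambda> t \<theta>)"
proof -
  have "\<exists>l. sys.is_adjoint (coef ustar) \<theta> (\<lambda>t. X t \<theta>) l"
    by (intro sys.adjoint_exists admissible_coef ustar St_cont assms)
  moreover have "(\<Sum>i\<in>UNIV. coef ustar i s *\<^sub>R J i (X s \<theta>) \<theta>) = jacobian (\<lambda>z. F0 z \<theta>) (at (X s \<theta>)) +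
       (\<Sum>i\<in>UNIV. ustar s $ i *\<^sub>R jacobian (\<lambda>z. F i z \<theta>) (at (X s \<theta>)))" for s
    by (simp add: sum_UNIV_option coef_def J_def)
  ultimately show ?thesis
    using someI_ex[of "sys.is_adjoint (coef ustar) \<theta> (\<lambda>t. X t \<theta>)"]
    by (simp add: adjoint_map_def sys.is_adjoint_def)
qed

lemma \<Lambda>_cont: "continuous_on ({0..T} \<times> \<Theta>) (\<lambda>(t, \<theta>). \<Lambda> t \<theta>)"
  by (rule sys.adjoint_cont[OF admissible_coef[OF ustar] St_cont[OF ustar] is_adjoint_\<Lambda>])

lemma endcost_cont:
  assumes "u \<in> Lp_space p T"
  shows "continuous_on \<Theta> (\<lambda>\<theta>. a (St u T \<theta>) \<theta>)"
proof -
  have "continuous_on \<Theta> (\<lambda>\<theta>. (\<lambda>(t, \<theta>). a (St u t \<theta>) \<theta>) (T, \<theta>))"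
    by (rule continuous_on_compose2[OF sys.comp_cont[OF a_cont St_cont[OF assms]]])
       (use T in \<open>auto intro!: continuous_intros\<close>)
  then show ?thesis by simp
qed

definition "worst u = (SUP \<theta>\<in>\<Theta>. a (St u T \<theta>) \<theta>)"

lemma worst_ge:
  assumes "u \<in> Lp_space p T" "\<theta> \<in> \<Theta>"
  shows "a (St u T \<theta>) \<theta> \<le> worst u"
  unfolding worst_def
  using bounded_imp_bdd_above[OF compact_imp_bounded[OF compact_continuous_image[OF endcost_cont[OF assms(1)] \<Theta>(1)]]] assms(2)
  by (intro cSUP_upper) auto

lemma worst_attained:
  assumes "u \<in> Lp_space p T"
  obtains \<theta> where "\<theta> \<in> \<Theta>" "a (St u T \<theta>) \<theta> = worst u"
proof -
  obtain \<theta> where \<theta>: "\<theta> \<in> \<Theta>" "\<And>\<eta>. \<eta> \<in> \<Theta> \<Longrightarrow> a (St u T \<eta>) \<eta> \<le> a (St u T \<theta>) \<theta>"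
    using continuous_attains_sup[OF \<Theta> endcost_cont[OF assms]] by auto
  then have "worst u \<le> a (St u T \<theta>) \<theta>" unfolding worst_def using \<Theta>(2) by (intro cSUP_least) auto
  with \<theta>(1) worst_ge[OF assms \<theta>(1)] show ?thesis by (intro that) auto
qed

lemma f_comp_measurable:
  assumes "u \<in> borel_measurable M"
  shows "(\<lambda>t. f t (u t)) \<in> borel_measurable M"
  by (rule borel_measurable_caratheodory[OF f_measurable _ _ assms]) (use f_convex in auto)

lemma f_lower: "AE t in M. - c t \<le> f t (u t)"
  using f_coercive
proof eventually_elim
  case (elim t)
  have "0 \<le> C * norm (u t) powr p" using C by simp
  then show ?case using elim[rule_format, of "u t"] by linarith
qed

text \<open>An upper bound is enough, because coercivity supplies the integrable lower bound
  \<open>- c\<close>.\<close>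

lemma f_comp_integrable:
  assumes u: "u \<in> borel_measurable M" and g: "integrable M g" and le: "AE t in M. f t (u t) \<le> g t"
  shows "integrable M (\<lambda>t. f t (u t))"
proof (rule Bochner_Integration.integrable_bound)
  show "integrable M (\<lambda>t. \<bar>c t\<bar> + \<bar>g t\<bar>)"
    using c_L1 g by (intro Bochner_Integration.integrable_add integrable_abs)
  show "AE t in M. norm (f t (u t)) \<le> norm (\<bar>c t\<bar> + \<bar>g t\<bar>)"
    using le f_lower[of u] by eventually_elim (simp add: abs_le_iff, linarith)
qed (rule f_comp_measurable[OF u])

lemma cost_eq:
  assumes "integrable M (\<lambda>t. f t (u t))"
  shows "cost_functional F0 F x0 a f T \<Theta> u = ereal (worst u + (LINT t|M. f t (u t)))"
  by (simp add: cost_functional_def worst_def extended_integral_eq_integral[OF assms])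

text \<open>Replacing \<open>ustar\<close> by \<open>u'\<close> where \<open>f t (ustar t) > n\<close> yields competitors of finite cost that
  converge to \<open>ustar\<close> in \<open>L\<^sup>p\<close>.\<close>
lemma ustar_finite: "integrable M (\<lambda>t. f t (ustar t))"
proof -
  obtain e where e: "e > 0" "\<And>v. v \<in> Lp_space p T \<Longrightarrow> Lp_norm p T (\<lambda>t. v t - ustar t) < e \<Longrightarrow>
      cost_functional F0 F x0 a f T \<Theta> ustar \<le> cost_functional F0 F x0 a f T \<Theta> v"
    using local_min unfolding Lp_local_minimizer_def by auto
  note um = Lp_space_measurable[OF ustar]
  note fm = f_comp_measurable[OF um]
  define v where "v n t = (if f t (ustar t) \<le> real n then ustar t else u')" for n t
  have vm: "v n \<in> borel_measurable M" for n
    unfolding v_def[abs_def] using um fm by measurable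
  have const: "(\<lambda>t. r) \<in> Lp_space p T" for r :: "real^'k"
    by (rule Lp_spaceI[where g = "\<lambda>_. norm r powr p"]) (auto intro: integrable_const_ivl)
  have vLp: "v n \<in> Lp_space p T" for n
    by (rule Lp_spaceI[OF vm, where g = "\<lambda>t. norm (ustar t) powr p + norm u' powr p"])
       (use ustar const[of u'] in \<open>auto simp: Lp_space_def v_def\<close>)
  have dLp: "(\<lambda>t. u' - ustar t) \<in> Lp_space p T"
    using Lp_space_add[OF const[of u'] Lp_space_scaleR[OF ustar, of "-1"]] p by simp
  have "(\<lambda>n. LINT t|M. norm (v n t - ustar t) powr p) \<longlonglongrightarrow> (LINT t|M. 0)"
  proof (rule integral_dominated_convergence[where w = "\<lambda>t. norm (u' - ustar t) powr p"])
    show "integrable M (\<lambda>t. norm (u' - ustar t) powr p)" using dLp by (simp add: Lp_space_def)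
    show "(\<lambda>t. norm (v n t - ustar t) powr p) \<in> borel_measurable M" for n using vm um by measurable
    show "AE t in M. (\<lambda>n. norm (v n t - ustar t) powr p) \<longlonglongrightarrow> 0"
    proof (intro AE_I2 tendsto_eventually)
      fix t
      obtain m where "f t (ustar t) \<le> real m" using real_arch_simple by blast
      then show "\<forall>\<^sub>F n in sequentially. norm (v n t - ustar t) powr p = 0"
        unfolding eventually_sequentially by (intro exI[of _ m]) (auto simp: v_def)
    qed
    show "AE t in M. norm (norm (v n t - ustar t) powr p) \<le> norm (u' - ustar t) powr p" for n
      by (intro AE_I2) (simp add: v_def)
  qed auto
  then have "(\<lambda>n. LINT t|M. norm (v n t - ustar t) powr p) \<longlonglongrightarrow> 0" by simp
  moreover have "e powr p > 0" using e by simp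
  ultimately obtain n where n: "(LINT t|M. norm (v n t - ustar t) powr p) < e powr p"
    using order_tendstoD(2) eventually_happens' sequentially_bot by blast
  have "Lp_norm p T (\<lambda>t. v n t - ustar t) < (e powr p) powr (1 / p)"
    unfolding Lp_norm_def using p by (intro powr_less_mono2 n integral_nonneg_AE) auto
  also have "\<dots> = e" using e p by (simp add: powr_powr)
  finally have le: "cost_functional F0 F x0 a f T \<Theta> ustar \<le> cost_functional F0 F x0 a f T \<Theta> (v n)"
    by (intro e vLp)
  have "integrable M (\<lambda>t. f t (v n t))"
  proof (rule f_comp_integrable[OF vm])
    show "integrable M (\<lambda>t. real n + \<bar>c' t\<bar>)"
      using c'_L1 by (auto intro!: Bochner_Integration.integrable_add integrable_const_ivl)
    show "AE t in M. f t (v n t) \<le> real n + \<bar>c' t\<bar>"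
      using f_u' by eventually_elim (auto simp: v_def)
  qed
  from cost_eq[OF this] le have "extended_integral M (\<lambda>t. f t (ustar t)) \<noteq> \<infinity>"
    by (auto simp: cost_functional_def)
  then show ?thesis
    using integrable_if_extended_integral[OF fm c_L1 f_lower] by blast
qed

text \<open>Finiteness at the full step is required only: by convexity the cost is then finite along
  the whole segment, as \<open>segment_cost\<close> shows.\<close>

definition "directions = {w \<in> Lp_space p T. integrable M (\<lambda>t. f t (ustar t + w t))}"
definition "gain w = (LINT t|M. f t (ustar t + w t)) - (LINT t|M. f t (ustar t))"
abbreviation "sens w \<equiv> sys.sensitivity (dir w) X \<Lambda>"
definition "argmax = {\<theta> \<in> \<Theta>. a (X T \<theta>) \<theta> = worst ustar}"

section \<open>First order conditions for finitely many directions\<close>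

lemma directionsD: "w \<in> directions \<Longrightarrow> w \<in> Lp_space p T" "w \<in> directions \<Longrightarrow> integrable M (\<lambda>t. f t (ustar t + w t))"
  by (auto simp: directions_def)

lemma argmax_compact: "compact argmax"
proof -
  have "closedin (top_of_set \<Theta>) (\<Theta> \<inter> (\<lambda>\<theta>. a (X T \<theta>) \<theta>) -` {worst ustar})"
    by (rule continuous_closedin_preimage[OF endcost_cont[OF ustar]]) simp
  moreover have "\<Theta> \<inter> (\<lambda>\<theta>. a (X T \<theta>) \<theta>) -` {worst ustar} = argmax" by (auto simp: argmax_def)
  ultimately show ?thesis using \<Theta>(1) closedin_compact by auto
qed

lemma argmax_nonempty: "argmax \<noteq> {}"
  using worst_attained[OF ustar] by (auto simp: argmax_def)

lemma sens_cont: "w \<in> Lp_space p T \<Longrightarrow> continuous_on \<Theta> (sens w)"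
  by (intro sys.sensitivity_cont admissible_dir St_cont ustar \<Lambda>_cont)

lemma segment_cost:
  assumes w: "w \<in> directions" and \<epsilon>: "0 \<le> \<epsilon>" "\<epsilon> \<le> 1"
  shows "integrable M (\<lambda>t. f t (ustar t + \<epsilon> *\<^sub>R w t))"
    "(LINT t|M. f t (ustar t + \<epsilon> *\<^sub>R w t)) \<le> (LINT t|M. f t (ustar t)) + \<epsilon> * gain w"
proof -
  note fw = directionsD(2)[OF w]
  have g: "integrable M (\<lambda>t. (1 - \<epsilon>) * f t (ustar t) + \<epsilon> * f t (ustar t + w t))"
    by (intro Bochner_Integration.integrable_add integrable_mult_right ustar_finite fw)
  have le: "AE t in M. f t (ustar t + \<epsilon> *\<^sub>R w t) \<le> (1 - \<epsilon>) * f t (ustar t) + \<epsilon> * f t (ustar t + w t)"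
    using f_convex
  proof eventually_elim
    case (elim t)
    then have "f t ((1 - \<epsilon>) *\<^sub>R ustar t + \<epsilon> *\<^sub>R (ustar t + w t)) \<le> (1 - \<epsilon>) * f t (ustar t) + \<epsilon> * f t (ustar t + w t)"
      using \<epsilon> by (intro convex_onD) auto
    then show ?case by (simp add: algebra_simps)
  qed
  have "(\<lambda>t. ustar t + \<epsilon> *\<^sub>R w t) \<in> borel_measurable M"
    using Lp_space_measurable[OF ustar] Lp_space_measurable[OF directionsD(1)[OF w]] by measurable
  then show i: "integrable M (\<lambda>t. f t (ustar t + \<epsilon> *\<^sub>R w t))" by (rule f_comp_integrable[OF _ g le])
  have "(LINT t|M. f t (ustar t + \<epsilon> *\<^sub>R w t)) \<le> (LINT t|M. (1 - \<epsilon>) * f t (ustar t) + \<epsilon> * f t (ustar t + w t))"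
    by (rule integral_mono_AE[OF i g le])
  also have "\<dots> = (LINT t|M. f t (ustar t)) + \<epsilon> * gain w"
    using ustar_finite fw by (simp add: gain_def algebra_simps)
  finally show "(LINT t|M. f t (ustar t + \<epsilon> *\<^sub>R w t)) \<le> (LINT t|M. f t (ustar t)) + \<epsilon> * gain w" .
qed

text \<open>The one-sided derivative of a maximum, as in Danskin's theorem. Let
  \<open>\<theta> k\<close> maximize the end-point cost of the control perturbed by
  \<open>\<epsilon> k\<close>. Minimality bounds its deficit \<open>A - ?h (\<theta> k)\<close> for
  \<open>ustar\<close> by \<open>\<epsilon> k\<close> times a bounded factor. Deficits are
  nonnegative, so the limit factor is nonnegative too; they tend to 0, so a limit parameter belongs
  to \<open>argmax\<close>.\<close>

lemma directional_derivative:
  assumes w: "w \<in> directions"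
  shows "\<exists>\<theta>\<in>argmax. 0 \<le> gain w - sens w \<theta>"
proof -
  note wLp = directionsD(1)[OF w]
  obtain e where e: "e > 0" "\<And>v. v \<in> Lp_space p T \<Longrightarrow> Lp_norm p T (\<lambda>t. v t - ustar t) < e \<Longrightarrow>
      cost_functional F0 F x0 a f T \<Theta> ustar \<le> cost_functional F0 F x0 a f T \<Theta> v"
    using local_min unfolding Lp_local_minimizer_def by auto
  let ?h = "\<lambda>\<theta>. a (X T \<theta>) \<theta>"
  define A where "A = worst ustar"
  have "\<exists>\<epsilon> \<theta>. 0 < \<epsilon> \<and> \<epsilon> < 1 / real (Suc k) \<and> \<theta> \<in> \<Theta> \<and> A - ?h \<theta> \<le> \<epsilon> * (gain w - sens w \<theta> + 1 / real (Suc k))" for k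
  proof -
    have k: "0 < 1 / real (Suc k)" by simp
    obtain \<delta> where \<delta>: "\<delta> > 0" "\<And>\<epsilon> \<theta> x. \<lbrakk>0 < \<epsilon>; \<epsilon> < \<delta>; \<theta> \<in> \<Theta>; sys.is_state (\<lambda>i s. coef ustar i s + \<epsilon> * dir w i s) \<theta> x\<rbrakk>
        \<Longrightarrow> \<bar>a (x T) \<theta> - ?h \<theta> + \<epsilon> * sens w \<theta>\<bar> \<le> 1 / real (Suc k) * \<epsilon>"
      using sys.endpoint_expansion[OF admissible_coef[OF ustar] admissible_dir[OF wLp] is_state_St[OF ustar] is_adjoint_\<Lambda> k]
      by blast
    \<comment> \<open>The summand 1 permits division by \<open>W\<close> even if \<open>w\<close>
      has norm 0.\<close>
    define W where "W = Lp_norm p T w + 1"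
    have W: "W > 0" by (simp add: W_def Lp_norm_def add_nonneg_pos)
    obtain \<epsilon> where \<epsilon>: "0 < \<epsilon>" "\<epsilon> < min \<delta> (min (e / W) (1 / real (Suc k)))"
      using dense[of 0 "min \<delta> (min (e / W) (1 / real (Suc k)))"] \<delta>(1) e(1) W by auto
    have \<epsilon>1: "\<epsilon> \<le> 1" using \<epsilon>(2) by (simp add: min_less_iff_conj) (smt (verit) divide_le_eq_1 of_nat_0_le_iff)
    let ?v = "\<lambda>t. ustar t + \<epsilon> *\<^sub>R w t"
    have vLp: "?v \<in> Lp_space p T"
      using p by (intro Lp_space_add ustar Lp_space_scaleR wLp) auto
    have "Lp_norm p T (\<lambda>t. ?v t - ustar t) = \<epsilon> * Lp_norm p T w"
      using Lp_norm_scaleR[of \<epsilon> p T w] \<epsilon>(1) p by simp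
    also have "\<dots> \<le> \<epsilon> * W" using \<epsilon>(1) by (simp add: W_def)
    also have "\<dots> < e" using \<epsilon>(2) W by (simp add: field_simps)
    finally have le: "cost_functional F0 F x0 a f T \<Theta> ustar \<le> cost_functional F0 F x0 a f T \<Theta> ?v"
      by (intro e vLp)
    have seg: "integrable M (\<lambda>t. f t (?v t))" "(LINT t|M. f t (?v t)) \<le> (LINT t|M. f t (ustar t)) + \<epsilon> * gain w"
      using segment_cost[OF w, of \<epsilon>] \<epsilon>(1) \<epsilon>1 by auto
    have "A + (LINT t|M. f t (ustar t)) \<le> worst ?v + (LINT t|M. f t (?v t))"
      using le by (simp add: cost_eq[OF ustar_finite] cost_eq[OF seg(1)] A_def)
    then have 1: "A \<le> worst ?v + \<epsilon> * gain w" using seg(2) by simp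
    obtain \<theta> where \<theta>: "\<theta> \<in> \<Theta>" "a (St ?v T \<theta>) \<theta> = worst ?v" using worst_attained[OF vLp] .
    have "sys.is_state (\<lambda>i s. coef ustar i s + \<epsilon> * dir w i s) \<theta> (\<lambda>t. St ?v t \<theta>)"
      using is_state_St[OF vLp \<theta>(1)] by (simp add: coef_add)
    then have "\<bar>worst ?v - ?h \<theta> + \<epsilon> * sens w \<theta>\<bar> \<le> 1 / real (Suc k) * \<epsilon>"
      using \<delta>(2)[OF \<epsilon>(1) _ \<theta>(1), of "\<lambda>t. St ?v t \<theta>"] \<epsilon>(2) \<theta>(2) by simp
    then have "worst ?v - ?h \<theta> \<le> \<epsilon> * (1 / real (Suc k)) - \<epsilon> * sens w \<theta>"
      by (simp only: abs_le_iff mult.commute) linarith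
    with 1 have "A - ?h \<theta> \<le> \<epsilon> * (gain w - sens w \<theta> + 1 / real (Suc k))"
      by (simp only: distrib_left right_diff_distrib)
    with \<epsilon> \<theta>(1) show ?thesis by (intro exI[of _ \<epsilon>] exI[of _ \<theta>]) auto
  qed
  then obtain \<epsilon> \<theta> where \<epsilon>: "\<And>k. 0 < \<epsilon> k" "\<And>k. \<epsilon> k < 1 / real (Suc k)" and \<theta>: "\<And>k. \<theta> k \<in> \<Theta>"
    and le: "\<And>k. A - ?h (\<theta> k) \<le> \<epsilon> k * (gain w - sens w (\<theta> k) + 1 / real (Suc k))"
    by metis
  obtain \<theta>' r where \<theta>': "\<theta>' \<in> \<Theta>" "strict_mono (r :: nat \<Rightarrow> nat)" "(\<lambda>k. \<theta> (r k)) \<longlonglongrightarrow> \<theta>'"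
    using seq_compactE[OF compact_imp_seq_compact[OF \<Theta>(1)], of \<theta>] \<theta> unfolding o_def by blast
  have inv: "(\<lambda>k. 1 / real (Suc (r k))) \<longlonglongrightarrow> 0"
    using LIMSEQ_subseq_LIMSEQ[OF LIMSEQ_inverse_real_of_nat \<theta>'(2)] by (simp add: o_def inverse_eq_divide)
  have \<epsilon>0: "(\<lambda>k. \<epsilon> (r k)) \<longlonglongrightarrow> 0"
    by (rule tendsto_sandwich[OF always_eventually always_eventually tendsto_const inv])
       (use \<epsilon> in \<open>auto intro: less_imp_le\<close>)
  have s: "(\<lambda>k. sens w (\<theta> (r k))) \<longlonglongrightarrow> sens w \<theta>'"
    by (rule continuous_on_tendsto_compose[OF sens_cont[OF wLp] \<theta>'(3,1)]) (simp add: \<theta>)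
  have h: "(\<lambda>k. ?h (\<theta> (r k))) \<longlonglongrightarrow> ?h \<theta>'"
    by (rule continuous_on_tendsto_compose[OF endcost_cont[OF ustar] \<theta>'(3,1)]) (simp add: \<theta>)
  have b: "(\<lambda>k. gain w - sens w (\<theta> (r k)) + 1 / real (Suc (r k))) \<longlonglongrightarrow> gain w - sens w \<theta>' + 0"
    by (intro tendsto_intros s inv)
  have hA: "?h (\<theta> k) \<le> A" for k using worst_ge[OF ustar \<theta>] by (simp add: A_def)
  have "0 \<le> gain w - sens w \<theta>' + 0"
  proof (rule tendsto_lowerbound[OF b always_eventually])
    show "\<forall>k. 0 \<le> gain w - sens w (\<theta> (r k)) + 1 / real (Suc (r k))"
    proof
      fix k
      have "0 \<le> \<epsilon> (r k) * (gain w - sens w (\<theta> (r k)) + 1 / real (Suc (r k)))"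
        using le[of "r k"] hA[of "r k"] by linarith
      then show "0 \<le> gain w - sens w (\<theta> (r k)) + 1 / real (Suc (r k))"
        using \<epsilon>(1)[of "r k"] by (simp only: zero_le_mult_iff) linarith
    qed
  qed auto
  moreover have "A - ?h \<theta>' \<le> 0 * (gain w - sens w \<theta>' + 0)"
    by (rule tendsto_le[OF sequentially_bot tendsto_mult[OF \<epsilon>0 b] tendsto_diff[OF tendsto_const h] always_eventually])
       (use le in auto)
  ultimately show ?thesis
    using \<theta>'(1) worst_ge[OF ustar \<theta>'(1)] by (intro bexI[of _ \<theta>']) (auto simp: argmax_def A_def)
qed

text \<open>The response condition for \<open>minimax_measure\<close>. The mixture \<open>v\<close>
  with normalized weights is again a direction, and its parameter serves the whole sum:
  \<open>gain\<close> is convex and \<open>sens\<close> linear in the direction. If all weights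
  vanish, any maximizer will do.\<close>

lemma convex_combination:
  assumes w: "\<And>i. i < (m::nat) \<Longrightarrow> w i \<in> directions" and \<alpha>: "\<And>i. 0 \<le> \<alpha> i"
  shows "\<exists>\<theta>\<in>argmax. 0 \<le> (\<Sum>i<m. \<alpha> i * (gain (w i) - sens (w i) \<theta>))"
proof (cases "(\<Sum>i<m. \<alpha> i) = 0")
  case True
  then have "\<alpha> i = 0" if "i < m" for i
    using \<alpha> that by (simp add: sum_nonneg_eq_0_iff)
  then show ?thesis using argmax_nonempty by auto
next
  case False
  define A where "A = (\<Sum>i<m. \<alpha> i)"
  have A: "A > 0" using False \<alpha> by (simp add: A_def sum_nonneg order.strict_iff_order)
  define \<beta> where "\<beta> i = \<alpha> i / A" for i
  have \<beta>: "\<And>i. 0 \<le> \<beta> i" "(\<Sum>i<m. \<beta> i) = 1"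
    using \<alpha> A by (auto simp: \<beta>_def sum_divide_distrib[symmetric] A_def)
  have m: "{..<m} \<noteq> {}" using \<beta>(2) by auto
  define v where "v t = (\<Sum>i<m. \<beta> i *\<^sub>R w i t)" for t
  have vLp: "v \<in> Lp_space p T"
    unfolding v_def[abs_def] using p by (intro Lp_space_sum Lp_space_scaleR directionsD(1) w) auto
  have fi: "integrable M (\<lambda>t. \<beta> i * f t (ustar t + w i t))" if "i < m" for i
    using directionsD(2)[OF w[OF that]] by simp
  have g: "integrable M (\<lambda>t. \<Sum>i<m. \<beta> i * f t (ustar t + w i t))"
    by (intro Bochner_Integration.integrable_sum fi) simp
  have le: "AE t in M. f t (ustar t + v t) \<le> (\<Sum>i<m. \<beta> i * f t (ustar t + w i t))"
    using f_convex
  proof eventually_elim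
    case (elim t)
    have "ustar t + v t = (\<Sum>i<m. \<beta> i *\<^sub>R (ustar t + w i t))"
      by (simp add: v_def scaleR_add_right sum.distrib scaleR_sum_left[symmetric] \<beta>(2))
    then show ?case
      using convex_on_sum[of "{..<m}" UNIV "f t" \<beta> "\<lambda>i. ustar t + w i t"] elim \<beta> m by simp
  qed
  have vm: "(\<lambda>t. ustar t + v t) \<in> borel_measurable M"
    using Lp_space_measurable[OF ustar] Lp_space_measurable[OF vLp] by measurable
  have fv: "integrable M (\<lambda>t. f t (ustar t + v t))" by (rule f_comp_integrable[OF vm g le])
  then have "v \<in> directions" using vLp by (simp add: directions_def)
  then obtain \<theta> where \<theta>: "\<theta> \<in> argmax" "0 \<le> gain v - sens v \<theta>" using directional_derivative by blast
  then have \<theta>': "\<theta> \<in> \<Theta>" by (simp add: argmax_def)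
  have "(LINT t|M. f t (ustar t + v t)) \<le> (LINT t|M. (\<Sum>i<m. \<beta> i * f t (ustar t + w i t)))"
    by (rule integral_mono_AE[OF fv g le])
  also have "\<dots> = (\<Sum>i<m. \<beta> i * (LINT t|M. f t (ustar t + w i t)))"
    using fi by (simp add: Bochner_Integration.integral_sum)
  finally have gain_v: "gain v \<le> (\<Sum>i<m. \<beta> i * gain (w i))"
    by (simp add: gain_def right_diff_distrib sum_subtractf sum_distrib_right[symmetric] \<beta>(2))
  have "sens v \<theta> = (\<Sum>i<m. \<beta> i * sens (w i) \<theta>)"
  proof -
    let ?\<phi> = "\<lambda>j t. \<Lambda> t \<theta> \<bullet> G j (X t \<theta>) \<theta>"
    have int: "(\<lambda>t. \<Sum>j\<in>UNIV. dir (w i) j t * ?\<phi> j t) integrable_on {0..T}" if "i < m" for i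
    proof (intro absolutely_integrable_on_imp_integrable_on absolutely_integrable_sum absolutely_integrable_mult_continuous)
      fix j
      show "dir (w i) j absolutely_integrable_on {0..T}"
        using admissible_dir[OF directionsD(1)[OF w[OF that]]] by (simp add: sys.admissible_def)
      show "continuous_on {0..T} (?\<phi> j)"
        by (intro continuous_on_inner sys.continuous_on_slice[OF \<Lambda>_cont \<theta>']
            sys.continuous_on_slice[OF sys.comp_cont[OF sys.G_cont St_cont[OF ustar]] \<theta>'])
    qed simp
    have "dir v j t = (\<Sum>i<m. \<beta> i * dir (w i) j t)" for j t
      by (cases j) (simp_all add: dir_def v_def)
    then have "(\<Sum>j\<in>UNIV. dir v j t * ?\<phi> j t) = (\<Sum>i<m. \<beta> i * (\<Sum>j\<in>UNIV. dir (w i) j t * ?\<phi> j t))" for t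
      by (simp add: sum_distrib_left sum_distrib_right mult.assoc sum.swap[of _ UNIV])
    then show ?thesis
      unfolding sys.sensitivity_def
      using Henstock_Kurzweil_Integration.integral_sum[of "{..<m}" "\<lambda>i t. \<beta> i * (\<Sum>j\<in>UNIV. dir (w i) j t * ?\<phi> j t)" "{0..T}"]
        integrable_on_mult_right[OF int]
      by simp
  qed
  with gain_v \<theta>(2) have "0 \<le> (\<Sum>i<m. \<beta> i * (gain (w i) - sens (w i) \<theta>))"
    by (simp add: right_diff_distrib sum_subtractf)
  also have "\<dots> = (\<Sum>i<m. \<alpha> i * (gain (w i) - sens (w i) \<theta>)) / A"
    by (simp add: \<beta>_def sum_divide_distrib)
  finally show ?thesis using A \<theta>(1) by (auto simp: zero_le_divide_iff)
qed

end

text \<open>By continuity the indefinite integral is monotone once its increments between rational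
  points are nonnegative, and almost everywhere \<open>\<kappa>\<close> is the derivative of this
  monotone function.\<close>

lemma AE_nonneg_if_rational_interval_integrals:
  fixes \<kappa> :: "real \<Rightarrow> real"
  assumes int: "\<kappa> integrable_on {0..T}"
    and nonneg: "\<And>r s. \<lbrakk>r \<in> \<rat>; s \<in> \<rat>; 0 \<le> r; r \<le> s; s \<le> T\<rbrakk> \<Longrightarrow> 0 \<le> integral {r..s} \<kappa>"
  shows "AE t in lebesgue_on {0..T}. 0 \<le> \<kappa> t"
proof -
  define x where "x t = integral {0..t} \<kappa>" for t
  have x_diff: "x s - x r = integral {r..s} \<kappa>" if "0 \<le> r" "r \<le> s" "s \<le> T" for r s
    using Henstock_Kurzweil_Integration.integral_combine[of 0 r s \<kappa>] that
      integrable_on_subinterval[OF int, of 0 s] by (auto simp: x_def algebra_simps)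
  have cont: "continuous_on {0..T} x"
    unfolding x_def[abs_def] by (rule indefinite_integral_continuous_1[OF int])
  have mono: "mono_on {0<..<T} x"
  proof (rule mono_onI, rule ccontr)
    fix s t assume st: "s \<in> {0<..<T}" "t \<in> {0<..<T}" "s \<le> t" "\<not> x s \<le> x t"
    define e where "e = (x s - x t) / 2"
    have e: "e > 0" and "s < t" using st by (auto simp: e_def order.strict_iff_order)
    obtain d1 where d1: "d1 > 0" "\<And>y. \<lbrakk>y \<in> {0..T}; dist y s < d1\<rbrakk> \<Longrightarrow> dist (x y) (x s) < e"
      using cont st(1) e unfolding continuous_on_iff
      by (metis atLeastAtMost_iff greaterThanLessThan_iff less_imp_le)
    obtain d2 where d2: "d2 > 0" "\<And>y. \<lbrakk>y \<in> {0..T}; dist y t < d2\<rbrakk> \<Longrightarrow> dist (x y) (x t) < e"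
      using cont st(2) e unfolding continuous_on_iff
      by (metis atLeastAtMost_iff greaterThanLessThan_iff less_imp_le)
    \<comment> \<open>\<open>r1\<close> and \<open>r2\<close> stay on either side of the midpoint,
      hence in order, and each replacement changes the value by less than half of the supposed
      drop.\<close>
    obtain r1 where r1: "r1 \<in> \<rat>" "s < r1" "r1 < min (s + d1) ((s + t) / 2)"
      using Rats_dense_in_real[of s "min (s + d1) ((s + t) / 2)"] d1(1) \<open>s < t\<close> by auto
    obtain r2 where r2: "r2 \<in> \<rat>" "max (t - d2) ((s + t) / 2) < r2" "r2 < t"
      using Rats_dense_in_real[of "max (t - d2) ((s + t) / 2)" t] d2(1) \<open>s < t\<close> by auto
    have "0 \<le> x r2 - x r1"
      using nonneg[of r1 r2] x_diff[of r1 r2] r1 r2 st by auto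
    moreover have "dist (x r1) (x s) < e" using r1 r2 st by (intro d1) (auto simp: dist_real_def)
    then have "x s - x r1 < e" by (simp add: dist_real_def abs_less_iff)
    moreover have "dist (x r2) (x t) < e" using r1 r2 st by (intro d2) (auto simp: dist_real_def)
    then have "x r2 - x t < e" by (simp add: dist_real_def abs_less_iff)
    ultimately have "x s - x t < 2 * e" by linarith
    then show False by (simp add: e_def)
  qed
  obtain N where N: "negligible N"
    "\<And>t. t \<in> {0..T} - N \<Longrightarrow> ((\<lambda>t. integral {0..t} \<kappa>) has_vector_derivative \<kappa> t) (at t within {0..T})"
    using has_vector_derivative_indefinite_integral_AE[OF int] by metis
  \<comment> \<open>The end points are discarded because the derivative must be two-sided.\<close>
  have "0 \<le> \<kappa> t" if t: "t \<in> {0..T} - (N \<union> {0, T})" for t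
  proof (rule mono_on_imp_deriv_nonneg[OF mono])
    have "at t within {0..T} = at t" using t by (intro at_within_interior) auto
    then show "(x has_real_derivative \<kappa> t) (at t)"
      using N(2)[of t] t by (simp add: has_real_derivative_iff_has_vector_derivative x_def[abs_def])
    show "t \<in> interior {0<..<T}" using t by (auto simp: interior_open)
  qed
  moreover have "negligible (N \<union> {0, T})" using N(1) by simp
  ultimately have "\<exists>N'. negligible N' \<and> (\<forall>t\<in>{0..T} - N'. 0 \<le> \<kappa> t)" by blast
  then show ?thesis by (subst AE_lebesgue_on_iff) auto
qed

context ensemble_problem
begin

text \<open>Moves the control to the constant \<open>v\<close> on an interval that need not be
  short. The cutoff \<open>n\<close> ensures finite cost, since \<open>f t v\<close> need not be
  integrable in \<open>t\<close>.\<close>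

definition spike :: "real \<Rightarrow> real \<Rightarrow> real^'k \<Rightarrow> nat \<Rightarrow> real \<Rightarrow> real^'k" where
  "spike r s v n t = (if t \<in> {r..s} \<and> \<bar>f t v\<bar> \<le> real n then v - ustar t else 0)"

lemma spike_directions: "spike r s v n \<in> directions"
proof -
  note um = Lp_space_measurable[OF ustar]
  have pred: "Measurable.pred M (\<lambda>t. t \<in> {r..s} \<and> \<bar>f t v\<bar> \<le> real n)"
  proof -
    have "(\<lambda>t. t) \<in> borel_measurable M"
      by (rule continuous_imp_measurable_on_sets_lebesgue) (auto intro: continuous_on_id)
    then have [measurable]: "Measurable.pred M (\<lambda>t. t \<in> {r..s})" by measurable
    show ?thesis using f_measurable[of v] by measurable
  qed
  have m: "spike r s v n \<in> borel_measurable M"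
    unfolding spike_def[abs_def] using pred um by measurable
  have const: "(\<lambda>t. v) \<in> Lp_space p T"
    by (rule Lp_spaceI[where g = "\<lambda>_. norm v powr p"]) (auto intro: integrable_const_ivl)
  have d: "(\<lambda>t. v - ustar t) \<in> Lp_space p T"
    using Lp_space_add[OF const Lp_space_scaleR[OF ustar, of "-1"]] p by simp
  have "spike r s v n \<in> Lp_space p T"
    by (rule Lp_spaceI[OF m, where g = "\<lambda>t. norm (v - ustar t) powr p"])
       (use d in \<open>auto simp: Lp_space_def spike_def\<close>)
  moreover have "integrable M (\<lambda>t. f t (ustar t + spike r s v n t))"
  proof (rule f_comp_integrable)
    show "(\<lambda>t. ustar t + spike r s v n t) \<in> borel_measurable M" using um m by measurable
    show "integrable M (\<lambda>t. real n + \<bar>f t (ustar t)\<bar>)"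
      using ustar_finite by (auto intro!: Bochner_Integration.integrable_add integrable_const_ivl)
    show "AE t in M. f t (ustar t + spike r s v n t) \<le> real n + \<bar>f t (ustar t)\<bar>"
      by (intro AE_I2) (auto simp: spike_def)
  qed
  ultimately show ?thesis by (simp add: directions_def)
qed

lemma exists_multiplier:
  assumes w: "\<And>i. w i \<in> directions"
  obtains \<mu> where "prob_space \<mu>" "sets \<mu> = sets borel" "AE \<theta> in \<mu>. \<theta> \<in> argmax"
    "\<And>i :: nat. 0 \<le> (LINT \<theta>|\<mu>. indicator argmax \<theta> * (gain (w i) - sens (w i) \<theta>))"
proof (rule minimax_measure[OF argmax_compact, of "\<lambda>i \<theta>. gain (w i) - sens (w i) \<theta>"])
  show "continuous_on argmax (\<lambda>\<theta>. gain (w i) - sens (w i) \<theta>)" for i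
    by (intro continuous_intros continuous_on_subset[OF sens_cont[OF directionsD(1)[OF w]]])
       (auto simp: argmax_def)
  show "\<exists>\<theta>\<in>argmax. 0 \<le> (\<Sum>i<m. \<alpha> i * (gain (w i) - sens (w i) \<theta>))" if "\<And>i. 0 \<le> \<alpha> i" for m \<alpha>
    using convex_combination[of m w \<alpha>] w that by blast
qed (rule that)

text \<open>States and adjoints carry no information for parameters outside \<open>\<Theta>\<close>.
  A bounded continuous extension provides joint Borel measurability and a uniform bound for Fubini's
  theorem, with a measure on the whole space.\<close>

lemma switching_extension:
  obtains \<Psi> :: "real \<times> (real^'l) \<Rightarrow> real^'k" and B where "continuous_on UNIV \<Psi>" "\<And>q. norm (\<Psi> q) \<le> B"
    "\<And>t \<theta>. t \<in> {0..T} \<Longrightarrow> \<theta> \<in> \<Theta> \<Longrightarrow> \<Psi> (t, \<theta>) = \<Lambda> t \<theta> v* field_matrix F (X t \<theta>) \<theta>"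
proof -
  let ?\<psi> = "\<lambda>q. \<Lambda> (fst q) (snd q) v* field_matrix F (X (fst q) (snd q)) (snd q)"
  have "continuous_on ({0..T} \<times> \<Theta>) (\<lambda>q. ?\<psi> q $ j)" for j
    using continuous_on_inner[OF \<Lambda>_cont sys.comp_cont[OF sys.G_cont[of "Some j"] St_cont[OF ustar]]]
    by (simp add: vector_field_matrix_mult G_def split_def)
  then have cont: "continuous_on ({0..T} \<times> \<Theta>) ?\<psi>"
    by (subst continuous_on_componentwise) (auto simp: Basis_vec_def inner_axis)
  have comp: "compact ({0..T} \<times> \<Theta>)" by (intro compact_Times \<Theta>) auto
  obtain B where B: "B > 0" "\<And>q. q \<in> {0..T} \<times> \<Theta> \<Longrightarrow> norm (?\<psi> q) \<le> B"
    by (rule continuous_on_compact_norm_bound[OF comp cont]) (rule that)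
  show ?thesis
  proof (rule Tietze[OF cont, of UNIV B])
    show "closedin (top_of_set UNIV) ({0..T} \<times> \<Theta>)" using comp by (simp add: compact_imp_closed)
    fix \<Psi> assume \<Psi>: "continuous_on UNIV \<Psi>" "\<And>q. q \<in> {0..T} \<times> \<Theta> \<Longrightarrow> \<Psi> q = ?\<psi> q" "\<And>q. q \<in> UNIV \<Longrightarrow> norm (\<Psi> q) \<le> B"
    show thesis
      by (rule that[of \<Psi> B]) (use \<Psi> in auto)
  qed (use B in auto)
qed

text \<open>Passes from the gauge integral in \<open>sensitivity\<close> to the Lebesgue integral
  that Fubini's theorem works with.\<close>

lemma sens_eq_integral:
  assumes w: "w \<in> Lp_space p T" and \<theta>: "\<theta> \<in> \<Theta>" and \<Psi>: "continuous_on UNIV \<Psi>"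
    and eq: "\<And>t \<theta>. t \<in> {0..T} \<Longrightarrow> \<theta> \<in> \<Theta> \<Longrightarrow> \<Psi> (t, \<theta>) = \<Lambda> t \<theta> v* field_matrix F (X t \<theta>) \<theta>"
  shows "sens w \<theta> = (LINT t|M. w t \<bullet> \<Psi> (t, \<theta>))"
proof -
  have 1: "(\<Sum>i\<in>UNIV. dir w i t * (\<Lambda> t \<theta> \<bullet> G i (X t \<theta>) \<theta>)) = w t \<bullet> \<Psi> (t, \<theta>)" if "t \<in> {0..T}" for t
    using eq[OF that \<theta>]
    by (simp add: sum_UNIV_option dir_def G_def inner_vec_def[where ?'a = real and ?'b = 'k] vector_field_matrix_mult)
  have c: "continuous_on {0..T} (\<lambda>t. \<Psi> (t, \<theta>) $ j)" for j
    by (intro continuous_intros continuous_on_compose2[OF \<Psi>]) auto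
  have "(\<lambda>t. \<Sum>j\<in>UNIV. w t $ j * \<Psi> (t, \<theta>) $ j) absolutely_integrable_on {0..T}"
    by (intro absolutely_integrable_sum absolutely_integrable_mult_continuous Lp_component w c) simp
  then have "(\<lambda>t. w t \<bullet> \<Psi> (t, \<theta>)) absolutely_integrable_on {0..T}"
    by (simp add: inner_vec_def)
  then have "integrable M (\<lambda>t. w t \<bullet> \<Psi> (t, \<theta>))"
    by (simp add: absolutely_integrable_imp_integrable)
  then have "(LINT t|M. w t \<bullet> \<Psi> (t, \<theta>)) = integral {0..T} (\<lambda>t. w t \<bullet> \<Psi> (t, \<theta>))"
    by (simp add: lebesgue_integral_eq_integral)
  also have "\<dots> = sens w \<theta>"
    unfolding sys.sensitivity_def using 1 by (intro Henstock_Kurzweil_Integration.integral_cong) simp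
  finally show ?thesis by simp
qed

text \<open>Fubini's theorem with the dominating function \<open>B * norm (w t)\<close>, integrable
  because \<open>w\<close> belongs to \<open>Lp_space p T\<close> over a bounded interval.\<close>

lemma averaged_sens:
  fixes \<Psi> :: "real \<times> (real^'l) \<Rightarrow> real^'k"
  assumes \<mu>: "prob_space \<mu>" "sets \<mu> = sets borel" and w: "w \<in> Lp_space p T"
    and \<Psi>: "continuous_on UNIV \<Psi>" "\<And>q. norm (\<Psi> q) \<le> B"
  shows "integrable \<mu> (\<lambda>\<theta>. LINT t|M. w t \<bullet> \<Psi> (t, \<theta>))"
    "integrable M (\<lambda>t. w t \<bullet> (LINT \<theta>|\<mu>. \<Psi> (t, \<theta>)))"
    "(LINT \<theta>|\<mu>. LINT t|M. w t \<bullet> \<Psi> (t, \<theta>)) = (LINT t|M. w t \<bullet> (LINT \<theta>|\<mu>. \<Psi> (t, \<theta>)))"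
proof -
  interpret \<mu>: prob_space \<mu> by (rule \<mu>(1))
  interpret M: finite_measure M by (rule finite_measure_lebesgue_on) simp
  interpret pair_sigma_finite \<mu> M ..
  note wm[measurable] = Lp_space_measurable[OF w]
  have \<Psi>m[measurable]: "\<Psi> \<in> borel_measurable (borel \<Otimes>\<^sub>M borel)"
    using borel_measurable_continuous_onI[OF \<Psi>(1)] by (simp add: borel_prod)
  have idM[measurable]: "(\<lambda>t. t) \<in> borel_measurable M"
    by (rule continuous_imp_measurable_on_sets_lebesgue) (auto intro: continuous_on_id)
  have id\<mu>[measurable]: "(\<lambda>\<theta>. \<theta>) \<in> borel_measurable \<mu>"
    using measurable_ident_sets[OF \<mu>(2)] by (simp add: id_def)
  have swap: "(\<lambda>q. (snd q, fst q)) \<in> \<mu> \<Otimes>\<^sub>M M \<rightarrow>\<^sub>M borel \<Otimes>\<^sub>M borel"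
    by (intro measurable_Pair measurable_compose[OF measurable_snd idM] measurable_compose[OF measurable_fst id\<mu>])
  have \<Psi>s: "(\<lambda>q. \<Psi> (snd q, fst q)) \<in> borel_measurable (\<mu> \<Otimes>\<^sub>M M)"
    using measurable_compose[OF swap \<Psi>m] .
  have g: "(\<lambda>(\<theta>, t). w t \<bullet> \<Psi> (t, \<theta>)) \<in> borel_measurable (\<mu> \<Otimes>\<^sub>M M)"
    unfolding split_def by (intro borel_measurable_inner \<Psi>s measurable_compose[OF measurable_snd wm])
  have wi: "integrable M w" using Lp_space_imp_integrable[OF w] p by simp
  have bound: "norm (w t \<bullet> \<Psi> (t, \<theta>)) \<le> B * norm (w t)" for t \<theta>
  proof -
    have "norm (w t \<bullet> \<Psi> (t, \<theta>)) \<le> norm (w t) * norm (\<Psi> (t, \<theta>))"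
      by (simp add: Cauchy_Schwarz_ineq2)
    also have "\<dots> \<le> norm (w t) * B" by (intro mult_left_mono \<Psi>(2)) auto
    finally show ?thesis by (simp add: mult.commute)
  qed
  have Bw: "integrable M (\<lambda>t. B * norm (w t))" using wi by simp
  have slice_m: "(\<lambda>t. w t \<bullet> \<Psi> (t, \<theta>)) \<in> borel_measurable M" if "\<theta> \<in> space \<mu>" for \<theta>
    using measurable_Pair2[OF g that] by simp
  have slice: "integrable M (\<lambda>t. w t \<bullet> \<Psi> (t, \<theta>))" if "\<theta> \<in> space \<mu>" for \<theta>
    by (rule Bochner_Integration.integrable_bound[OF Bw slice_m[OF that]])
       (intro AE_I2 order_trans[OF bound], simp)
  have int: "integrable (\<mu> \<Otimes>\<^sub>M M) (\<lambda>(\<theta>, t). w t \<bullet> \<Psi> (t, \<theta>))"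
  proof (rule Fubini_integrable[OF g])
    have "(\<lambda>\<theta>. LINT t|M. norm (case (\<theta>, t) of (\<theta>, t) \<Rightarrow> w t \<bullet> \<Psi> (t, \<theta>))) \<in> borel_measurable \<mu>"
      by (intro M.borel_measurable_lebesgue_integral) (use g in \<open>simp add: split_def\<close>)
    moreover have "norm (LINT t|M. norm (case (\<theta>, t) of (\<theta>, t) \<Rightarrow> w t \<bullet> \<Psi> (t, \<theta>))) \<le> (LINT t|M. B * norm (w t))"
      if "\<theta> \<in> space \<mu>" for \<theta>
    proof -
      have "(LINT t|M. norm (w t \<bullet> \<Psi> (t, \<theta>))) \<le> (LINT t|M. B * norm (w t))"
        by (rule integral_mono[OF integrable_norm[OF slice[OF that]] Bw bound])
      moreover have "0 \<le> (LINT t|M. norm (w t \<bullet> \<Psi> (t, \<theta>)))" by (rule integral_nonneg_AE) simp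
      ultimately show ?thesis by (simp only: prod.case real_norm_def abs_of_nonneg)
    qed
    ultimately show "integrable \<mu> (\<lambda>\<theta>. LINT t|M. norm (case (\<theta>, t) of (\<theta>, t) \<Rightarrow> w t \<bullet> \<Psi> (t, \<theta>)))"
      by (intro \<mu>.integrable_const_bound) (auto intro: AE_I2)
    show "AE \<theta> in \<mu>. integrable M (\<lambda>t. case (\<theta>, t) of (\<theta>, t) \<Rightarrow> w t \<bullet> \<Psi> (t, \<theta>))"
      using slice by (intro AE_I2) simp
  qed
  have \<Psi>\<theta>: "integrable \<mu> (\<lambda>\<theta>. \<Psi> (t, \<theta>))" for t
  proof (rule \<mu>.integrable_const_bound[where B = B])
    have "continuous_on UNIV (\<lambda>\<theta>. \<Psi> (t, \<theta>))"
      by (rule continuous_on_compose2[OF \<Psi>(1)]) (auto intro!: continuous_intros)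
    then show "(\<lambda>\<theta>. \<Psi> (t, \<theta>)) \<in> borel_measurable \<mu>"
      using borel_measurable_continuous_onI \<mu>(2) by (metis measurable_cong_sets)
  qed (use \<Psi> in auto)
  have inner: "(LINT \<theta>|\<mu>. w t \<bullet> \<Psi> (t, \<theta>)) = w t \<bullet> (LINT \<theta>|\<mu>. \<Psi> (t, \<theta>))" for t
    by (rule integral_inner_right[OF \<Psi>\<theta>])
  show "integrable \<mu> (\<lambda>\<theta>. LINT t|M. w t \<bullet> \<Psi> (t, \<theta>))"
    using integrable_fst'[OF int] by simp
  show "integrable M (\<lambda>t. w t \<bullet> (LINT \<theta>|\<mu>. \<Psi> (t, \<theta>)))"
    using integrable_snd[OF int] by (simp add: inner)
  show "(LINT \<theta>|\<mu>. LINT t|M. w t \<bullet> \<Psi> (t, \<theta>)) = (LINT t|M. w t \<bullet> (LINT \<theta>|\<mu>. \<Psi> (t, \<theta>)))"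
    using Fubini_integral[OF int] by (simp add: inner)
qed

text \<open>Tested with spikes, the hypothesis says that \<open>\<kappa> v n\<close> has nonnegative
  integral over all rational intervals, so it is nonnegative almost everywhere. The pairs of
  \<open>v \<in> D\<close> and \<open>n\<close> are countable and share one exceptional set. At a
  remaining time each \<open>v \<in> D\<close> is reached by some
  \<open>n \<ge> \<bar>f t v\<bar>\<close>.\<close>

lemma pointwise_maximum:
  assumes D: "countable D" "\<And>S :: (real^'k) set. open S \<Longrightarrow> S \<noteq> {} \<Longrightarrow> \<exists>d\<in>D. d \<in> S"
    and q: "\<And>r s v n. r \<in> \<rat> \<Longrightarrow> s \<in> \<rat> \<Longrightarrow> v \<in> D \<Longrightarrow> integrable M (\<lambda>t. spike r s v n t \<bullet> q t) \<and>
      (LINT t|M. spike r s v n t \<bullet> q t) \<le> gain (spike r s v n)"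
    and qi: "\<And>w. w \<in> Lp_space p T \<Longrightarrow> integrable M (\<lambda>t. w t \<bullet> q t)"
  shows "AE t in M. \<forall>v. q t \<bullet> v - f t v \<le> q t \<bullet> ustar t - f t (ustar t)"
proof -
  define \<kappa> where "\<kappa> v n t = (if \<bar>f t v\<bar> \<le> real n then f t v - f t (ustar t) - (v - ustar t) \<bullet> q t else 0)" for v n t
  have spike_\<kappa>: "f t (ustar t + spike r s v n t) - f t (ustar t) - spike r s v n t \<bullet> q t
      = (if t \<in> {r..s} then \<kappa> v n t else 0)" for r s v n t
    by (simp add: spike_def \<kappa>_def)
  have int: "integrable M (\<lambda>t. if t \<in> {r..s} then \<kappa> v n t else 0)" for r s v n
    unfolding spike_\<kappa>[symmetric]
    by (intro Bochner_Integration.integrable_diff directionsD(2) spike_directions ustar_finite qi directionsD(1))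
  have "AE t in M. 0 \<le> \<kappa> v n t" if v: "v \<in> D" for v n
  proof (rule AE_nonneg_if_rational_interval_integrals)
    have "integrable M (\<kappa> v n)"
      by (rule Bochner_Integration.integrable_cong[THEN iffD1, OF refl _ int[of 0 T v n]]) simp
    then show \<kappa>i: "\<kappa> v n integrable_on {0..T}" by (rule integrable_on_lebesgue_on) simp
    fix r s assume rs: "r \<in> \<rat>" "s \<in> \<rat>" "0 \<le> r" "r \<le> s" "s \<le> T"
    have "0 \<le> gain (spike r s v n) - (LINT t|M. spike r s v n t \<bullet> q t)" using q[OF rs(1,2) v] by simp
    also have "\<dots> = (LINT t|M. f t (ustar t + spike r s v n t) - f t (ustar t) - spike r s v n t \<bullet> q t)"
      using directionsD(2)[OF spike_directions[of r s v n]] ustar_finite qi[OF directionsD(1)[OF spike_directions[of r s v n]]]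
      by (simp add: gain_def)
    also have "\<dots> = (LINT t|M. (if t \<in> {r..s} then \<kappa> v n t else 0))" unfolding spike_\<kappa> ..
    also have "\<dots> = integral {0..T} (\<lambda>t. if t \<in> {r..s} then \<kappa> v n t else 0)"
      by (rule lebesgue_integral_eq_integral[OF int]) simp
    also have "\<dots> = integral {r..s} (\<kappa> v n)"
      using rs by (subst Henstock_Kurzweil_Integration.integral_restrict_Int) (simp add: max_def min_def)
    finally show "0 \<le> integral {r..s} (\<kappa> v n)" .
  qed
  then have "AE t in M. \<forall>v\<in>D. \<forall>n. 0 \<le> \<kappa> v n t"
    using D(1) by (simp add: AE_ball_countable AE_all_countable)
  then show ?thesis
    using f_convex
  proof eventually_elim
    case (elim t)
    have onD: "0 \<le> f t v - f t (ustar t) - (v - ustar t) \<bullet> q t" if "v \<in> D" for v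
    proof -
      obtain n where n: "\<bar>f t v\<bar> \<le> real n" using real_arch_simple by blast
      have "0 \<le> \<kappa> v n t" using elim(1) that by blast
      then show ?thesis using n by (simp add: \<kappa>_def)
    qed
    \<comment> \<open>Continuity of \<open>f t\<close> makes the set of violations open, so a
      nonempty one would contain a point of the dense set \<open>D\<close>.\<close>
    define S where "S = {v. f t v - f t (ustar t) - (v - ustar t) \<bullet> q t < 0}"
    have "open S"
      unfolding S_def by (intro open_Collect_less continuous_intros conjunct1[OF elim(2)])
    then have "S = {}" using D(2)[of S] onD by (fastforce simp: S_def)
    then have "0 \<le> f t v - f t (ustar t) - (v - ustar t) \<bullet> q t" for v by (auto simp: S_def not_less)
    then show ?case by (simp add: inner_diff_left inner_commute algebra_simps)
  qed
qed

theorem maximum_principle: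
  "\<exists>\<mu>\<in>borel_prob_measures \<Theta>.
     (AE t in M. is_arg_max (\<lambda>v. (LINT \<theta>|\<mu>. (\<Lambda> t \<theta> v* field_matrix F (X t \<theta>) \<theta>) \<bullet> v) - f t v)
                         (\<lambda>v. v \<in> UNIV) (ustar t)) \<and>
     (\<forall>\<theta>\<in>measure_support \<mu>. a (X T \<theta>) \<theta> = (SUP \<eta>\<in>\<Theta>. a (X T \<eta>) \<eta>))"
proof -
  obtain D :: "(real^'k) set" where D: "countable D" "\<And>S. open S \<Longrightarrow> S \<noteq> {} \<Longrightarrow> \<exists>d\<in>D. d \<in> S"
    using countable_dense_setE by blast
  then have "D \<noteq> {}" using open_UNIV by blast
  \<comment> \<open>All spikes to be tested are enumerated in advance, so that a single measure
    serves them all.\<close>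
  define I where "I = (\<rat> :: real set) \<times> (\<rat> :: real set) \<times> D \<times> (UNIV :: nat set)"
  have "countable I" unfolding I_def using D(1) countable_rat by (intro countable_SIGMA) auto
  moreover have "I \<noteq> {}" using \<open>D \<noteq> {}\<close> Rats_0 by (auto simp: I_def)
  ultimately have range_I: "range (from_nat_into I) = I" by (rule range_from_nat_into[rotated])
  define w where "w i = (case from_nat_into I i of (r, s, v, n) \<Rightarrow> spike r s v n)" for i
  have w_dir: "w i \<in> directions" for i
    by (simp add: w_def spike_directions split: prod.split)
  have w_onto: "\<exists>i. w i = spike r s v n" if "r \<in> \<rat>" "s \<in> \<rat>" "v \<in> D" for r s v n
  proof -
    have "(r, s, v, n) \<in> range (from_nat_into I)" using that unfolding range_I by (simp add: I_def)
    then obtain i where "from_nat_into I i = (r, s, v, n)" by auto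
    then show ?thesis by (intro exI[of _ i]) (simp add: w_def)
  qed
  obtain \<mu> where \<mu>: "prob_space \<mu>" "sets \<mu> = sets borel" "AE \<theta> in \<mu>. \<theta> \<in> argmax"
    "\<And>i :: nat. 0 \<le> (LINT \<theta>|\<mu>. indicator argmax \<theta> * (gain (w i) - sens (w i) \<theta>))"
    by (rule exists_multiplier[of w, OF w_dir]) (rule that)
  interpret \<mu>: prob_space \<mu> by (rule \<mu>(1))
  obtain \<Psi> :: "real \<times> (real^'l) \<Rightarrow> real^'k" and B where \<Psi>: "continuous_on UNIV \<Psi>" "\<And>q. norm (\<Psi> q) \<le> B"
    "\<And>t \<theta>. t \<in> {0..T} \<Longrightarrow> \<theta> \<in> \<Theta> \<Longrightarrow> \<Psi> (t, \<theta>) = \<Lambda> t \<theta> v* field_matrix F (X t \<theta>) \<theta>"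
    by (rule switching_extension) (rule that)
  define q where "q t = (LINT \<theta>|\<mu>. \<Psi> (t, \<theta>))" for t
  note avg = averaged_sens[OF \<mu>(1,2) _ \<Psi>(1,2), folded q_def]
  have "(LINT t|M. w i t \<bullet> q t) \<le> gain (w i)" for i
  proof -
    note wLp = directionsD(1)[OF w_dir[of i]]
    let ?s = "\<lambda>\<theta>. LINT t|M. w i t \<bullet> \<Psi> (t, \<theta>)"
    have am: "argmax \<in> sets \<mu>" using argmax_compact \<mu>(2) by (simp add: borel_compact)
    have "(\<lambda>\<theta>. indicator argmax \<theta> * (gain (w i) - sens (w i) \<theta>)) = (\<lambda>\<theta>. indicator argmax \<theta> * (gain (w i) - ?s \<theta>))"
      using sens_eq_integral[OF wLp _ \<Psi>(1,3)] by (auto simp: fun_eq_iff indicator_def argmax_def)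
    then have "0 \<le> (LINT \<theta>|\<mu>. indicator argmax \<theta> * (gain (w i) - ?s \<theta>))" using \<mu>(4)[of i] by simp
    also have "\<dots> = (LINT \<theta>|\<mu>. gain (w i) - ?s \<theta>)"
    proof (rule integral_cong_AE)
      have [measurable]: "?s \<in> borel_measurable \<mu>" using avg(1)[OF wLp] by (rule borel_measurable_integrable)
      show "(\<lambda>\<theta>. gain (w i) - ?s \<theta>) \<in> borel_measurable \<mu>" by measurable
      show "(\<lambda>\<theta>. indicator argmax \<theta> * (gain (w i) - ?s \<theta>)) \<in> borel_measurable \<mu>" using am by measurable
      show "AE \<theta> in \<mu>. indicator argmax \<theta> * (gain (w i) - ?s \<theta>) = gain (w i) - ?s \<theta>"
        using \<mu>(3) by eventually_elim simp
    qed
    also have "\<dots> = gain (w i) - (LINT t|M. w i t \<bullet> q t)"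
      using avg(1)[OF wLp] by (simp add: avg(3)[OF wLp] \<mu>.prob_space)
    finally show ?thesis by simp
  qed
  then have "integrable M (\<lambda>t. spike r s v n t \<bullet> q t) \<and> (LINT t|M. spike r s v n t \<bullet> q t) \<le> gain (spike r s v n)"
    if "r \<in> \<rat>" "s \<in> \<rat>" "v \<in> D" for r s v n
    using w_onto[OF that] avg(2)[OF directionsD(1)[OF spike_directions]] by metis
  then have max: "AE t in M. \<forall>v. q t \<bullet> v - f t v \<le> q t \<bullet> ustar t - f t (ustar t)"
    using avg(2) by (intro pointwise_maximum[OF D]) auto
  \<comment> \<open>The minimax measure lives on the whole Euclidean space, whereas
    \<open>borel_prob_measures\<close> asks for \<open>\<Theta>\<close> as the underlying
    space.\<close>
  define \<mu>' where "\<mu>' = restrict_space \<mu> \<Theta>"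
  have \<Theta>_sets: "\<Theta> \<in> sets \<mu>" using \<Theta>(1) \<mu>(2) by (simp add: borel_compact)
  have space: "space \<mu>' = \<Theta>"
    using sets.sets_into_space[OF \<Theta>_sets] by (auto simp: \<mu>'_def space_restrict_space)
  have AE_\<Theta>: "AE \<theta> in \<mu>. \<theta> \<in> \<Theta>" using \<mu>(3) by eventually_elim (simp add: argmax_def)
  have "emeasure \<mu>' (space \<mu>') = 1"
    using \<mu>.emeasure_eq_1_AE[OF \<Theta>_sets AE_\<Theta>] \<Theta>_sets space
    by (simp add: \<mu>'_def emeasure_restrict_space)
  then have "\<mu>' \<in> borel_prob_measures \<Theta>"
    using sets_restrict_space_cong[OF \<mu>(2)] by (simp add: borel_prob_measures_def \<mu>'_def)
  moreover have q_eq: "(LINT \<theta>|\<mu>'. (\<Lambda> t \<theta> v* field_matrix F (X t \<theta>) \<theta>) \<bullet> v) = q t \<bullet> v" if t: "t \<in> {0..T}" for t v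
  proof -
    have "continuous_on UNIV (\<lambda>\<theta>. \<Psi> (t, \<theta>))"
      by (rule continuous_on_compose2[OF \<Psi>(1)]) (auto intro!: continuous_intros)
    then have m: "(\<lambda>\<theta>. \<Psi> (t, \<theta>)) \<in> borel_measurable \<mu>"
      using borel_measurable_continuous_onI \<mu>(2) by (metis measurable_cong_sets)
    have i: "integrable \<mu> (\<lambda>\<theta>. \<Psi> (t, \<theta>))"
      by (rule \<mu>.integrable_const_bound[where B = B, OF _ m]) (use \<Psi>(2) in auto)
    have "(LINT \<theta>|\<mu>'. (\<Lambda> t \<theta> v* field_matrix F (X t \<theta>) \<theta>) \<bullet> v) = (LINT \<theta>|\<mu>'. \<Psi> (t, \<theta>) \<bullet> v)"
      using \<Psi>(3)[OF t] by (intro Bochner_Integration.integral_cong) (auto simp: space)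
    also have "\<dots> = (LINT \<theta>|\<mu>. indicator \<Theta> \<theta> *\<^sub>R (\<Psi> (t, \<theta>) \<bullet> v))"
      unfolding \<mu>'_def using \<Theta>_sets by (intro integral_restrict_space) auto
    also have "\<dots> = (LINT \<theta>|\<mu>. \<Psi> (t, \<theta>) \<bullet> v)"
    proof (rule integral_cong_AE)
      show "(\<lambda>\<theta>. \<Psi> (t, \<theta>) \<bullet> v) \<in> borel_measurable \<mu>" using m by measurable
      then show "(\<lambda>\<theta>. indicator \<Theta> \<theta> *\<^sub>R (\<Psi> (t, \<theta>) \<bullet> v)) \<in> borel_measurable \<mu>" using \<Theta>_sets by measurable
      show "AE \<theta> in \<mu>. indicator \<Theta> \<theta> *\<^sub>R (\<Psi> (t, \<theta>) \<bullet> v) = \<Psi> (t, \<theta>) \<bullet> v"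
        using AE_\<Theta> by eventually_elim simp
    qed
    also have "\<dots> = q t \<bullet> v" unfolding q_def using i by (intro integral_inner_left) auto
    finally show ?thesis .
  qed
  have "AE t in M. is_arg_max (\<lambda>v. (LINT \<theta>|\<mu>'. (\<Lambda> t \<theta> v* field_matrix F (X t \<theta>) \<theta>) \<bullet> v) - f t v)
                         (\<lambda>v. v \<in> UNIV) (ustar t)"
    using max AE_space
  proof eventually_elim
    case (elim t)
    then have t: "t \<in> {0..T}" by simp
    show ?case using elim(1) by (simp add: is_arg_max_def q_eq[OF t] not_less)
  qed
  moreover have "a (X T \<theta>) \<theta> = (SUP \<eta>\<in>\<Theta>. a (X T \<eta>) \<eta>)" if \<theta>: "\<theta> \<in> measure_support \<mu>'" for \<theta>
  proof (rule ccontr)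
    assume "\<not> ?thesis"
    \<comment> \<open>The complement of the compact set \<open>argmax\<close> would be an open
      neighbourhood of the support point, although it carries no mass.\<close>
    then have "\<theta> \<in> - argmax" by (simp add: argmax_def worst_def)
    moreover have "open (- argmax)" using argmax_compact by (simp add: compact_imp_closed open_Compl)
    ultimately have pos: "emeasure \<mu>' (- argmax \<inter> \<Theta>) > 0"
      using \<theta> by (auto simp: measure_support_def space)
    have "argmax \<in> sets \<mu>" using argmax_compact \<mu>(2) by (simp add: borel_compact)
    then have am: "- argmax \<inter> \<Theta> \<in> sets \<mu>"
      using \<Theta>_sets by (metis Diff_eq inf_commute sets.Diff)
    have "emeasure \<mu>' (- argmax \<inter> \<Theta>) = emeasure \<mu> (- argmax \<inter> \<Theta>)"
      unfolding \<mu>'_def using \<Theta>_sets by (intro emeasure_restrict_space) auto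
    also have "\<dots> = 0"
    proof -
      have "AE \<theta> in \<mu>. \<theta> \<notin> - argmax \<inter> \<Theta>" using \<mu>(3) by eventually_elim simp
      then have "- argmax \<inter> \<Theta> \<in> null_sets \<mu>" using AE_iff_null_sets[OF am] by blast
      then show ?thesis by (rule null_setsD1)
    qed
    finally show False using pos by simp
  qed
  ultimately show ?thesis by blast
qed

end

theorem theorem4p5:
  fixes p T L C :: real
    and \<Theta> :: "(real^'l) set"
    and F0 :: "real^'d \<Rightarrow> real^'l \<Rightarrow> real^'d"
    and F :: "'k::finite \<Rightarrow> real^'d \<Rightarrow> real^'l \<Rightarrow> real^'d"
    and x0 :: "real^'l \<Rightarrow> real^'d"
    and a :: "real^'d \<Rightarrow> real^'l \<Rightarrow> real"
    and f :: "real \<Rightarrow> real^'k \<Rightarrow> real"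
    and c c' :: "real \<Rightarrow> real"
    and u' :: "real^'k"
    and ustar :: "real \<Rightarrow> real^'k"
    and X \<Lambda> :: "real \<Rightarrow> real^'l \<Rightarrow> real^'d"
  assumes "1 < p" and "0 < T"
    and "compact \<Theta>" and "\<Theta> \<noteq> {}"
    and "0 < L"
    and F0_lipschitz: "\<And>x1 x2 \<theta>1 \<theta>2. \<theta>1 \<in> \<Theta> \<Longrightarrow> \<theta>2 \<in> \<Theta> \<Longrightarrow>
           norm (F0 x1 \<theta>1 - F0 x2 \<theta>2) \<le> L * (norm (x1 - x2) + norm (x1 + x2) * norm (\<theta>1 - \<theta>2))"
    and F_lipschitz: "\<And>i x1 x2 \<theta>1 \<theta>2. \<theta>1 \<in> \<Theta> \<Longrightarrow> \<theta>2 \<in> \<Theta> \<Longrightarrow>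
           norm (F i x1 \<theta>1 - F i x2 \<theta>2) \<le> L * (norm (x1 - x2) + norm (x1 + x2) * norm (\<theta>1 - \<theta>2))"
    and x0_cont: "continuous_on \<Theta> x0"
    and a_nonneg: "\<And>x \<theta>. \<theta> \<in> \<Theta> \<Longrightarrow> 0 \<le> a x \<theta>"
    and a_cont: "continuous_on (UNIV \<times> \<Theta>) (\<lambda>(x, \<theta>). a x \<theta>)"
    and f_measurable: "\<And>v. (\<lambda>t. f t v) \<in> borel_measurable (lebesgue_on {0..T})"
    and f_convex: "AE t in lebesgue_on {0..T}. continuous_on UNIV (f t) \<and> convex_on UNIV (f t)"
    and c_L1: "integrable (lebesgue_on {0..T}) c" "\<And>t. t \<in> {0..T} \<Longrightarrow> 0 \<le> c t"
    and "0 < C"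
    and f_coercive: "AE t in lebesgue_on {0..T}. \<forall>v. f t v \<ge> C * norm v powr p - c t"
    and c'_L1: "integrable (lebesgue_on {0..T}) c'" "\<And>t. t \<in> {0..T} \<Longrightarrow> 0 \<le> c' t"
    and f_u': "AE t in lebesgue_on {0..T}. \<bar>f t u'\<bar> \<le> c' t"
    and F0_diff: "\<And>x \<theta>. \<theta> \<in> \<Theta> \<Longrightarrow> (\<lambda>z. F0 z \<theta>) differentiable (at x)"
    and F0_jacobian_cont: "continuous_on (UNIV \<times> \<Theta>) (\<lambda>(x, \<theta>). jacobian (\<lambda>z. F0 z \<theta>) (at x))"
    and F_diff: "\<And>i x \<theta>. \<theta> \<in> \<Theta> \<Longrightarrow> (\<lambda>z. F i z \<theta>) differentiable (at x)"
    and F_jacobian_cont: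
          "\<And>i. continuous_on (UNIV \<times> \<Theta>) (\<lambda>(x, \<theta>). jacobian (\<lambda>z. F i z \<theta>) (at x))"
    and a_diff: "\<And>x \<theta>. \<theta> \<in> \<Theta> \<Longrightarrow> (\<lambda>z. a z \<theta>) differentiable (at x)"
    and a_gradient_cont: "continuous_on (UNIV \<times> \<Theta>) (\<lambda>(x, \<theta>). gradient (\<lambda>z. a z \<theta>) x)"
    and local_min: "Lp_local_minimizer p T (cost_functional F0 F x0 a f T \<Theta>) ustar"
    and X_eq: "X = state_map F0 F x0 T ustar"
    and \<Lambda>_eq: "\<Lambda> = adjoint_map F0 F x0 a T ustar"
  shows "\<exists>\<mu>\<in>borel_prob_measures \<Theta>.
           (AE t in lebesgue_on {0..T}.
              is_arg_max (\<lambda>v. (LINT \<theta>|\<mu>. (\<Lambda> t \<theta> v* field_matrix F (X t \<theta>) \<theta>) \<bullet> v) - f t v)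
                         (\<lambda>v. v \<in> UNIV) (ustar t)) \<and>
           (\<forall>\<theta>\<in>measure_support \<mu>. a (X T \<theta>) \<theta> = (SUP \<eta>\<in>\<Theta>. a (X T \<eta>) \<eta>))"
proof -
  interpret ensemble_problem p T L C \<Theta> F0 F x0 a f c c' u' ustar
    by unfold_locales (fact assms)+
  show ?thesis
    unfolding X_eq \<Lambda>_eq by (rule maximum_principle)
qed

end
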